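(* Let $1<p<\infty$ and let $g\in L^\infty$ be a matching function (i.e. $g\widetilde g=1$) such that (i) the operator $T(g)$ is invertible on $H^p$; (ii) the function $g$ is continuous at the point $1$ or $-1$. Then $\boldsymbol\sigma(g)=g(1)$ or $\boldsymbol\sigma(g)=g(-1)$, respectively (that is, $\boldsymbol\sigma(g)=g(1)$ if $g$ is continuous at $1$, and $\boldsymbol\sigma(g)=g(-1)$ if $g$ is continuous at $-1$).
   Context: $\mathbb{T}$ is the unit circle, $L^p=L^p(\mathbb{T})$, $1/p+1/q=1$, $H^p=\{f\in L^p:\widehat f_n=0\text{ for }n<0\}$, $\overline{H^p}=\{f\in L^p:\widehat f_n=0\text{ for }n>0\}$; for $f\in H^p$, $f(0)=\widehat f_0$, and for $f\in\overline{H^p}$, $f(\infty)=\widehat f_0$. $P$ is the Riesz projection of $L^p$ onto $H^p$, $\widetilde a(t)=a(1/t)$, $T(a)f=P(af)$ on $H^p$. Wiener--Hopf factorization of $a\in L^\infty$ in $H^p$: $a=a_-t^{\nu}a_+$ with $\nu\in\mathbb{Z}$, $a_+\in H^q$, $a_+^{-1}\in H^p$, $a_-\in\overline{H^p}$, $a_-^{-1}\in\overline{H^q}$, $a_-(\infty)=1$, such that the operator $a_+^{-1}Pa_-^{-1}I$, defined on $\operatorname{span}\{t^k:k\ge0\}$, extends boundedly to $H^p$. It is unique, and it exists if and only if $T(a)$ is Fredholm on $H^p$, in which case $\nu=-\operatorname{ind}T(a)$. For a matching function $g$ with $T(g)$ Fredholm on $H^p$, with factorization $g=g_-t^{\nu}g_+$,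 one has $g_+(0)\in\{1,-1\}$; the factorization signature is $\boldsymbol\sigma(g):=g_+(0)$. If a matching function is continuous at $1$ (or $-1$), its value there is $1$ or $-1$. *)

theory Defs
  imports "HOL-Analysis.Analysis" "HOL-Computational_Algebra.Polynomial"
begin

text \<open>
  Elements of the function spaces on the unit circle are represented by Borel functions
  on the circle (extended arbitrarily to the plane); equality in \<open>L\<^sup>p\<close> is equality
  almost everywhere with respect to normalized arc length.
\<close>

definition unit_circle :: "complex set" where
  "unit_circle = sphere 0 1"

definition circle_measure :: "complex measure" where
  "circle_measure =
     distr (uniform_measure lborel {0..2 * pi}) (restrict_space borel unit_circle) cis"

definition Lp :: "real \<Rightarrow> (complex \<Rightarrow> complex) set" where
  "Lp p = {f \<in> borel_measurable circle_measure.
             integrable circle_measure (\<lambda>t. norm (f t) powr p)}"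

definition Lp_norm :: "real \<Rightarrow> (complex \<Rightarrow> complex) \<Rightarrow> real" where
  "Lp_norm p f = (LINT t|circle_measure. norm (f t) powr p) powr (1 / p)"

definition Linf :: "(complex \<Rightarrow> complex) set" where
  "Linf = {f \<in> borel_measurable circle_measure.
             \<exists>C. AE t in circle_measure. norm (f t) \<le> C}"

definition fourier_coeff :: "(complex \<Rightarrow> complex) \<Rightarrow> int \<Rightarrow> complex" where
  "fourier_coeff f n = (LINT t|circle_measure. f t * t powi (- n))"

definition Hardy :: "real \<Rightarrow> (complex \<Rightarrow> complex) set" where
  "Hardy p = {f \<in> Lp p. \<forall>n<0. fourier_coeff f n = 0}"

definition conj_Hardy :: "real \<Rightarrow> (complex \<Rightarrow> complex) set" where
  "conj_Hardy p = {f \<in> Lp p. \<forall>n>0. fourier_coeff f n = 0}"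

definition conj_exponent :: "real \<Rightarrow> real" where
  "conj_exponent p = p / (p - 1)"

text \<open>
  For \<open>1 < p < \<infinity>\<close> and \<open>f \<in> L\<^sup>p\<close> a function \<open>h\<close> as below exists by M. Riesz's theorem,
  and it is unique up to equality almost everywhere.
\<close>

definition riesz_proj :: "real \<Rightarrow> (complex \<Rightarrow> complex) \<Rightarrow> complex \<Rightarrow> complex" where
  "riesz_proj p f =
     (SOME h. h \<in> Hardy p \<and> (\<forall>n\<ge>0. fourier_coeff h n = fourier_coeff f n))"

definition toeplitz ::
  "real \<Rightarrow> (complex \<Rightarrow> complex) \<Rightarrow> (complex \<Rightarrow> complex) \<Rightarrow> complex \<Rightarrow> complex" where
  "toeplitz p a f = riesz_proj p (\<lambda>t. a t * f t)"

text \<open>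
  Linearity is required up to null sets. Together with the norm bound it implies that
  \<open>A\<close> maps functions that agree almost everywhere to functions that agree almost
  everywhere, so that \<open>A\<close> induces a bounded linear operator on the Banach space \<open>H\<^sup>p\<close>.
\<close>

definition bounded_operator_Hardy ::
  "real \<Rightarrow> ((complex \<Rightarrow> complex) \<Rightarrow> complex \<Rightarrow> complex) \<Rightarrow> bool" where
  "bounded_operator_Hardy p A \<longleftrightarrow>
     (\<forall>f\<in>Hardy p. A f \<in> Hardy p) \<and>
     (\<forall>f\<in>Hardy p. \<forall>h\<in>Hardy p.
        AE t in circle_measure. A (\<lambda>s. f s + h s) t = A f t + A h t) \<and>
     (\<forall>c. \<forall>f\<in>Hardy p. AE t in circle_measure. A (\<lambda>s. c * f s) t = c * A f t) \<and>
     (\<exists>C. \<forall>f\<in>Hardy p. Lp_norm p (A f) \<le> C * Lp_norm p f)"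

definition invertible_operator_Hardy ::
  "real \<Rightarrow> ((complex \<Rightarrow> complex) \<Rightarrow> complex \<Rightarrow> complex) \<Rightarrow> bool" where
  "invertible_operator_Hardy p A \<longleftrightarrow>
     bounded_operator_Hardy p A \<and>
     (\<exists>B. bounded_operator_Hardy p B \<and>
        (\<forall>f\<in>Hardy p. (AE t in circle_measure. B (A f) t = f t) \<and>
                      (AE t in circle_measure. A (B f) t = f t)))"

text \<open>
  The conditions that the factors are nonzero almost everywhere make \<open>inverse\<close> the true
  reciprocal, since \<open>inverse 0 = 0\<close> in HOL. The polynomials \<open>r\<close> range over the span of
  the functions \<open>t\<^sup>k\<close> with \<open>k \<ge> 0\<close>; on them the inner projection acts in \<open>L\<^sup>q\<close>.
  The value \<open>a\<^sub>-(\<infinity>)\<close> is the zeroth Fourier coefficient of \<open>a\<^sub>-\<close>.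
\<close>

definition wiener_hopf_factorization ::
  "real \<Rightarrow> (complex \<Rightarrow> complex) \<Rightarrow> (complex \<Rightarrow> complex) \<Rightarrow> int \<Rightarrow> (complex \<Rightarrow> complex) \<Rightarrow> bool" where
  "wiener_hopf_factorization p a am \<nu> ap \<longleftrightarrow>
     (let q = conj_exponent p in
        (AE t in circle_measure. a t = am t * t powi \<nu> * ap t) \<and>
        (AE t in circle_measure. ap t \<noteq> 0) \<and>
        (AE t in circle_measure. am t \<noteq> 0) \<and>
        ap \<in> Hardy q \<and> (\<lambda>t. inverse (ap t)) \<in> Hardy p \<and>
        am \<in> conj_Hardy p \<and> (\<lambda>t. inverse (am t)) \<in> conj_Hardy q \<and>
        fourier_coeff am 0 = 1 \<and>
        (\<exists>B. bounded_operator_Hardy p B \<and>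
           (\<forall>r :: complex poly. AE t in circle_measure.
              B (poly r) t = inverse (ap t) * riesz_proj q (\<lambda>s. inverse (am s) * poly r s) t)))"

definition reflect :: "(complex \<Rightarrow> complex) \<Rightarrow> complex \<Rightarrow> complex" where
  "reflect a t = a (1 / t)"

definition matching :: "(complex \<Rightarrow> complex) \<Rightarrow> bool" where
  "matching g \<longleftrightarrow> (AE t in circle_measure. g t * reflect g t = 1)"

text \<open>The value \<open>g\<^sub>+(0)\<close> is the zeroth Fourier coefficient of \<open>g\<^sub>+\<close>.\<close>

definition factorization_signature :: "real \<Rightarrow> (complex \<Rightarrow> complex) \<Rightarrow> complex" where
  "factorization_signature p g =
     (THE s. \<exists>gm \<nu> gp. wiener_hopf_factorization p g gm \<nu> gp \<and> s = fourier_coeff gp 0)"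

end

(* With phi = T(g)^{-1} 1, the relation g(t) g(1/t) = 1 forces g phi = s phi(1/t) with s = phi(0) = 1/s,
   so the factorization, if it exists, is g = (s phi(1/t)) (1/phi) and its signature is s.

   Existence needs 1/phi in H^q.  T(g) maps phi times a polynomial to an explicit polynomial, so the
   bounded inverse of T(g) bounds the functional "sum of b_k t^k |-> sum of b_k K_k" on H^p, where the K_k are
   the Taylor coefficients of 1/phi.  Testing it on Riesz projections and using M. Riesz's inequality
   bounds the L^q means of 1/phi on circles, and Fatou's lemma transfers this to the boundary.

   For the value of s, compare Poisson integrals at w = e r, where e = 1 or -1 and r tends to 1:
   (s - g(e)) phi(w) is the Poisson integral of (g - g(e)) phi.  Since T(g) maps phi/(1 - w t) to
   s phi(w)/(1 - w t), the bounded inverse gives |phi/(1 - w t)|_p <= C |phi(w)| |1/(1 - w t)|_p,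
   and Hoelder's inequality makes the Poisson integral o(|phi(w)|). *)

theory Submission
  imports Defs "HOL-Complex_Analysis.Complex_Analysis" "HOL-Probability.Probability_Measure"
begin

section \<open>Arc length measure on the circle and Fourier coefficients\<close>

text \<open>The points 1 and -1 are the fixed points of t -> 1/t on the circle, and w = e r is then
  real, so the Poisson kernel at w is invariant under t -> 1/t; this lets the relation between g phi
  and phi(1/t) be integrated against it. The kernel equals (1 - r^2) |1/(1 - w t)|^2: one factor
  1/(1 - w t) is paired with phi in L^p, the other goes into L^q. The norms of the factors are of
  order (1 - r)^(1/p - 1) and (1 - r)^(1/q - 1), and together with 1 - r^2 the powers cancel
  exactly. This alone gives only O(|phi(w)|); the small o comes from continuity of g near e and from
  the decay of the kernel away from e.

  Existence faces a circularity: 1/phi is a meaningful function only once phi is known to be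
  nonzero, but the bound must come before that. So the K_k start as coefficients of a formal power
  series; the functional bound makes them bounded, which gives a holomorphic 1/phi in the disc, and
  only the limit at the boundary excludes zeros there.

  The signature is a definite description, so factorizations of every index must be compared, not
  only those of index 0.\<close>

abbreviation circle_mu ("\<mu>") where "\<mu> \<equiv> circle_measure"

lemma space_mu [simp]: "space \<mu> = unit_circle"
  by (simp add: circle_measure_def space_restrict_space)

lemma sets_mu [simp, measurable_cong]: "sets \<mu> = sets (restrict_space borel unit_circle)"
  by (simp add: circle_measure_def)

lemma norm_circle: "t \<in> unit_circle \<longleftrightarrow> norm t = 1"
  by (simp add: unit_circle_def)

lemma AE_circleI: "(\<And>t. norm t = 1 \<Longrightarrow> P t) \<Longrightarrow> AE t in \<mu>. P t"
  by (rule AE_I2) (simp add: norm_circle)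

lemma cnj_circle: "norm t = 1 \<Longrightarrow> cnj t = inverse t"
  using complex_norm_square[of t] by (metis inverse_unique of_real_1 one_power2)

lemma measurable_cis [measurable]: "cis \<in> borel \<rightarrow>\<^sub>M restrict_space borel unit_circle"
  by (intro measurable_restrict_space2 borel_measurable_continuous_onI continuous_intros)
     (auto simp: norm_circle)

abbreviation angle_measure :: "real measure" where
  "angle_measure \<equiv> uniform_measure lborel {0..2 * pi}"

lemma prob_space_angle: "prob_space angle_measure"
  by (intro prob_space_uniform_measure) auto

lemma prob_space_mu: "prob_space \<mu>"
  unfolding circle_measure_def
  by (intro prob_space.prob_space_distr prob_space_angle) simp

interpretation mu: prob_space \<mu> by (rule prob_space_mu)

lemma meas_continuous: "continuous_on unit_circle f \<Longrightarrow> (f :: complex \<Rightarrow> 'a::topological_space) \<in> borel_measurable \<mu>"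
  using borel_measurable_continuous_on_restrict[of unit_circle f]
  by (simp cong: measurable_cong_sets)

lemma meas_id [measurable]: "(\<lambda>t. t) \<in> borel_measurable \<mu>"
  by (rule meas_continuous) simp

lemma nn_integral_mu:
  assumes [measurable]: "f \<in> borel_measurable \<mu>"
  shows "(\<integral>\<^sup>+t. f t \<partial>\<mu>) = (\<integral>\<^sup>+x. f (cis x) * indicator {0..2*pi} x \<partial>lborel) / ennreal (2*pi)"
proof -
  have [measurable]: "f \<in> borel_measurable (restrict_space borel unit_circle)"
    using assms by simp
  show ?thesis
    unfolding circle_measure_def
    by (subst nn_integral_distr) (auto simp: nn_integral_uniform_measure)
qed

text \<open>The map t -> 1/t on the circle is x -> 2 pi - x on angles, which maps [0, 2 pi] onto
  itself; its invariance therefore reduces to that of Lebesgue measure under an affine map of slope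
  -1.\<close>

lemma distr_angle_reflect: "distr angle_measure borel (\<lambda>x. 2*pi - x) = angle_measure"
proof (rule measure_eqI)
  fix A assume "A \<in> sets (distr angle_measure borel (\<lambda>x. 2*pi - x))"
  then have A[measurable]: "A \<in> sets borel" by simp
  have "emeasure (distr angle_measure borel (\<lambda>x. 2*pi - x)) A
      = (\<integral>\<^sup>+x. indicator A (2*pi - x) \<partial>angle_measure)"
    by (subst nn_integral_indicator[symmetric], simp, subst nn_integral_distr) auto
  also have "\<dots> = (\<integral>\<^sup>+x. indicator A (2*pi - x) * indicator {0..2*pi} x \<partial>lborel) / ennreal (2*pi)"
    by (subst nn_integral_uniform_measure) auto
  also have "(\<integral>\<^sup>+x. indicator A (2*pi - x) * indicator {0..2*pi} x \<partial>lborel)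
     = (\<integral>\<^sup>+x. indicator A x * indicator {0..2*pi} x \<partial>lborel)"
    by (subst nn_integral_real_affine[where c="-1" and t="2*pi"])
       (auto intro!: nn_integral_cong simp: indicator_def)
  also have "\<dots> / ennreal (2*pi) = (\<integral>\<^sup>+x. indicator A x \<partial>angle_measure)"
    by (subst nn_integral_uniform_measure) auto
  also have "\<dots> = emeasure angle_measure A" by simp
  finally show "emeasure (distr angle_measure borel (\<lambda>x. 2*pi - x)) A = emeasure angle_measure A" .
qed simp

lemma meas_inverse_map [measurable]: "(\<lambda>t. 1 / t) \<in> \<mu> \<rightarrow>\<^sub>M \<mu>"
proof -
  have "continuous_on unit_circle (\<lambda>t::complex. 1 / t)"
    by (auto intro!: continuous_intros simp: norm_circle)
  then have "(\<lambda>t::complex. 1 / t) \<in> borel_measurable (restrict_space borel unit_circle)"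
    by (rule borel_measurable_continuous_on_restrict)
  then have "(\<lambda>t::complex. 1 / t) \<in> restrict_space borel unit_circle \<rightarrow>\<^sub>M restrict_space borel unit_circle"
    by (intro measurable_restrict_space2) (auto simp: space_restrict_space norm_circle norm_divide)
  then show ?thesis by (simp cong: measurable_cong_sets)
qed

text \<open>This invariance is what carries \<open>reflect\<close> through integrals, Fourier
  coefficients and null sets.\<close>

lemma distr_mu_reflect: "distr \<mu> \<mu> (\<lambda>t. 1 / t) = \<mu>"
proof -
  let ?C = "restrict_space borel unit_circle"
  have [measurable]: "(\<lambda>t. 1 / t) \<in> ?C \<rightarrow>\<^sub>M ?C"
    using meas_inverse_map by (simp cong: measurable_cong_sets)
  have "distr \<mu> \<mu> (\<lambda>t. 1 / t) = distr (distr angle_measure ?C cis) ?C (\<lambda>t. 1/t)"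
    by (rule distr_cong) (auto simp: circle_measure_def)
  also have "\<dots> = distr angle_measure ?C (\<lambda>x. 1 / cis x)"
    by (subst distr_distr) (auto simp: o_def)
  also have "(\<lambda>x. 1 / cis x) = (\<lambda>x. cis (2*pi - x))"
    by (metis cis_2pi cis_divide)
  also have "distr angle_measure ?C (\<lambda>x. cis (2*pi - x)) = distr (distr angle_measure borel (\<lambda>x. 2*pi - x)) ?C cis"
    by (subst distr_distr) (auto simp: o_def)
  also have "\<dots> = \<mu>" by (simp add: distr_angle_reflect circle_measure_def)
  finally show ?thesis .
qed

lemma meas_reflect [measurable]: "f \<in> borel_measurable \<mu> \<Longrightarrow> (\<lambda>t. f (1 / t)) \<in> borel_measurable \<mu>"
  by (rule measurable_compose[OF meas_inverse_map])

lemma meas_reflect' [measurable]: "f \<in> borel_measurable \<mu> \<Longrightarrow> reflect f \<in> borel_measurable \<mu>"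
  unfolding reflect_def[abs_def] by (rule meas_reflect)

lemma integral_reflect:
  fixes f :: "complex \<Rightarrow> 'a::{banach, second_countable_topology}"
  assumes [measurable]: "f \<in> borel_measurable \<mu>"
  shows "(LINT t|\<mu>. f (1 / t)) = (LINT t|\<mu>. f t)"
  by (subst (2) distr_mu_reflect[symmetric], subst integral_distr) auto

lemma integrable_reflect:
  fixes f :: "complex \<Rightarrow> 'a::{banach, second_countable_topology}"
  assumes "integrable \<mu> f"
  shows "integrable \<mu> (\<lambda>t. f (1 / t))"
  using assms by (subst (asm) distr_mu_reflect[symmetric], subst (asm) integrable_distr_eq) auto

lemma AE_reflect:
  assumes "AE t in \<mu>. P t"
  shows "AE t in \<mu>. P (1 / t)"
  using assms by (subst (asm) distr_mu_reflect[symmetric]) (rule AE_distrD[OF meas_inverse_map])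

lemma integral_circle:
  fixes f :: "complex \<Rightarrow> complex"
  assumes "continuous_on unit_circle f"
  shows "(LINT t|\<mu>. f t) = (LINT x:{0..2*pi}|lborel. f (cis x)) / (2*pi)"
proof -
  have [measurable]: "f \<in> borel_measurable (restrict_space borel unit_circle)"
    using meas_continuous[OF assms] by simp
  have "(LINT t|\<mu>. f t) = (LINT x|angle_measure. f (cis x))"
    unfolding circle_measure_def by (subst integral_distr) auto
  also have "angle_measure = density lborel (\<lambda>x. ennreal (indicator {0..2*pi} x / (2*pi)))"
    unfolding uniform_measure_def
    by (rule density_cong) (auto simp: indicator_def divide_ennreal[symmetric] ennreal_1[symmetric] simp del: ennreal_1)
  also have "(LINT x|density lborel (\<lambda>x. ennreal (indicator {0..2*pi} x / (2*pi))). f (cis x))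
      = (LINT x|lborel. (indicator {0..2*pi} x / (2*pi)) *\<^sub>R f (cis x))"
    by (rule integral_density) auto
  also have "\<dots> = (LINT x|lborel. (1/(2*pi)) *\<^sub>R (indicator {0..2*pi} x *\<^sub>R f (cis x)))"
    by (intro Bochner_Integration.integral_cong) auto
  also have "\<dots> = (1/(2*pi)) *\<^sub>R (LINT x:{0..2*pi}|lborel. f (cis x))"
    by (simp only: integral_scaleR_right set_lebesgue_integral_def)
  finally show ?thesis by (simp add: scaleR_conv_of_real)
qed

text \<open>For nonzero n the antiderivative exp(i n x) / (i n) has period 2 pi, so the boundary
  terms cancel.\<close>

lemma integral_powi: "(LINT t|\<mu>. t powi n) = (if n = 0 then 1 else 0)"
proof (cases "n = 0")
  case False
  have "(LINT t|\<mu>. t powi n) = (LINT x:{0..2*pi}|lborel. cis x powi n) / (2*pi)"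
    by (intro integral_circle continuous_intros) (auto simp: norm_circle)
  also have "(LINT x:{0..2*pi}|lborel. cis x powi n) = (LINT x|lborel. indicator {0..2*pi} x *\<^sub>R cis (of_int n * x))"
    by (simp add: set_lebesgue_integral_def cis_power_int)
  also have "\<dots> = cis (of_int n * (2*pi)) / (\<i> * of_int n) - cis (of_int n * 0) / (\<i> * of_int n)"
  proof (rule integral_FTC_atLeastAtMost)
    fix x :: real
    have "((\<lambda>z. exp (\<i> * of_int n * z) / (\<i> * of_int n)) has_field_derivative exp (\<i> * of_int n * of_real x)) (at (of_real x))"
      using False by (auto intro!: derivative_eq_intros)
    then have "((\<lambda>x. exp (\<i> * of_int n * of_real x) / (\<i> * of_int n)) has_vector_derivative exp (\<i> * of_int n * of_real x)) (at x within {0..2*pi})"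
      by (rule has_vector_derivative_real_field)
    then show "((\<lambda>x. cis (of_int n * x) / (\<i> * of_int n)) has_vector_derivative cis (of_int n * x)) (at x within {0..2*pi})"
      by (simp add: cis_conv_exp mult.assoc)
  qed (auto intro!: continuous_intros)
  also have "cis (of_int n * (2*pi)) = 1"
    by (metis cis_multiple_2pi Ints_of_int mult.commute)
  finally show ?thesis using False by simp
qed (use mu.prob_space in simp)


section \<open>Fourier coefficients and multiplication by absolutely convergent power series\<close>

lemma integrable_bounded_mult:
  fixes f h :: "complex \<Rightarrow> complex"
  assumes f: "integrable \<mu> f" and [measurable]: "h \<in> borel_measurable \<mu>"
    and h: "AE t in \<mu>. norm (h t) \<le> C"
  shows "integrable \<mu> (\<lambda>t. h t * f t)"
proof (rule Bochner_Integration.integrable_bound)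
  show "integrable \<mu> (\<lambda>t. C * norm (f t))" using f by auto
  show "AE t in \<mu>. norm (h t * f t) \<le> norm (C * norm (f t))"
    using h
  proof eventually_elim
    case (elim t)
    then have "norm (h t) * norm (f t) \<le> C * norm (f t)" by (intro mult_right_mono) auto
    then show ?case by (simp add: norm_mult)
  qed
qed (use f in measurable)

lemma meas_powi [measurable]: "(\<lambda>t. t powi n) \<in> borel_measurable \<mu>"
  by (intro meas_continuous continuous_intros) (auto simp: norm_circle)

lemma norm_powi_circle: "norm (t::complex) = 1 \<Longrightarrow> norm (t powi n) = 1"
  by (simp add: norm_power_int)

lemma integrable_powi_mult:
  fixes f :: "complex \<Rightarrow> complex"
  assumes "integrable \<mu> f"
  shows "integrable \<mu> (\<lambda>t. t powi n * f t)" "integrable \<mu> (\<lambda>t. f t * t powi n)"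
proof -
  show "integrable \<mu> (\<lambda>t. t powi n * f t)"
    by (rule integrable_bounded_mult[OF assms, where C=1]) (auto intro!: AE_circleI simp: norm_powi_circle)
  then show "integrable \<mu> (\<lambda>t. f t * t powi n)" by (simp add: mult.commute)
qed

lemma fourier_coeff_cong_AE:
  assumes "f \<in> borel_measurable \<mu>" "h \<in> borel_measurable \<mu>" "AE t in \<mu>. f t = h t"
  shows "fourier_coeff f n = fourier_coeff h n"
  unfolding fourier_coeff_def using assms(3) 
  by (intro integral_cong_AE borel_measurable_times assms meas_powi) auto

lemma fourier_coeff_add:
  assumes "integrable \<mu> f" "integrable \<mu> h"
  shows "fourier_coeff (\<lambda>t. f t + h t) n = fourier_coeff f n + fourier_coeff h n"
  unfolding fourier_coeff_def using assms
  by (simp add: distrib_right integrable_powi_mult)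

lemma fourier_coeff_diff:
  assumes "integrable \<mu> f" "integrable \<mu> h"
  shows "fourier_coeff (\<lambda>t. f t - h t) n = fourier_coeff f n - fourier_coeff h n"
  unfolding fourier_coeff_def using assms
  by (simp add: left_diff_distrib integrable_powi_mult)

lemma fourier_coeff_cmult: "fourier_coeff (\<lambda>t. c * f t) n = c * fourier_coeff f n"
  unfolding fourier_coeff_def by (simp add: mult.assoc)

lemma fourier_coeff_sum:
  assumes "\<And>i. i \<in> I \<Longrightarrow> integrable \<mu> (f i)"
  shows "fourier_coeff (\<lambda>t. \<Sum>i\<in>I. f i t) n = (\<Sum>i\<in>I. fourier_coeff (f i) n)"
  unfolding fourier_coeff_def using assms
  by (simp add: sum_distrib_right integrable_powi_mult)

lemma fourier_coeff_shift:
  shows "fourier_coeff (\<lambda>t. t powi k * f t) n = fourier_coeff f (n - k)"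
  unfolding fourier_coeff_def
proof (rule Bochner_Integration.integral_cong)
  fix t assume "t \<in> space \<mu>"
  then have "t \<noteq> 0" by (auto simp: norm_circle)
  then have "t powi (- (n - k)) = t powi k * t powi (- n)" 
    by (subst power_int_add[symmetric]) auto
  then show "t powi k * f t * t powi (- n) = f t * t powi (- (n - k))"
    by (simp only: mult_ac)
qed simp

lemma fourier_coeff_reflect:
  assumes [measurable]: "f \<in> borel_measurable \<mu>"
  shows "fourier_coeff (reflect f) n = fourier_coeff f (- n)"
proof -
  have "fourier_coeff f (- n) = (LINT t|\<mu>. f (1/t) * (1/t) powi n)"
    unfolding fourier_coeff_def by (subst integral_reflect[symmetric]) auto
  then show ?thesis
    by (simp add: fourier_coeff_def reflect_def power_int_minus power_int_divide_distrib inverse_eq_divide)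
qed

lemma fourier_coeff_powi: "fourier_coeff (\<lambda>t. t powi k) n = (if n = k then 1 else 0)"
  using fourier_coeff_shift[of k "\<lambda>_. 1" n] integral_powi[of "k - n"]
  by (auto simp: fourier_coeff_def)

lemma norm_fourier_coeff_le:
  assumes "integrable \<mu> f"
  shows "norm (fourier_coeff f n) \<le> (LINT t|\<mu>. norm (f t))"
proof -
  have "norm (fourier_coeff f n) \<le> (LINT t|\<mu>. norm (f t * t powi (-n)))"
    unfolding fourier_coeff_def by (rule integral_norm_bound)
  also have "\<dots> = (LINT t|\<mu>. norm (f t))"
    by (rule Bochner_Integration.integral_cong) (auto simp: norm_circle norm_mult norm_powi_circle)
  finally show ?thesis .
qed

lemma series_continuous:
  fixes a :: "nat \<Rightarrow> complex"
  assumes "summable (\<lambda>k. norm (a k))"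
  shows "continuous_on unit_circle (\<lambda>t. \<Sum>k. a k * t ^ k)"
proof -
  have "uniform_limit unit_circle (\<lambda>n t. \<Sum>k<n. a k * t ^ k) (\<lambda>t. \<Sum>k. a k * t ^ k) sequentially"
    by (rule Weierstrass_m_test[OF _ assms]) (auto simp: norm_circle norm_mult norm_power)
  then show ?thesis
    by (rule uniform_limit_theorem[rotated]) (auto intro!: always_eventually continuous_intros)
qed

lemma series_bound:
  fixes a :: "nat \<Rightarrow> complex"
  assumes "summable (\<lambda>k. norm (a k))" "norm t = 1"
  shows "norm (\<Sum>k. a k * t ^ k) \<le> (\<Sum>k. norm (a k))"
proof -
  have s: "summable (\<lambda>k. norm (a k * t ^ k))" using assms by (simp add: norm_mult norm_power)
  have "norm (\<Sum>k. a k * t ^ k) \<le> (\<Sum>k. norm (a k * t ^ k))" by (rule summable_norm[OF s])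
  then show ?thesis using assms by (simp add: norm_mult norm_power)
qed

lemma series_mult_integrable:
  assumes "integrable \<mu> f" "summable (\<lambda>k. norm (a k))"
  shows "integrable \<mu> (\<lambda>t. (\<Sum>k. a k * t ^ k) * f t)"
  by (rule integrable_bounded_mult[OF assms(1), where C="\<Sum>k. norm (a k)"])
     (auto intro!: AE_circleI series_bound meas_continuous series_continuous assms)

text \<open>Termwise integration, dominated by |a_k| |f|. Dilations to a radius r < 1 have
  absolutely summable coefficients, so products of a boundary function with a Cauchy kernel or with
  a dilated series are computed through this convolution.\<close>

lemma fourier_coeff_series_mult:
  assumes f: "integrable \<mu> f" and a: "summable (\<lambda>k. norm (a k))"
  shows "(\<lambda>k. a k * fourier_coeff f (n - int k)) sums fourier_coeff (\<lambda>t. (\<Sum>k. a k * t ^ k) * f t) n"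
proof -
  let ?F = "\<lambda>k t. a k * (t powi int k * f t) * t powi (-n)"
  have nF: "norm (?F k t) = norm (a k) * norm (f t)" if "norm t = 1" for k t
    using that by (simp add: norm_mult norm_powi_circle norm_power)
  have "(\<lambda>k. LINT t|\<mu>. ?F k t) sums (LINT t|\<mu>. (\<Sum>k. ?F k t))"
  proof (rule sums_integral)
    show "integrable \<mu> (?F k)" for k
      by (intro integrable_powi_mult integrable_mult_right f)
    show "AE t in \<mu>. summable (\<lambda>k. norm (?F k t))"
      using a by (intro AE_circleI) (simp only: nF summable_mult2)
    have "(\<lambda>k. LINT t|\<mu>. norm (?F k t)) = (\<lambda>k. LINT t|\<mu>. norm (a k) * norm (f t))"
      by (intro ext Bochner_Integration.integral_cong) (simp_all only: space_mu norm_circle nF)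
    also have "\<dots> = (\<lambda>k. norm (a k) * (LINT t|\<mu>. norm (f t)))" by simp
    finally show "summable (\<lambda>k. LINT t|\<mu>. norm (?F k t))"
      using a by (simp add: summable_mult2)
  qed
  moreover have "(\<lambda>k. LINT t|\<mu>. ?F k t) = (\<lambda>k. a k * fourier_coeff f (n - int k))"
    by (subst fourier_coeff_shift[symmetric]) (auto simp: fourier_coeff_def mult.assoc)
  moreover have "(LINT t|\<mu>. (\<Sum>k. ?F k t)) = fourier_coeff (\<lambda>t. (\<Sum>k. a k * t ^ k) * f t) n"
    unfolding fourier_coeff_def
  proof (rule Bochner_Integration.integral_cong)
    fix t assume "t \<in> space \<mu>"
    then have "norm t = 1" by (simp add: norm_circle)
    then have "summable (\<lambda>k. norm (a k * t ^ k))" using a by (simp add: norm_mult norm_power)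
    then have "summable (\<lambda>k. a k * t ^ k)" by (rule summable_norm_cancel)
    then have "(\<lambda>k. a k * t ^ k * (f t * t powi (-n))) sums ((\<Sum>k. a k * t ^ k) * (f t * t powi (-n)))"
      by (intro sums_mult2 summable_sums)
    then show "(\<Sum>k. ?F k t) = (\<Sum>k. a k * t ^ k) * f t * t powi (-n)"
      by (simp add: sums_iff mult.assoc)
  qed simp
  ultimately show ?thesis by simp
qed

section \<open>Density of trigonometric polynomials\<close>

lemma integrable_continuous:
  fixes f :: "complex \<Rightarrow> complex"
  assumes "continuous_on unit_circle f"
  shows "integrable \<mu> f"
proof -
  have "compact (f ` unit_circle)"
    using assms by (intro compact_continuous_image) (auto simp: unit_circle_def)
  then obtain C where "\<And>t. norm t = 1 \<Longrightarrow> norm (f t) \<le> C"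
    by (meson bounded_iff compact_imp_bounded imageI norm_circle)
  then show ?thesis
    by (intro mu.integrable_const_bound[where B=C] AE_circleI meas_continuous assms)
qed

lemma continuous_trig: "continuous_on unit_circle (\<lambda>t. poly a t / t ^ N :: complex)"
  by (auto intro!: continuous_intros simp: norm_circle)

lemma integrable_trig: "integrable \<mu> (\<lambda>t. poly a t / t ^ N :: complex)"
  by (rule integrable_continuous[OF continuous_trig])

lemma trig_add:
  fixes t :: complex
  assumes "norm t = 1"
  shows "poly a t / t ^ M + poly b t / t ^ N = poly (a * monom 1 N + b * monom 1 M) t / t ^ (M + N)"
  using assms by (subst add_frac_eq) (auto simp: poly_monom power_add mult.commute)

text \<open>On the circle cnj t = 1/t, so Re t and Im t are Laurent polynomials in t, and sums and
  products preserve this form. It turns the polynomials of the Stone-Weierstrass theorem on the real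
  plane into trigonometric polynomials.\<close>

lemma real_polynomial_function_trig:
  fixes r :: "complex \<Rightarrow> real"
  assumes "real_polynomial_function r"
  shows "\<exists>a N. \<forall>t. norm t = 1 \<longrightarrow> of_real (r t) = poly a t / t ^ N"
  using assms
proof (induction r rule: real_polynomial_function.induct)
  case (linear r)
  interpret bounded_linear r by fact
  \<comment> \<open>Writing r(t) = Re t r(1) + Im t r(i) with Re t = (t + 1/t) / 2 and Im t = (t -
    1/t) / (2 i) gives c (t + 1/t) + d (t - 1/t), which is the quotient below.\<close>
  define c d :: complex where "c = of_real (r 1) / 2" and "d = of_real (r \<i>) / (2 * \<i>)"
  have "of_real (r t) = poly [:c - d, 0, c + d:] t / t ^ 1" if t: "norm t = 1" for t
  proof -
    have "t \<noteq> 0" using t by auto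
    have cnj: "t * cnj t = 1" using t complex_norm_square[of t] by simp
    have cancel: "a / b * (b * x) = a * x" if "b \<noteq> 0" for a b x :: complex using that by simp
    have "t = Re t *\<^sub>R 1 + Im t *\<^sub>R \<i>" by (simp add: complex_eq_iff)
    then have "r t = Re t * r 1 + Im t * r \<i>" by (metis add scaleR real_scaleR_def)
    then have "of_real (r t) = of_real (Re t) * (2 * c) + of_real (Im t) * (2 * \<i> * d)"
      by (simp add: c_def d_def)
    also have "of_real (Re t) = (t + cnj t) / 2" by (simp add: complex_add_cnj)
    also have "of_real (Im t) = (t - cnj t) / (2 * \<i>)"
    proof -
      have "t - cnj t = of_real (Im t) * (2 * \<i>)" by (simp add: complex_eq_iff)
      then show ?thesis by (subst eq_divide_eq) simp
    qed
    also have "(t + cnj t) / 2 * (2 * c) + (t - cnj t) / (2 * \<i>) * (2 * \<i> * d) = (t + cnj t) * c + (t - cnj t) * d"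
      by (subst cancel, simp, subst cancel, simp, rule refl)
    finally have "t * of_real (r t) = t * ((t + cnj t) * c + (t - cnj t) * d)"
      by (simp only:)
    also have "\<dots> = (t * t + t * cnj t) * c + (t * t - t * cnj t) * d"
      by (simp add: algebra_simps)
    finally have "t * of_real (r t) = (t * t + t * cnj t) * c + (t * t - t * cnj t) * d" .
    then have "t * of_real (r t) = (t * t + 1) * c + (t * t - 1) * d" by (simp only: cnj)
    then show ?thesis using \<open>t \<noteq> 0\<close> by (simp add: field_simps)
  qed
  then show ?case by blast
next
  case (const c)
  show ?case by (rule exI[of _ "[:of_real c:]"], rule exI[of _ 0]) simp
next
  case (add f g)
  then obtain a M b N where "\<forall>t. norm t = 1 \<longrightarrow> of_real (f t) = poly a t / t ^ M"
    "\<forall>t. norm t = 1 \<longrightarrow> of_real (g t) = poly b t / t ^ N" by blast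
  then have "\<forall>t. norm t = 1 \<longrightarrow> of_real (f t + g t) = poly (a * monom 1 N + b * monom 1 M) t / t ^ (M + N)"
    by (simp add: trig_add del: poly_add poly_mult)
  then show ?case by blast
next
  case (mult f g)
  then obtain a M b N where "\<forall>t. norm t = 1 \<longrightarrow> of_real (f t) = poly a t / t ^ M"
    "\<forall>t. norm t = 1 \<longrightarrow> of_real (g t) = poly b t / t ^ N" by blast
  then have "\<forall>t. norm t = 1 \<longrightarrow> of_real (f t * g t) = poly (a * b) t / t ^ (M + N)"
    by (simp add: power_add)
  then show ?case by blast
qed

lemma polynomial_function_trig:
  fixes g :: "complex \<Rightarrow> complex"
  assumes "polynomial_function g"
  shows "\<exists>a N. \<forall>t. norm t = 1 \<longrightarrow> g t = poly a t / t ^ N"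
proof -
  have "real_polynomial_function (Re \<circ> g)" "real_polynomial_function (Im \<circ> g)"
    using assms bounded_linear_Re bounded_linear_Im unfolding polynomial_function_def by blast+
  then obtain a M b N where ab: "\<And>t. norm t = 1 \<Longrightarrow> of_real (Re (g t)) = poly a t / t ^ M"
    "\<And>t. norm t = 1 \<Longrightarrow> of_real (Im (g t)) = poly b t / t ^ N"
    using real_polynomial_function_trig unfolding o_def by meson
  have "g t = poly (a * monom 1 N + [:\<i>:] * b * monom 1 M) t / t ^ (M + N)" if "norm t = 1" for t
  proof -
    have "g t = poly a t / t ^ M + poly ([:\<i>:] * b) t / t ^ N"
      using ab[OF that] complex_eq[of "g t"] by simp
    also have "\<dots> = poly (a * monom 1 N + [:\<i>:] * b * monom 1 M) t / t ^ (M + N)"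
      by (rule trig_add[OF that])
    finally show ?thesis .
  qed
  then show ?thesis by blast
qed

text \<open>An ordinary polynomial over a power of t encodes a trigonometric polynomial. The
  distance is that of L^1, which later yields uniqueness of Fourier coefficients and convergence
  almost everywhere along a subsequence.\<close>

definition trig_approx :: "(complex \<Rightarrow> complex) \<Rightarrow> bool" where
  "trig_approx f \<longleftrightarrow> (\<forall>e>0. \<exists>a N. (LINT t|\<mu>. norm (f t - poly a t / t ^ N)) < e)"

lemma integral_norm_triangle:
  fixes f g h :: "complex \<Rightarrow> complex"
  assumes "integrable \<mu> f" "integrable \<mu> g" "integrable \<mu> h"
  shows "(LINT t|\<mu>. norm (f t - h t)) \<le> (LINT t|\<mu>. norm (f t - g t)) + (LINT t|\<mu>. norm (g t - h t))"
proof -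
  have "(LINT t|\<mu>. norm (f t - h t)) \<le> (LINT t|\<mu>. norm (f t - g t) + norm (g t - h t))"
    using assms norm_triangle_ineq[of "f t - g t" "g t - h t" for t]
    by (intro integral_mono) (auto simp: norm_triangle_ineq)
  also have "\<dots> = (LINT t|\<mu>. norm (f t - g t)) + (LINT t|\<mu>. norm (g t - h t))"
    using assms by (intro Bochner_Integration.integral_add) auto
  finally show ?thesis .
qed

lemma trig_approx_limit:
  assumes f: "integrable \<mu> f"
    and *: "\<And>e. e > 0 \<Longrightarrow> \<exists>h. integrable \<mu> h \<and> trig_approx h \<and> (LINT t|\<mu>. norm (f t - h t)) < e"
  shows "trig_approx f"
  unfolding trig_approx_def
proof (intro allI impI)
  fix e :: real assume "e > 0"
  then obtain h where h: "integrable \<mu> h" "trig_approx h" "(LINT t|\<mu>. norm (f t - h t)) < e / 2"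
    using *[of "e/2"] by auto
  then obtain a N where "(LINT t|\<mu>. norm (h t - poly a t / t ^ N)) < e / 2"
    using \<open>e > 0\<close> unfolding trig_approx_def by (meson half_gt_zero)
  then have "(LINT t|\<mu>. norm (f t - poly a t / t ^ N)) < e"
    using integral_norm_triangle[OF f h(1) integrable_trig[of a N]] h(3) by linarith
  then show "\<exists>a N. (LINT t|\<mu>. norm (f t - poly a t / t ^ N)) < e" by blast
qed

lemma trig_approx_seq:
  assumes f: "integrable \<mu> f" and s: "\<And>i. integrable \<mu> (s i)" "\<And>i. trig_approx (s i)"
    and lim: "AE t in \<mu>. (\<lambda>i. s i t) \<longlonglongrightarrow> f t"
    and w: "integrable \<mu> w" "\<And>i. AE t in \<mu>. norm (s i t) \<le> w t"
  shows "trig_approx f"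
proof (rule trig_approx_limit[OF f])
  fix e :: real assume "e > 0"
  have "(\<lambda>i. LINT t|\<mu>. norm (f t - s i t)) \<longlonglongrightarrow> (LINT t|\<mu>. 0)"
  proof (rule integral_dominated_convergence[where w="\<lambda>t. norm (f t) + w t"])
    show "AE t in \<mu>. (\<lambda>i. norm (f t - s i t)) \<longlonglongrightarrow> 0"
      using lim
    proof eventually_elim
      case (elim t)
      then have "(\<lambda>i. norm (f t - s i t)) \<longlonglongrightarrow> norm (f t - f t)" by (intro tendsto_intros)
      then show ?case by simp
    qed
    show "AE t in \<mu>. norm (norm (f t - s i t)) \<le> norm (f t) + w t" for i
      using w(2)[of i]
    proof eventually_elim
      case (elim t)
      then show ?case using norm_triangle_ineq4[of "f t" "s i t"] by simp
    qed
  qed (use f s w in auto)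
  then have "eventually (\<lambda>i. (LINT t|\<mu>. norm (f t - s i t)) < e) sequentially"
    using \<open>e > 0\<close> by (simp add: order_tendsto_iff)
  then obtain i where "(LINT t|\<mu>. norm (f t - s i t)) < e"
    by (meson eventually_sequentially order_refl)
  then show "\<exists>h. integrable \<mu> h \<and> trig_approx h \<and> (LINT t|\<mu>. norm (f t - h t)) < e"
    using s by blast
qed

lemma trig_approx_continuous:
  assumes f: "continuous_on unit_circle f"
  shows "trig_approx f"
  unfolding trig_approx_def
proof (intro allI impI)
  fix e :: real assume "e > 0"
  then obtain g where g: "polynomial_function g" "\<forall>t\<in>unit_circle. norm (f t - g t) < e / 2"
    using Stone_Weierstrass_polynomial_function[OF _ f, of "e/2"] by (auto simp: unit_circle_def)
  obtain a N where a: "\<And>t. norm t = 1 \<Longrightarrow> g t = poly a t / t ^ N"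
    using polynomial_function_trig[OF g(1)] by blast
  have "(LINT t|\<mu>. norm (f t - poly a t / t ^ N)) \<le> (LINT t|\<mu>. e / 2)"
    using g(2) a integrable_continuous[OF f] integrable_trig[of a N]
    by (intro integral_mono) (auto simp: norm_circle less_imp_le)
  also have "\<dots> < e" using \<open>e > 0\<close> mu.prob_space by simp
  finally show "\<exists>a N. (LINT t|\<mu>. norm (f t - poly a t / t ^ N)) < e" by blast
qed

lemma trig_approx_zero: "trig_approx (\<lambda>t. 0)"
  by (rule trig_approx_continuous) auto

lemma trig_approx_add:
  assumes "integrable \<mu> f" "trig_approx f" "integrable \<mu> h" "trig_approx h"
  shows "trig_approx (\<lambda>t. f t + h t)"
  unfolding trig_approx_def
proof (intro allI impI)
  fix e :: real assume "e > 0"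
  then have e: "e / 2 > 0" by simp
  obtain a M where a: "(LINT t|\<mu>. norm (f t - poly a t / t ^ M)) < e / 2"
    using assms(2) e unfolding trig_approx_def by meson
  obtain b N where b: "(LINT t|\<mu>. norm (h t - poly b t / t ^ N)) < e / 2"
    using assms(4) e unfolding trig_approx_def by meson
  note [simp] = assms(1,3) integrable_trig
  let ?c = "a * monom 1 N + b * monom 1 M"
  have "(LINT t|\<mu>. norm (f t + h t - poly ?c t / t ^ (M + N)))
      \<le> (LINT t|\<mu>. norm (f t - poly a t / t ^ M) + norm (h t - poly b t / t ^ N))"
  proof (rule integral_mono)
    fix t assume "t \<in> space \<mu>"
    then have "norm t = 1" by (simp add: norm_circle)
    then show "norm (f t + h t - poly ?c t / t ^ (M + N)) \<le> norm (f t - poly a t / t ^ M) + norm (h t - poly b t / t ^ N)"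
      unfolding trig_add[OF \<open>norm t = 1\<close>, symmetric]
      by (metis add_diff_add norm_triangle_ineq)
  qed (intro integrable_norm Bochner_Integration.integrable_diff Bochner_Integration.integrable_add assms integrable_trig)+
  also have "\<dots> = (LINT t|\<mu>. norm (f t - poly a t / t ^ M)) + (LINT t|\<mu>. norm (h t - poly b t / t ^ N))"
    by (intro Bochner_Integration.integral_add integrable_norm Bochner_Integration.integrable_diff assms integrable_trig)
  finally show "\<exists>a N. (LINT t|\<mu>. norm (f t + h t - poly a t / t ^ N)) < e"
    using a b by (intro exI[of _ ?c] exI[of _ "M + N"]) linarith
qed

lemma integrable_indicator_scaleR:
  "A \<in> sets \<mu> \<Longrightarrow> integrable \<mu> (\<lambda>t. indicator A t *\<^sub>R (c :: complex))"
  by (intro integrable_scaleR_left integrable_real_indicator) (auto simp: less_top[symmetric])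

text \<open>The indicator is the decreasing limit of the continuous functions max 0 (1 - n dist(t,
  K)), all bounded by 1.\<close>

lemma trig_approx_indicator_compact:
  assumes K: "compact K" "K \<subseteq> unit_circle"
  shows "trig_approx (\<lambda>t. indicator K t *\<^sub>R c)"
proof (cases "K = {}")
  case True
  then show ?thesis using trig_approx_zero by simp
next
  case False
  let ?s = "\<lambda>(n::nat) t. of_real (max 0 (1 - n * infdist t K)) * c"
  have [measurable]: "K \<in> sets \<mu>" using K by (auto simp: sets_restrict_space compact_imp_closed intro!: image_eqI[of _ _ K])
  have b: "norm (?s n t) \<le> norm c" for n t
    by (auto simp: norm_mult infdist_nonneg mult_left_le_one_le)
  show ?thesis
  proof (rule trig_approx_seq[where s="?s" and w="\<lambda>_. norm c"])
    show c: "trig_approx (?s i)" "integrable \<mu> (?s i)" for i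
      by (auto intro!: trig_approx_continuous integrable_continuous continuous_intros)
    show "AE t in \<mu>. (\<lambda>i. ?s i t) \<longlonglongrightarrow> indicator K t *\<^sub>R c"
    proof (intro AE_I2)
      fix t
      show "(\<lambda>i. ?s i t) \<longlonglongrightarrow> indicator K t *\<^sub>R c"
      proof (cases "t \<in> K")
        case False
        then have pos: "infdist t K > 0"
          using K \<open>K \<noteq> {}\<close> by (simp add: infdist_pos_not_in_closed compact_imp_closed)
        then obtain N :: nat where N: "1 / infdist t K < real N" using reals_Archimedean2 by blast
        have "?s i t = 0" if "i \<ge> N" for i
        proof -
          have "1 / infdist t K < real i" using N that by linarith
          then have "1 < real i * infdist t K" using pos by (simp add: field_simps)
          then show ?thesis by simp
        qed
        then have "eventually (\<lambda>i. ?s i t = indicator K t *\<^sub>R c) sequentially"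
          using False by (auto simp: eventually_sequentially)
        then show ?thesis by (rule tendsto_eventually)
      qed simp
    qed
  qed (auto intro!: AE_I2 integrable_indicator_scaleR simp: b simp del: sets_mu)
qed

lemma trig_approx_indicator:
  assumes A: "A \<in> sets \<mu>"
  shows "trig_approx (\<lambda>t. indicator A t *\<^sub>R c)"
proof (rule trig_approx_limit)
  show "integrable \<mu> (\<lambda>t. indicator A t *\<^sub>R c)" using A by (rule integrable_indicator_scaleR)
  fix e :: real assume e: "e > 0"
  \<comment> \<open>The summand 1 keeps the quotient meaningful for c = 0 and makes d * norm c
    strictly smaller than e.\<close>
  define d where "d = e / (1 + norm c)"
  have d: "d > 0" unfolding d_def using e by (simp add: add_pos_nonneg)
  \<comment> \<open>Inner regularity concerns measures on the Borel sets of the plane, so the circle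
    measure is pushed forward along the inclusion.\<close>
  let ?N = "distr \<mu> borel (\<lambda>t. t)"
  have AB: "A \<in> sets borel" "A \<subseteq> unit_circle"
    using A sets.sets_into_space[OF A] by (auto simp: sets_restrict_space unit_circle_def)
  have eN: "emeasure ?N B = emeasure \<mu> B" if "B \<in> sets borel" "B \<subseteq> unit_circle" for B
    using that by (subst emeasure_distr) (auto simp: Int_absorb2)
  have "emeasure ?N A = (SUP K \<in> {K. K \<subseteq> A \<and> compact K}. emeasure ?N K)"
    by (rule inner_regular) (use AB in \<open>auto simp: emeasure_distr\<close>)
  have "\<exists>K. K \<subseteq> A \<and> compact K \<and> measure \<mu> A - d < measure \<mu> K"
  proof (rule ccontr)
    assume "\<not> ?thesis"
    then have "measure \<mu> K \<le> measure \<mu> A - d" if "K \<subseteq> A" "compact K" for K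
      using that by force
    then have "emeasure ?N K \<le> ennreal (measure \<mu> A - d)" if "K \<subseteq> A" "compact K" for K
      using that AB by (subst eN) (auto simp: mu.emeasure_eq_measure compact_imp_closed intro!: ennreal_leI)
    then have "emeasure ?N A \<le> ennreal (measure \<mu> A - d)"
      unfolding \<open>emeasure ?N A = _\<close> by (auto intro!: SUP_least)
    then have "ennreal (measure \<mu> A) \<le> ennreal (measure \<mu> A - d)"
      using AB by (simp add: eN mu.emeasure_eq_measure)
    moreover have "measure \<mu> {} \<le> measure \<mu> A - d"
      using \<open>\<And>K. K \<subseteq> A \<Longrightarrow> compact K \<Longrightarrow> measure \<mu> K \<le> measure \<mu> A - d\<close>[of "{}"] by simp
    ultimately show False using d by (simp add: ennreal_le_iff)
  qed
  then obtain K where K: "K \<subseteq> A" "compact K" "measure \<mu> A - d < measure \<mu> K" by blast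
  have [measurable]: "K \<in> sets \<mu>" "A \<in> sets \<mu>"
    using K AB A by (auto simp: sets_restrict_space compact_imp_closed intro!: image_eqI[of _ _ K])
  have "(LINT t|\<mu>. norm (indicator A t *\<^sub>R c - indicator K t *\<^sub>R c)) = (LINT t|\<mu>. indicator (A - K) t * norm c)"
    using K by (intro Bochner_Integration.integral_cong) (auto simp: indicator_def)
  also have "\<dots> = measure \<mu> (A - K) * norm c"
  proof -
    have "(A - K) \<inter> unit_circle = A - K" using AB by auto
    then show ?thesis by simp
  qed
  also have "measure \<mu> (A - K) = measure \<mu> A - measure \<mu> K"
    by (intro mu.finite_measure_Diff K) fact+
  also have "\<dots> * norm c \<le> d * norm c"
    using K by (intro mult_right_mono) auto
  also have "\<dots> < e" using e unfolding d_def by (simp add: field_simps add_pos_nonneg)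
  finally have "(LINT t|\<mu>. norm (indicator A t *\<^sub>R c - indicator K t *\<^sub>R c)) < e" .
  moreover have "integrable \<mu> (\<lambda>t. indicator K t *\<^sub>R c)"
    by (rule integrable_indicator_scaleR) fact
  ultimately show "\<exists>h. integrable \<mu> h \<and> trig_approx h \<and> (LINT t|\<mu>. norm (indicator A t *\<^sub>R c - h t)) < e"
    using trig_approx_indicator_compact[OF K(2), of c] K(1) AB(2) by blast
qed

theorem trig_approx: "integrable \<mu> f \<Longrightarrow> trig_approx f"
proof (induction f rule: integrable_induct)
  case (base A c)
  then show ?case by (intro trig_approx_indicator)
next
  case (add f g)
  then show ?case by (intro trig_approx_add)
next
  case (lim f s)
  then show ?case
    by (intro trig_approx_seq[of f s "\<lambda>t. 2 * norm (f t)"]) auto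
qed

section \<open>Poisson integrals\<close>

lemma fourier_coeff_one: "fourier_coeff (\<lambda>t. 1) n = (if n = 0 then 1 else 0)"
  using fourier_coeff_powi[of 0 n] by simp

lemma series_integrable:
  "summable (\<lambda>k. norm (a k)) \<Longrightarrow> integrable \<mu> (\<lambda>t. \<Sum>k. a k * t ^ k :: complex)"
  by (rule integrable_continuous[OF series_continuous])

lemma fourier_coeff_series:
  fixes a :: "nat \<Rightarrow> complex"
  assumes "summable (\<lambda>k. norm (a k))"
  shows "fourier_coeff (\<lambda>t. \<Sum>k. a k * t ^ k) n = (if n \<ge> 0 then a (nat n) else 0)"
proof -
  have "(\<lambda>k. a k * fourier_coeff (\<lambda>t. 1) (n - int k)) sums fourier_coeff (\<lambda>t. (\<Sum>k. a k * t ^ k) * 1) n"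
    by (rule fourier_coeff_series_mult[OF _ assms]) simp
  moreover have "(\<lambda>k. a k * fourier_coeff (\<lambda>t. 1) (n - int k)) sums (if n \<ge> 0 then a (nat n) else 0)"
  proof (cases "n \<ge> 0")
    case True
    then have "(\<lambda>k. a k * fourier_coeff (\<lambda>t. 1) (n - int k)) = (\<lambda>k. if k = nat n then a (nat n) else 0)"
      by (auto simp: fun_eq_iff fourier_coeff_one)
    then show ?thesis using sums_single[of "nat n" a] True by (simp add: if_distrib cong: if_cong)
  next
    case False
    then have "(\<lambda>k. a k * fourier_coeff (\<lambda>t. 1) (n - int k)) = (\<lambda>k. 0)"
      by (auto simp: fun_eq_iff fourier_coeff_one)
    then show ?thesis using False by simp
  qed
  ultimately show ?thesis by (simp add: sums_iff)
qed

lemma summable_coeff_power: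
  assumes "\<And>k. norm (c k :: complex) \<le> C" "norm z < 1"
  shows "summable (\<lambda>k. norm (c k * z ^ k))"
proof (rule summable_comparison_test')
  show "summable (\<lambda>k. C * norm z ^ k)" using assms by (intro summable_mult summable_geometric) auto
  show "norm (norm (c k * z ^ k)) \<le> C * norm z ^ k" if "k \<ge> 0" for k
    using assms(1)[of k] by (auto simp: norm_mult norm_power intro!: mult_right_mono)
qed

lemma summable_fourier:
  assumes "integrable \<mu> f" "norm z < 1"
  shows "summable (\<lambda>k. norm (fourier_coeff f (int k) * z ^ k))"
    "summable (\<lambda>k. norm (fourier_coeff f (- int k) * z ^ k))"
  using assms norm_fourier_coeff_le[OF assms(1)] by (auto intro!: summable_coeff_power)

text \<open>For f in L^p this is the holomorphic extension of P f to the disc. The series makes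
  sense for every integrable f, so it stands in for the Riesz projection before any boundedness is
  known.\<close>

definition analytic_part :: "(complex \<Rightarrow> complex) \<Rightarrow> complex \<Rightarrow> complex" where
  "analytic_part f z = (\<Sum>k. fourier_coeff f (int k) * z ^ k)"

text \<open>Written as a power series in z; the nonpositive frequencies of the Poisson integral at z
  appear when it is evaluated at cnj z.\<close>

definition coanalytic_part :: "(complex \<Rightarrow> complex) \<Rightarrow> complex \<Rightarrow> complex" where
  "coanalytic_part f z = (\<Sum>k. fourier_coeff f (- int k) * z ^ k)"

lemma one_minus_ne_0: "norm z < 1 \<Longrightarrow> norm t = 1 \<Longrightarrow> 1 - z * t \<noteq> (0::complex)"
  by (metis eq_iff_diff_eq_0 less_irrefl mult.right_neutral norm_mult norm_one)

lemma geometric_circle: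
  assumes "norm z < 1" "norm t = 1"
  shows "(\<Sum>k. z ^ k * t ^ k) = 1 / (1 - z * t :: complex)"
  using suminf_geometric[of "z * t"] assms by (simp add: norm_mult power_mult_distrib)

lemma summable_norm_power: "norm (z::complex) < 1 \<Longrightarrow> summable (\<lambda>k. norm (z ^ k))"
  by (simp add: norm_power summable_geometric)

lemma integrable_kernel_mult:
  assumes "integrable \<mu> f" "norm z < 1"
  shows "integrable \<mu> (\<lambda>t. f t / (1 - z * t))"
proof -
  have "integrable \<mu> (\<lambda>t. (\<Sum>k. z ^ k * t ^ k) * f t)"
    by (rule series_mult_integrable[OF assms(1) summable_norm_power[OF assms(2)]])
  then show ?thesis
    by (rule Bochner_Integration.integrable_cong[THEN iffD1, rotated -1])
       (auto simp: norm_circle geometric_circle assms(2))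
qed

lemma fourier_coeff_kernel_mult:
  assumes f: "integrable \<mu> f" and z: "norm z < 1"
  shows "(\<lambda>k. z ^ k * fourier_coeff f (n - int k)) sums fourier_coeff (\<lambda>t. f t / (1 - z * t)) n"
proof -
  have "fourier_coeff (\<lambda>t. (\<Sum>k. z ^ k * t ^ k) * f t) n = fourier_coeff (\<lambda>t. f t / (1 - z * t)) n"
    unfolding fourier_coeff_def
    by (rule Bochner_Integration.integral_cong) (auto simp: norm_circle geometric_circle z)
  then show ?thesis
    using fourier_coeff_series_mult[OF f summable_norm_power[OF z], of n] by simp
qed

lemma coanalytic_part_eq:
  assumes f: "integrable \<mu> f" and z: "norm z < 1"
  shows "coanalytic_part f z = (LINT t|\<mu>. f t / (1 - z * t))"
  using fourier_coeff_kernel_mult[OF assms, of 0]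
  by (simp add: sums_iff coanalytic_part_def mult.commute fourier_coeff_def)

lemma analytic_part_reflect:
  assumes [measurable]: "f \<in> borel_measurable \<mu>"
  shows "analytic_part f z = coanalytic_part (reflect f) z"
  by (simp add: analytic_part_def coanalytic_part_def fourier_coeff_reflect)

lemma integrable_reflect': "integrable \<mu> f \<Longrightarrow> integrable \<mu> (reflect f :: complex \<Rightarrow> complex)"
  unfolding reflect_def[abs_def] by (rule integrable_reflect)

lemma analytic_part_eq:
  assumes f: "integrable \<mu> f" and z: "norm z < 1"
  shows "analytic_part f z = (LINT t|\<mu>. f t / (1 - z / t))"
proof -
  have [measurable]: "f \<in> borel_measurable \<mu>" using f by auto
  have "analytic_part f z = (LINT t|\<mu>. f (1 / t) / (1 - z * t))"
    using analytic_part_reflect[of f] coanalytic_part_eq[OF integrable_reflect'[OF f] z]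
    by (simp add: reflect_def)
  also have "\<dots> = (LINT t|\<mu>. f t / (1 - z / t))"
    by (subst integral_reflect[symmetric]) auto
  finally show ?thesis .
qed

definition poisson :: "complex \<Rightarrow> complex \<Rightarrow> real" where
  "poisson z t = (1 - (norm z)\<^sup>2) / (norm (1 - z / t))\<^sup>2"

text \<open>With u = z / t this is 1 - |u|^2 = (1 - u) + (1 - cnj u) - |1 - u|^2 divided by |1 -
  u|^2. It splits the Poisson kernel into two Cauchy kernels minus the constant that both
  contain.\<close>

lemma poisson_eq:
  assumes z: "norm z < 1" and t: "norm t = 1"
  shows "of_real (poisson z t) = 1 / (1 - z / t) + 1 / (1 - cnj z * t) - 1"
proof -
  define u where "u = z / t"
  have cu: "cnj u = cnj z * t" using t by (simp add: u_def cnj_circle divide_inverse)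
  have nu: "norm u = norm z" using t by (simp add: u_def norm_divide)
  have u1: "1 - u \<noteq> 0" "1 - cnj u \<noteq> 0" using z nu by auto
  have gen: "(v + w - v * w) / (v * w) = 1 / v + 1 / w - 1" if "v \<noteq> 0" "w \<noteq> 0" for v w :: complex
    using that by (simp add: field_simps)
  have "(of_real ((norm (1 - u))\<^sup>2) :: complex) = (1 - u) * (1 - cnj u)"
    using complex_norm_square[of "1 - u"] by simp
  moreover have "(of_real ((norm u)\<^sup>2) :: complex) = u * cnj u"
    using complex_norm_square[of u] by simp
  ultimately have "(of_real (poisson z t) :: complex) = (1 - u * cnj u) / ((1 - u) * (1 - cnj u))"
    unfolding poisson_def nu[symmetric] u_def[symmetric] by simp
  also have "1 - u * cnj u = (1 - u) + (1 - cnj u) - (1 - u) * (1 - cnj u)"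
    by (simp add: algebra_simps)
  also have "\<dots> / ((1 - u) * (1 - cnj u)) = 1 / (1 - u) + 1 / (1 - cnj u) - 1"
    by (rule gen[OF u1])
  finally show ?thesis by (simp only: cu) (simp only: u_def)
qed

lemma poisson_nonneg: "norm z < 1 \<Longrightarrow> poisson z t \<ge> 0"
  by (simp add: poisson_def power_le_one)

lemma continuous_poisson:
  assumes "norm z < 1" shows "continuous_on unit_circle (poisson z)"
proof -
  have "1 - z / t \<noteq> 0" if "norm t = 1" for t
    using that assms by (metis diff_eq_diff_eq eq_iff_diff_eq_0 less_irrefl norm_divide norm_one div_by_1)
  then show ?thesis unfolding poisson_def[abs_def]
    by (intro continuous_intros) (auto simp: norm_circle)
qed

lemma meas_poisson [measurable]: "norm z < 1 \<Longrightarrow> poisson z \<in> borel_measurable \<mu>"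
  by (intro meas_continuous continuous_poisson)

lemma poisson_bound:
  assumes "norm z < 1" "norm t = 1"
  shows "poisson z t \<le> (1 - (norm z)\<^sup>2) / (1 - norm z)\<^sup>2"
proof -
  have "1 - norm z \<le> norm (1 - z / t)"
    using norm_triangle_ineq2[of 1 "z / t"] assms by (simp add: norm_divide)
  moreover from this have "0 < norm (1 - z / t)" using assms by linarith
  ultimately show ?thesis
    unfolding poisson_def using assms
    by (intro divide_left_mono power_mono mult_pos_pos zero_less_power) (auto simp: power_le_one)
qed

lemma integrable_poisson_mult:
  assumes "integrable \<mu> f" "norm z < 1"
  shows "integrable \<mu> (\<lambda>t. of_real (poisson z t) * f t :: complex)"
  using poisson_bound[OF assms(2)] poisson_nonneg[OF assms(2)] assms(2)
  by (intro integrable_bounded_mult[OF assms(1)]) (auto intro!: AE_circleI)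

lemma integrable_poisson_mult_real:
  assumes "integrable \<mu> f" "norm z < 1"
  shows "integrable \<mu> (\<lambda>t. poisson z t * f t)"
proof -
  have "integrable \<mu> (\<lambda>t. of_real (f t) :: complex)" using assms by auto
  from integrable_poisson_mult[OF this assms(2)]
  have "integrable \<mu> (\<lambda>t. of_real (poisson z t * f t) :: complex)" by simp
  then show ?thesis by (simp only: complex_of_real_integrable_eq)
qed

definition poisson_integral :: "(complex \<Rightarrow> complex) \<Rightarrow> complex \<Rightarrow> complex" where
  "poisson_integral f z = (LINT t|\<mu>. of_real (poisson z t) * f t)"

lemma poisson_integral_expand:
  assumes f: "integrable \<mu> f" and z: "norm z < 1"
  shows "poisson_integral f z = analytic_part f z + coanalytic_part f (cnj z) - fourier_coeff f 0"
proof -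
  have [measurable]: "f \<in> borel_measurable \<mu>" using f by auto
  have 1: "integrable \<mu> (\<lambda>t. f t / (1 - cnj z * t))"
    using f z by (intro integrable_kernel_mult) auto
  have "integrable \<mu> (\<lambda>t. reflect f t / (1 - z * t))"
    using f z by (intro integrable_kernel_mult integrable_reflect') auto
  from integrable_reflect[OF this] have 2: "integrable \<mu> (\<lambda>t. f t / (1 - z / t))"
    by (simp add: reflect_def)
  have "poisson_integral f z = (LINT t|\<mu>. f t / (1 - z / t) + f t / (1 - cnj z * t) - f t)"
    unfolding poisson_integral_def
    by (rule Bochner_Integration.integral_cong) (auto simp: norm_circle poisson_eq z algebra_simps)
  also have "\<dots> = (LINT t|\<mu>. f t / (1 - z / t)) + (LINT t|\<mu>. f t / (1 - cnj z * t)) - (LINT t|\<mu>. f t)"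
    using 1 2 f by simp
  finally show ?thesis
    using z f by (simp add: analytic_part_eq coanalytic_part_eq fourier_coeff_def)
qed

text \<open>Only the zeroth term of the coanalytic series survives, and it cancels the subtracted
  constant.\<close>

lemma poisson_integral_hardy:
  assumes f: "integrable \<mu> f" "\<forall>n<0. fourier_coeff f n = 0" and z: "norm z < 1"
  shows "poisson_integral f z = analytic_part f z"
proof -
  have "(\<lambda>k. fourier_coeff f (- int k) * cnj z ^ k) = (\<lambda>k. if k = 0 then fourier_coeff f 0 else 0)"
    using f by (auto simp: fun_eq_iff)
  moreover have "\<dots> sums fourier_coeff f 0" using sums_single[of 0 "\<lambda>_. fourier_coeff f 0"] by simp
  ultimately have "coanalytic_part f (cnj z) = fourier_coeff f 0"
    by (simp add: coanalytic_part_def sums_iff)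
  then show ?thesis using poisson_integral_expand[OF f(1) z] by simp
qed

lemma analytic_part_circle:
  "analytic_part f (of_real r * t) = (\<Sum>k. (fourier_coeff f (int k) * of_real r ^ k) * t ^ k)"
  by (simp add: analytic_part_def power_mult_distrib mult.assoc)

lemma coanalytic_part_circle:
  "coanalytic_part f (of_real r * t) = (\<Sum>k. (fourier_coeff f (- int k) * of_real r ^ k) * t ^ k)"
  by (simp add: coanalytic_part_def power_mult_distrib mult.assoc)

context
  fixes r :: real
  assumes r: "0 \<le> r" "r < 1"
begin

lemma norm_radius: "norm t = 1 \<Longrightarrow> norm (of_real r * t :: complex) < 1"
  using r by (simp add: norm_mult)

lemma summable_radius:
  assumes "integrable \<mu> f"
  shows "summable (\<lambda>k. norm (fourier_coeff f (int k) * of_real r ^ k))"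
    "summable (\<lambda>k. norm (fourier_coeff f (- int k) * of_real r ^ k))"
  using summable_fourier[OF assms, of "of_real r"] r by auto

lemma continuous_analytic_part:
  assumes "integrable \<mu> f"
  shows "continuous_on unit_circle (\<lambda>t. analytic_part f (of_real r * t))"
    "continuous_on unit_circle (\<lambda>t. coanalytic_part f (of_real r * t))"
  unfolding analytic_part_circle coanalytic_part_circle
  by (intro series_continuous summable_radius assms)+

lemma fourier_coeff_analytic_part:
  assumes "integrable \<mu> f"
  shows "fourier_coeff (\<lambda>t. analytic_part f (of_real r * t)) n =
    (if n \<ge> 0 then fourier_coeff f n * of_real r ^ nat n else 0)"
  unfolding analytic_part_circle using fourier_coeff_series[OF summable_radius(1)[OF assms], of n]
  by simp

lemma fourier_coeff_coanalytic_part: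
  assumes "integrable \<mu> f"
  shows "fourier_coeff (\<lambda>t. coanalytic_part f (of_real r * t)) n =
    (if n \<ge> 0 then fourier_coeff f (- n) * of_real r ^ nat n else 0)"
  unfolding coanalytic_part_circle using fourier_coeff_series[OF summable_radius(2)[OF assms], of n]
  by simp

lemma poisson_integral_circle:
  assumes f: "integrable \<mu> f" and t: "norm t = 1"
  shows "poisson_integral f (of_real r * t) =
    analytic_part f (of_real r * t) + coanalytic_part f (of_real r * (1 / t)) - fourier_coeff f 0"
  using poisson_integral_expand[OF f norm_radius[OF t]] t
  by (simp add: cnj_circle inverse_eq_divide)

lemma continuous_poisson_integral:
  assumes f: "integrable \<mu> f"
  shows "continuous_on unit_circle (\<lambda>t. poisson_integral f (of_real r * t))"
proof -
  have "continuous_on unit_circle (\<lambda>t. coanalytic_part f (of_real r * (1 / t)))"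
  proof (rule continuous_on_compose2[OF continuous_analytic_part(2)[OF f]])
    show "continuous_on unit_circle (\<lambda>t::complex. 1 / t)"
      by (auto intro!: continuous_intros simp: norm_circle)
  qed (auto simp: norm_circle norm_divide)
  then have "continuous_on unit_circle (\<lambda>t. analytic_part f (of_real r * t)
      + coanalytic_part f (of_real r * (1 / t)) - fourier_coeff f 0)"
    by (intro continuous_intros continuous_analytic_part f)
  then show ?thesis
    by (rule continuous_on_cong[THEN iffD1, rotated -1]) (auto simp: poisson_integral_circle f norm_circle)
qed

lemma integrable_poisson_integral:
  "integrable \<mu> f \<Longrightarrow> integrable \<mu> (\<lambda>t. poisson_integral f (of_real r * t))"
  by (rule integrable_continuous[OF continuous_poisson_integral])

lemma integral_poisson_integral:
  assumes f: "integrable \<mu> f"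
  shows "(LINT t|\<mu>. poisson_integral f (of_real r * t)) = (LINT t|\<mu>. f t)"
proof -
  let ?B = "\<lambda>t. coanalytic_part f (of_real r * t)"
  have A: "integrable \<mu> (\<lambda>t. analytic_part f (of_real r * t))" and B: "integrable \<mu> ?B"
    by (intro integrable_continuous continuous_analytic_part f)+
  have [measurable]: "?B \<in> borel_measurable \<mu>" using B by auto
  have "(LINT t|\<mu>. poisson_integral f (of_real r * t))
     = (LINT t|\<mu>. analytic_part f (of_real r * t) + ?B (1 / t) - fourier_coeff f 0)"
    by (rule Bochner_Integration.integral_cong) (auto simp: norm_circle poisson_integral_circle f)
  also have "\<dots> = (LINT t|\<mu>. analytic_part f (of_real r * t)) + (LINT t|\<mu>. ?B (1 / t)) - fourier_coeff f 0"
    using A integrable_reflect[OF B] mu.prob_space by simp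
  also have "(LINT t|\<mu>. ?B (1 / t)) = (LINT t|\<mu>. ?B t)"
    by (rule integral_reflect) simp
  finally show ?thesis
    using fourier_coeff_analytic_part[OF f, of 0] fourier_coeff_coanalytic_part[OF f, of 0]
    by (simp add: fourier_coeff_def)
qed

end

lemma integrable_of_real_iff: "integrable \<mu> (\<lambda>t. of_real (h t) :: complex) \<longleftrightarrow> integrable \<mu> h"
  by (rule complex_of_real_integrable_eq)

lemma poisson_integral_of_real:
  "poisson_integral (\<lambda>t. of_real (h t)) z = of_real (LINT t|\<mu>. poisson z t * h t)"
  unfolding poisson_integral_def by (simp flip: of_real_mult)

lemma poisson_mass:
  assumes "norm z < 1"
  shows "(LINT t|\<mu>. poisson z t) = 1"
proof -
  have "poisson_integral (\<lambda>t. 1) z = analytic_part (\<lambda>t. 1) z"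
    by (rule poisson_integral_hardy) (auto simp: fourier_coeff_one assms)
  also have "\<dots> = (\<Sum>k. if k = 0 then 1 else 0)"
    unfolding analytic_part_def by (rule suminf_cong) (auto simp: fourier_coeff_one)
  also have "\<dots> = 1" using sums_single[of 0 "\<lambda>_. 1::complex"] by (simp add: sums_iff)
  finally show ?thesis using poisson_integral_of_real[of "\<lambda>_. 1" z] by simp
qed

lemma norm_poisson_integral_le:
  assumes z: "norm z < 1"
  shows "norm (poisson_integral f z) \<le> (LINT t|\<mu>. poisson z t * norm (f t))"
proof -
  have "norm (poisson_integral f z) \<le> (LINT t|\<mu>. norm (of_real (poisson z t) * f t))"
    unfolding poisson_integral_def by (rule integral_norm_bound)
  also have "\<dots> = (LINT t|\<mu>. poisson z t * norm (f t))"
    using poisson_nonneg[OF z] by (simp add: norm_mult)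
  finally show ?thesis .
qed

text \<open>The mean of a Poisson integral over a circle is its zeroth Fourier coefficient, which is
  that of h. Comparing coefficients takes the place of exchanging the two integrations.\<close>

lemma poisson_mean:
  assumes r: "0 \<le> r" "r < 1" and h: "integrable \<mu> h"
  shows "integrable \<mu> (\<lambda>t. LINT s|\<mu>. poisson (of_real r * t) s * h s)"
    "(LINT t|\<mu>. (LINT s|\<mu>. poisson (of_real r * t) s * h s)) = (LINT t|\<mu>. h t)"
proof -
  let ?h = "\<lambda>t. of_real (h t) :: complex"
  have h': "integrable \<mu> ?h" using h by simp
  have "integrable \<mu> (\<lambda>t. of_real (LINT s|\<mu>. poisson (of_real r * t) s * h s) :: complex)"
    using integrable_poisson_integral[OF r h'] by (simp only: poisson_integral_of_real)
  then show i: "integrable \<mu> (\<lambda>t. LINT s|\<mu>. poisson (of_real r * t) s * h s)"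
    by (simp only: integrable_of_real_iff)
  have "(LINT t|\<mu>. of_real (LINT s|\<mu>. poisson (of_real r * t) s * h s) :: complex) = (LINT t|\<mu>. ?h t)"
    using integral_poisson_integral[OF r h'] by (simp only: poisson_integral_of_real)
  then show "(LINT t|\<mu>. (LINT s|\<mu>. poisson (of_real r * t) s * h s)) = (LINT t|\<mu>. h t)"
    by (simp only: integral_complex_of_real of_real_eq_iff)
qed

lemma poisson_contraction:
  assumes r: "0 \<le> r" "r < 1" and f: "integrable \<mu> f"
  shows "(LINT t|\<mu>. norm (poisson_integral f (of_real r * t))) \<le> (LINT t|\<mu>. norm (f t))"
proof -
  have "(LINT t|\<mu>. norm (poisson_integral f (of_real r * t)))
      \<le> (LINT t|\<mu>. (LINT s|\<mu>. poisson (of_real r * t) s * norm (f s)))"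
    using f by (intro integral_mono integrable_norm integrable_poisson_integral r poisson_mean)
       (auto simp: norm_circle intro!: norm_poisson_integral_le norm_radius r)
  also have "\<dots> = (LINT t|\<mu>. norm (f t))" using f by (intro poisson_mean r) auto
  finally show ?thesis .
qed

text \<open>The graph of the convex function x^p lies above its tangent at y. Young's inequality for
  x and y^(p - 1) gives this without derivatives and covers y = 0.\<close>

lemma powr_tangent:
  fixes x y p :: real
  assumes "p > 1" "x \<ge> 0" "y \<ge> 0"
  shows "x powr p \<ge> y powr p + p * y powr (p - 1) * (x - y)"
proof -
  define q where "q = p / (p - 1)"
  have q: "q > 1" "1 / p + 1 / q = 1" using assms by (auto simp: q_def field_simps)
  have "x * y powr (p - 1) \<le> x powr p / p + (y powr (p - 1)) powr q / q"
    by (rule Youngs_inequality) (use assms q in auto)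
  also have "(y powr (p - 1)) powr q = y powr p"
    using assms by (simp add: powr_powr q_def)
  finally have "p * (x * y powr (p - 1)) \<le> x powr p + (p / q) * y powr p"
    using assms by (simp add: field_simps)
  moreover have "p / q = p - 1" using assms by (simp add: q_def)
  moreover have "y powr p = y powr (p - 1) * y"
  proof (cases "y = 0")
    case False
    then show ?thesis using assms powr_add[of y "p - 1" 1] by simp
  qed simp
  ultimately show ?thesis by (simp add: algebra_simps)
qed

text \<open>The tangent inequality at the mean y is integrated against the probability density
  \<open>poisson z\<close>; the linear term integrates to zero.\<close>

lemma poisson_jensen:
  assumes p: "p > 1" and z: "norm z < 1" and h: "integrable \<mu> h" "\<And>t. h t \<ge> 0"
    and hp: "integrable \<mu> (\<lambda>t. h t powr p)"
  shows "(LINT t|\<mu>. poisson z t * h t) powr p \<le> (LINT t|\<mu>. poisson z t * h t powr p)"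
proof -
  define y where "y = (LINT t|\<mu>. poisson z t * h t)"
  note [simp] = poisson_nonneg[OF z] integrable_poisson_mult_real[OF h(1) z] integrable_poisson_mult_real[OF hp z]
  have ip: "integrable \<mu> (poisson z)" using integrable_poisson_mult_real[of "\<lambda>_. 1", OF _ z] by simp
  have y: "y \<ge> 0" unfolding y_def using h by (intro integral_nonneg_AE) auto
  have eq: "(\<lambda>t. poisson z t * (y powr p + p * y powr (p - 1) * (h t - y)))
     = (\<lambda>t. (y powr p - p * y powr (p-1) * y) * poisson z t + p * y powr (p - 1) * (poisson z t * h t))"
    by (auto simp: fun_eq_iff algebra_simps)
  have "(LINT t|\<mu>. poisson z t * (y powr p + p * y powr (p - 1) * (h t - y))) \<le> (LINT t|\<mu>. poisson z t * h t powr p)"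
  proof (rule integral_mono)
    show "integrable \<mu> (\<lambda>t. poisson z t * (y powr p + p * y powr (p - 1) * (h t - y)))"
      unfolding eq using ip by (intro Bochner_Integration.integrable_add integrable_mult_right) auto
  qed (auto intro!: mult_left_mono powr_tangent p h y)
  moreover have "(LINT t|\<mu>. poisson z t * (y powr p + p * y powr (p - 1) * (h t - y))) = y powr p"
    unfolding eq using ip by (simp add: poisson_mass z y_def[symmetric])
  ultimately show ?thesis unfolding y_def by simp
qed

lemma poisson_integral_powi:
  assumes r: "0 \<le> r" "r < 1" and t: "norm t = 1"
  shows "poisson_integral (\<lambda>t. t powi k) (of_real r * t) = of_real (r ^ nat \<bar>k\<bar>) * t powi k"
proof -
  have i: "integrable \<mu> (\<lambda>t. t powi k)"
    by (intro integrable_continuous continuous_intros) (auto simp: norm_circle)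
  have "t \<noteq> 0" using t by auto
  have A: "analytic_part (\<lambda>t. t powi k) z = (if k \<ge> 0 then z ^ nat k else 0)" for z
  proof -
    have "analytic_part (\<lambda>t. t powi k) z = (\<Sum>j. if j = nat k then if k \<ge> 0 then z ^ j else 0 else 0)"
      unfolding analytic_part_def by (rule suminf_cong) (auto simp: fourier_coeff_powi)
    then show ?thesis using sums_single[of "nat k" "\<lambda>j. if k \<ge> 0 then z ^ j else 0"] by (simp add: sums_iff)
  qed
  have B: "coanalytic_part (\<lambda>t. t powi k) z = (if k \<le> 0 then z ^ nat (- k) else 0)" for z
  proof -
    have "coanalytic_part (\<lambda>t. t powi k) z = (\<Sum>j. if j = nat (-k) then if k \<le> 0 then z ^ j else 0 else 0)"
      unfolding coanalytic_part_def by (rule suminf_cong) (auto simp: fourier_coeff_powi)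
    then show ?thesis using sums_single[of "nat (-k)" "\<lambda>j. if k \<le> 0 then z ^ j else 0"] by (simp add: sums_iff)
  qed
  consider "k = 0" | "k > 0" | "k < 0" by linarith
  then show ?thesis
    unfolding poisson_integral_circle[OF r i t] A B fourier_coeff_powi
    using \<open>t \<noteq> 0\<close>
    by cases (auto simp: fourier_coeff_powi power_int_def power_mult_distrib power_divide divide_inverse power_inverse)
qed

lemma trig_eq_sum:
  assumes "norm (t::complex) = 1"
  shows "poly a t / t ^ N = (\<Sum>i\<le>degree a. coeff a i * t powi (int i - int N))"
proof -
  have "t \<noteq> 0" using assms by auto
  then show ?thesis
    by (simp add: poly_altdef sum_divide_distrib power_int_diff)
qed

lemma poisson_integral_cong:
  "(\<And>t. norm t = 1 \<Longrightarrow> f t = h t) \<Longrightarrow> poisson_integral f z = poisson_integral h z"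
  unfolding poisson_integral_def by (rule Bochner_Integration.integral_cong) (auto simp: norm_circle)

lemma poisson_integral_diff:
  assumes "integrable \<mu> f" "integrable \<mu> h" "norm z < 1"
  shows "poisson_integral (\<lambda>t. f t - h t) z = poisson_integral f z - poisson_integral h z"
  unfolding poisson_integral_def using assms by (simp add: right_diff_distrib integrable_poisson_mult)

lemma poisson_integral_cmult: "poisson_integral (\<lambda>t. c * f t) z = c * poisson_integral f z"
  unfolding poisson_integral_def by (simp add: mult.left_commute)

lemma poisson_integral_sum:
  assumes "\<And>i. i \<in> I \<Longrightarrow> integrable \<mu> (f i)" "norm z < 1"
  shows "poisson_integral (\<lambda>t. \<Sum>i\<in>I. f i t) z = (\<Sum>i\<in>I. poisson_integral (f i) z)"
  unfolding poisson_integral_def using assms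
  by (simp add: sum_distrib_left integrable_poisson_mult)

text \<open>Each frequency k is damped by r^|k|, so the error is bounded uniformly on the circle by
  a finite sum that vanishes as r tends to 1.\<close>

lemma poisson_integral_trig:
  assumes r: "0 \<le> r" "r < 1"
  shows "(LINT t|\<mu>. norm (poisson_integral (\<lambda>t. poly a t / t ^ N) (of_real r * t) - poly a t / t ^ N))
    \<le> (\<Sum>i\<le>degree a. norm (coeff a i) * (1 - r ^ nat \<bar>int i - int N\<bar>))"
proof -
  let ?P = "poisson_integral (\<lambda>t. poly a t / t ^ N)"
  let ?C = "\<Sum>i\<le>degree a. norm (coeff a i) * (1 - r ^ nat \<bar>int i - int N\<bar>)"
  have i: "integrable \<mu> (\<lambda>t. t powi k)" for k
    by (intro integrable_continuous continuous_intros) (auto simp: norm_circle)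
  have *: "norm (?P (of_real r * t) - poly a t / t ^ N) \<le> ?C" if t: "norm t = 1" for t
  proof -
    have "?P (of_real r * t) = poisson_integral (\<lambda>t. \<Sum>i\<le>degree a. coeff a i * t powi (int i - int N)) (of_real r * t)"
      by (rule poisson_integral_cong) (rule trig_eq_sum)
    also have "\<dots> = (\<Sum>i\<le>degree a. coeff a i * (of_real (r ^ nat \<bar>int i - int N\<bar>) * t powi (int i - int N)))"
      using i norm_radius[OF r t]
      by (simp add: poisson_integral_sum poisson_integral_cmult poisson_integral_powi r t)
    finally have "?P (of_real r * t) - poly a t / t ^ N =
       (\<Sum>i\<le>degree a. coeff a i * (of_real (r ^ nat \<bar>int i - int N\<bar>) - 1) * t powi (int i - int N))"
      by (simp only: trig_eq_sum[OF t] sum_subtractf[symmetric]) (simp only: algebra_simps mult_1_left)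
    also have "norm \<dots> \<le> (\<Sum>i\<le>degree a. norm (coeff a i * (of_real (r ^ nat \<bar>int i - int N\<bar>) - 1) * t powi (int i - int N)))"
      by (rule norm_sum)
    also have "\<dots> = ?C"
    proof (rule sum.cong)
      fix i
      have "norm (of_real (r ^ nat \<bar>int i - int N\<bar>) - 1 :: complex) = 1 - r ^ nat \<bar>int i - int N\<bar>"
        using r power_le_one[of r "nat \<bar>int i - int N\<bar>"]
        by (metis abs_minus_commute abs_of_nonneg diff_ge_0_iff_ge less_imp_le norm_of_real of_real_1 of_real_diff)
      then show "norm (coeff a i * (of_real (r ^ nat \<bar>int i - int N\<bar>) - 1) * t powi (int i - int N))
          = norm (coeff a i) * (1 - r ^ nat \<bar>int i - int N\<bar>)"
        using t by (simp add: norm_mult norm_powi_circle)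
    qed simp
    finally show ?thesis .
  qed
  have "(LINT t|\<mu>. norm (?P (of_real r * t) - poly a t / t ^ N)) \<le> (LINT t|\<mu>. ?C)"
    by (intro integral_mono integrable_norm Bochner_Integration.integrable_diff integrable_poisson_integral integrable_trig r)
       (auto simp: norm_circle *)
  then show ?thesis using mu.prob_space by simp
qed

text \<open>Trigonometric polynomials converge by the damping of frequencies, and the Poisson
  operators are contractions on L^1, so an approximation error below e / 3 is not enlarged.\<close>

theorem poisson_L1_convergence:
  assumes f: "integrable \<mu> f" and r: "\<And>n. 0 \<le> r n" "\<And>n. r n < 1" "r \<longlonglongrightarrow> 1"
  shows "(\<lambda>n. LINT t|\<mu>. norm (poisson_integral f (of_real (r n) * t) - f t)) \<longlonglongrightarrow> 0"
proof (rule tendstoI)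
  fix e :: real assume e: "e > 0"
  then obtain a N where a: "(LINT t|\<mu>. norm (f t - poly a t / t ^ N)) < e / 3"
    using trig_approx[OF f] unfolding trig_approx_def by (meson divide_pos_pos zero_less_numeral)
  define h :: "complex \<Rightarrow> complex" where "h t = poly a t / t ^ N" for t
  have h: "integrable \<mu> h" unfolding h_def by (rule integrable_trig)
  have "(\<lambda>n. \<Sum>i\<le>degree a. norm (coeff a i) * (1 - r n ^ nat \<bar>int i - int N\<bar>))
      \<longlonglongrightarrow> (\<Sum>i\<le>degree a. norm (coeff a i) * (1 - 1 ^ nat \<bar>int i - int N\<bar>))"
    by (intro tendsto_intros r)
  then have "eventually (\<lambda>n. (\<Sum>i\<le>degree a. norm (coeff a i) * (1 - r n ^ nat \<bar>int i - int N\<bar>)) < e / 3) sequentially"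
    by (rule order_tendstoD(2)) (use e in simp)
  then show "\<forall>\<^sub>F n in sequentially. dist (LINT t|\<mu>. norm (poisson_integral f (of_real (r n) * t) - f t)) 0 < e"
  proof eventually_elim
    case (elim n)
    let ?P = "\<lambda>f t. poisson_integral f (of_real (r n) * t)"
    have Pf: "integrable \<mu> (?P f)" and Ph: "integrable \<mu> (?P h)"
      by (intro integrable_poisson_integral r f h)+
    have "(LINT t|\<mu>. norm (?P f t - ?P h t)) = (LINT t|\<mu>. norm (?P (\<lambda>t. f t - h t) t))"
      using norm_radius[OF r(1,2)]
      by (intro Bochner_Integration.integral_cong) (auto simp: norm_circle poisson_integral_diff f h)
    also have "\<dots> \<le> (LINT t|\<mu>. norm (f t - h t))"
      by (intro poisson_contraction r Bochner_Integration.integrable_diff f h)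
    also have "\<dots> < e / 3" using a by (simp add: h_def)
    finally have 1: "(LINT t|\<mu>. norm (?P f t - ?P h t)) < e / 3" .
    have 2: "(LINT t|\<mu>. norm (?P h t - h t)) < e / 3"
      using elim poisson_integral_trig[OF r(1,2), of a N n] unfolding h_def by linarith
    have "(LINT t|\<mu>. norm (h t - f t)) = (LINT t|\<mu>. norm (f t - h t))"
      by (simp add: norm_minus_commute)
    then have 3: "(LINT t|\<mu>. norm (h t - f t)) < e / 3" using a by (simp add: h_def)
    have "(LINT t|\<mu>. norm (?P f t - f t)) < e"
      using integral_norm_triangle[OF Pf Ph f] integral_norm_triangle[OF Ph h f] 1 2 3 by linarith
    moreover have "(LINT t|\<mu>. norm (?P f t - f t)) \<ge> 0" by simp
    ultimately show ?case by (simp add: dist_norm)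
  qed
qed

lemma radii_tendsto_one:
  obtains r :: "nat \<Rightarrow> real" where "\<And>n. 0 \<le> r n" "\<And>n. r n < 1" "r \<longlonglongrightarrow> 1"
proof (rule that)
  let ?r = "\<lambda>n. 1 - inverse (real (Suc n))"
  show "0 \<le> ?r n" "?r n < 1" for n by (auto simp: inverse_le_1_iff)
  show "?r \<longlonglongrightarrow> 1" using tendsto_diff[OF tendsto_const LIMSEQ_inverse_real_of_nat, of 1] by simp
qed

text \<open>If all coefficients vanish, so do all Poisson integrals, and these converge to f in
  L^1.\<close>

theorem fourier_unique:
  assumes f: "integrable \<mu> f" and 0: "\<And>n. fourier_coeff f n = 0"
  shows "AE t in \<mu>. f t = 0"
proof -
  obtain r :: "nat \<Rightarrow> real" where r: "\<And>n. 0 \<le> r n" "\<And>n. r n < 1" and rl: "r \<longlonglongrightarrow> 1"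
    using radii_tendsto_one by blast
  have "poisson_integral f (of_real (r n) * t) = 0" if "norm t = 1" for n t
    using poisson_integral_expand[OF f norm_radius[OF r that]]
    by (simp add: analytic_part_def coanalytic_part_def 0)
  then have "(LINT t|\<mu>. norm (poisson_integral f (of_real (r n) * t) - f t)) = (LINT t|\<mu>. norm (f t))" for n
    by (intro Bochner_Integration.integral_cong) (auto simp: norm_circle)
  then have "(\<lambda>n. (LINT t|\<mu>. norm (f t))) \<longlonglongrightarrow> 0"
    using poisson_L1_convergence[OF f r rl] by simp
  then have "(LINT t|\<mu>. norm (f t)) = 0" by (simp add: LIMSEQ_const_iff)
  then show ?thesis using f by (simp add: integral_nonneg_eq_0_iff_AE)
qed

section \<open>Lebesgue spaces on the circle\<close>

lemma LpD:
  assumes "f \<in> Lp p"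
  shows "f \<in> borel_measurable \<mu>" "integrable \<mu> (\<lambda>t. norm (f t) powr p)"
  using assms by (auto simp: Lp_def)

lemma LpI_le:
  assumes [measurable]: "f \<in> borel_measurable \<mu>" and h: "integrable \<mu> h"
    and *: "AE t in \<mu>. norm (f t) powr p \<le> h t"
  shows "f \<in> Lp p"
  unfolding Lp_def
proof (intro CollectI conjI)
  show "integrable \<mu> (\<lambda>t. norm (f t) powr p)"
    by (rule Bochner_Integration.integrable_bound[OF h]) (use * in auto)
qed simp

lemma LpI_bounded:
  assumes "f \<in> borel_measurable \<mu>" "AE t in \<mu>. norm (f t) \<le> C" "p > 0"
  shows "f \<in> Lp p"
  by (rule LpI_le[where h="\<lambda>_. C powr p"])
     (use assms in \<open>auto elim!: eventually_mono intro!: powr_mono2\<close>)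

lemma LpI_continuous:
  assumes f: "continuous_on unit_circle f" and "p > 0"
  shows "f \<in> Lp p"
proof -
  have "compact (f ` unit_circle)"
    using assms by (intro compact_continuous_image) (auto simp: unit_circle_def)
  then obtain C where "\<And>t. norm t = 1 \<Longrightarrow> norm (f t) \<le> C"
    by (meson bounded_iff compact_imp_bounded imageI norm_circle)
  then show ?thesis by (intro LpI_bounded meas_continuous f \<open>p > 0\<close> AE_circleI)
qed

lemma Lp_bounded_mult:
  assumes f: "f \<in> Lp p" and h[measurable]: "h \<in> borel_measurable \<mu>"
    and b: "AE t in \<mu>. norm (h t) \<le> C" and p: "p > 0"
  shows "(\<lambda>t. h t * f t) \<in> Lp p"
proof (rule LpI_le)
  have [measurable]: "f \<in> borel_measurable \<mu>" using LpD[OF f] by auto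
  show "(\<lambda>t. h t * f t) \<in> borel_measurable \<mu>" by simp
  show "integrable \<mu> (\<lambda>t. C powr p * norm (f t) powr p)" using LpD[OF f] by auto
  show "AE t in \<mu>. norm (h t * f t) powr p \<le> C powr p * norm (f t) powr p"
    using b by eventually_elim (use p in \<open>auto simp: norm_mult powr_mult intro!: mult_right_mono powr_mono2\<close>)
qed

lemma powr_add_le:
  fixes x y p :: real
  assumes "x \<ge> 0" "y \<ge> 0" "p > 0"
  shows "(x + y) powr p \<le> 2 powr p * (x powr p + y powr p)"
proof -
  have "(x + y) powr p \<le> (2 * max x y) powr p" using assms by (intro powr_mono2) auto
  also have "\<dots> = 2 powr p * max x y powr p" using assms by (simp add: powr_mult)
  also have "max x y powr p \<le> x powr p + y powr p" by (auto simp: max_def)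
  finally show ?thesis by simp
qed

lemma Lp_add:
  assumes f: "f \<in> Lp p" and h: "h \<in> Lp p" and p: "p > 0"
  shows "(\<lambda>t. f t + h t) \<in> Lp p"
proof (rule LpI_le)
  show "(\<lambda>t. f t + h t) \<in> borel_measurable \<mu>" using LpD[OF f] LpD[OF h] by auto
  show "integrable \<mu> (\<lambda>t. 2 powr p * (norm (f t) powr p + norm (h t) powr p))"
    using LpD[OF f] LpD[OF h] by auto
  show "AE t in \<mu>. norm (f t + h t) powr p \<le> 2 powr p * (norm (f t) powr p + norm (h t) powr p)"
    using p by (intro AE_I2 order_trans[OF powr_mono2 powr_add_le]) (auto intro: norm_triangle_ineq)
qed

lemma Lp_cmult: "f \<in> Lp p \<Longrightarrow> p > 0 \<Longrightarrow> (\<lambda>t. c * f t) \<in> Lp p"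
  by (rule Lp_bounded_mult[where C="norm c"]) auto

lemma Lp_diff:
  assumes f: "f \<in> Lp p" and h: "h \<in> Lp p" and p: "p > 0"
  shows "(\<lambda>t. f t - h t) \<in> Lp p"
  using Lp_add[OF f Lp_cmult[OF h p, of "-1"] p] by simp

lemma Lp_diff_integral_bound:
  assumes f: "f \<in> Lp p" and h: "h \<in> Lp p" and p: "p > 0"
  shows "(LINT t|\<mu>. norm (f t - h t) powr p)
    \<le> 2 powr p * ((LINT t|\<mu>. norm (f t) powr p) + (LINT t|\<mu>. norm (h t) powr p))"
proof -
  have "(LINT t|\<mu>. norm (f t - h t) powr p) \<le> (LINT t|\<mu>. 2 powr p * (norm (f t) powr p + norm (h t) powr p))"
  proof (rule integral_mono)
    fix t
    have "norm (f t - h t) powr p \<le> (norm (f t) + norm (h t)) powr p"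
      using p by (intro powr_mono2 norm_triangle_ineq4) auto
    also have "\<dots> \<le> 2 powr p * (norm (f t) powr p + norm (h t) powr p)"
      using p by (intro powr_add_le) auto
    finally show "norm (f t - h t) powr p \<le> 2 powr p * (norm (f t) powr p + norm (h t) powr p)" .
  qed (use LpD(2)[OF Lp_diff[OF assms]] LpD(2)[OF f] LpD(2)[OF h] in auto)
  then show ?thesis using LpD(2)[OF f] LpD(2)[OF h] by simp
qed

lemma Lp_reflect: "f \<in> Lp p \<Longrightarrow> reflect f \<in> Lp p"
  unfolding Lp_def using integrable_reflect[of "\<lambda>t. norm (f t) powr p"]
  by (auto simp: reflect_def)

lemma Lp_integrable:
  assumes f: "f \<in> Lp p" and p: "p \<ge> 1"
  shows "integrable \<mu> f"
proof (rule Bochner_Integration.integrable_bound)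
  show "integrable \<mu> (\<lambda>t. 1 + norm (f t) powr p)" using LpD[OF f] by auto
  have "norm (f t) \<le> 1 + norm (f t) powr p" for t
  proof (cases "norm (f t) \<le> 1")
    case False
    then have "norm (f t) powr 1 \<le> norm (f t) powr p" using p by (intro powr_mono) auto
    then show ?thesis using False by simp
  qed (simp add: add_increasing2)
  then show "AE t in \<mu>. norm (f t) \<le> norm (1 + norm (f t) powr p)" by (simp add: add_nonneg_nonneg)
qed (use LpD[OF f] in auto)

lemma conj_exponent:
  assumes "p > 1"
  shows "conj_exponent p > 1" "1 / p + 1 / conj_exponent p = 1"
    "conj_exponent (conj_exponent p) = p" "(p - 1) * conj_exponent p = p"
    "(conj_exponent p - 1) * p = conj_exponent p"
  using assms by (auto simp: conj_exponent_def field_simps)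

lemma Lp_norm_nonneg: "Lp_norm p f \<ge> 0" by (simp add: Lp_norm_def)

lemma Lp_norm_powr:
  assumes "p > 0" shows "Lp_norm p f powr p = (LINT t|\<mu>. norm (f t) powr p)"
proof -
  have "(LINT t|\<mu>. norm (f t) powr p) \<ge> 0" by simp
  then show ?thesis using assms by (simp add: Lp_norm_def powr_powr)
qed

lemma Lp_norm_eq_0:
  assumes f: "f \<in> Lp p" and 0: "Lp_norm p f = 0"
  shows "AE t in \<mu>. f t = 0"
proof -
  have "(LINT t|\<mu>. norm (f t) powr p) = 0" using 0 by (simp add: Lp_norm_def)
  then have "AE t in \<mu>. norm (f t) powr p = 0"
    using LpD[OF f] by (subst (asm) integral_nonneg_eq_0_iff_AE) auto
  then show ?thesis by eventually_elim simp
qed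

lemma Lp_norm_cong_AE:
  assumes "f \<in> borel_measurable \<mu>" "h \<in> borel_measurable \<mu>" "AE t in \<mu>. f t = h t"
  shows "Lp_norm p f = Lp_norm p h"
proof -
  have "(LINT t|\<mu>. norm (f t) powr p) = (LINT t|\<mu>. norm (h t) powr p)"
    using assms by (intro integral_cong_AE) auto
  then show ?thesis by (simp add: Lp_norm_def)
qed

lemma Lp_norm_cmult:
  assumes "p > 0"
  shows "Lp_norm p (\<lambda>t. c * f t) = norm c * Lp_norm p f"
  using assms unfolding Lp_norm_def by (simp add: norm_mult powr_mult powr_powr)

lemma Lp_norm_mono:
  assumes "f \<in> borel_measurable \<mu>" "h \<in> Lp p" "AE t in \<mu>. norm (f t) \<le> norm (h t)" "p > 0"
  shows "Lp_norm p f \<le> Lp_norm p h"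
proof -
  have m: "AE t in \<mu>. norm (f t) powr p \<le> norm (h t) powr p"
    using assms(3) by eventually_elim (use assms in \<open>auto intro!: powr_mono2\<close>)
  then have "f \<in> Lp p" by (intro LpI_le[OF assms(1) LpD(2)[OF assms(2)]])
  then show ?thesis
    unfolding Lp_norm_def using m assms LpD(2)
    by (intro powr_mono2 integral_mono_AE) auto
qed

lemma holder:
  assumes p: "p > 1" and f: "f \<in> Lp p" and h: "h \<in> Lp (conj_exponent p)"
  shows "integrable \<mu> (\<lambda>t. f t * h t)"
    "(LINT t|\<mu>. norm (f t * h t)) \<le> Lp_norm p f * Lp_norm (conj_exponent p) h"
proof -
  define q where "q = conj_exponent p"
  have q: "q > 1" "1 / p + 1 / q = 1" using conj_exponent[OF p] by (auto simp: q_def)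
  note h = h[folded q_def]
  have [measurable]: "f \<in> borel_measurable \<mu>" "h \<in> borel_measurable \<mu>" using LpD f h by auto
  have young: "norm (x * y) \<le> norm x powr p / p + norm y powr q / q" for x y :: complex
    unfolding norm_mult by (rule Youngs_inequality) (use p q in auto)
  show i: "integrable \<mu> (\<lambda>t. f t * h t)"
  proof (rule Bochner_Integration.integrable_bound)
    show "integrable \<mu> (\<lambda>t. norm (f t) powr p / p + norm (h t) powr q / q)"
      using LpD f h by auto
    show "AE t in \<mu>. norm (f t * h t) \<le> norm (norm (f t) powr p / p + norm (h t) powr q / q)"
      by (rule AE_I2) (use young order_trans abs_ge_self in \<open>fastforce\<close>)
  qed simp
  define a b where "a = Lp_norm p f" and "b = Lp_norm q h"
  show "(LINT t|\<mu>. norm (f t * h t)) \<le> Lp_norm p f * Lp_norm (conj_exponent p) h"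
  proof (cases "a = 0 \<or> b = 0")
    case True
    then have "(AE t in \<mu>. f t = 0) \<or> (AE t in \<mu>. h t = 0)"
      using f h by (auto simp: a_def b_def dest: Lp_norm_eq_0)
    then have "AE t in \<mu>. norm (f t * h t) = 0" by (auto elim!: eventually_mono)
    then have "(LINT t|\<mu>. norm (f t * h t)) = (LINT t|\<mu>. 0)" by (intro integral_cong_AE) auto
    then show ?thesis using Lp_norm_nonneg by simp
  next
    case False
    then have ab: "a > 0" "b > 0" using Lp_norm_nonneg[of p f] Lp_norm_nonneg[of q h] by (auto simp: a_def b_def)
    have "(LINT t|\<mu>. norm (f t * h t) / (a * b))
       \<le> (LINT t|\<mu>. norm (f t) powr p / (a powr p * p) + norm (h t) powr q / (b powr q * q))"
    proof (rule integral_mono)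
      fix t
      have "norm (f t * h t) / (a * b) = norm ((f t / of_real a) * (h t / of_real b))"
        using ab by (simp add: norm_mult norm_divide)
      also have "\<dots> \<le> norm (f t / of_real a) powr p / p + norm (h t / of_real b) powr q / q" by (rule young)
      finally show "norm (f t * h t) / (a * b) \<le> norm (f t) powr p / (a powr p * p) + norm (h t) powr q / (b powr q * q)"
        using ab by (simp add: norm_divide powr_divide)
    qed (use i LpD f h in auto)
    also have "\<dots> = a powr p / (a powr p * p) + b powr q / (b powr q * q)"
      using LpD f h p q by (simp add: a_def b_def Lp_norm_powr)
    also have "\<dots> = 1" using ab q by simp
    finally show ?thesis using ab by (simp add: field_simps a_def b_def q_def)
  qed
qed

lemma Lp_norm_1: "Lp_norm p (\<lambda>t. 1) = 1"
  using mu.prob_space by (simp add: Lp_norm_def)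

lemma integral_norm_le_Lp_norm:
  assumes p: "p > 1" and f: "f \<in> Lp p"
  shows "(LINT t|\<mu>. norm (f t)) \<le> Lp_norm p f"
proof -
  have "(\<lambda>t. 1) \<in> Lp (conj_exponent p)" using conj_exponent[OF p] by (intro LpI_continuous) auto
  from holder(2)[OF p f this] show ?thesis by (simp add: Lp_norm_1)
qed

text \<open>Jensen's inequality at each point of the circle of radius r, followed by averaging over
  that circle.\<close>

lemma poisson_Lp_contraction:
  assumes p: "p > 1" and r: "0 \<le> r" "r < 1" and f: "f \<in> Lp p"
  shows "(LINT t|\<mu>. norm (poisson_integral f (of_real r * t)) powr p) \<le> (LINT t|\<mu>. norm (f t) powr p)"
proof -
  have i: "integrable \<mu> f" using f p by (intro Lp_integrable) auto
  note c = continuous_poisson_integral[OF r i]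
  have "(LINT t|\<mu>. norm (poisson_integral f (of_real r * t)) powr p)
      \<le> (LINT t|\<mu>. (LINT s|\<mu>. poisson (of_real r * t) s * norm (f s) powr p))"
  proof (rule integral_mono)
    show "integrable \<mu> (\<lambda>t. norm (poisson_integral f (of_real r * t)) powr p)"
      using LpI_continuous[OF c] p LpD by auto
    fix t assume "t \<in> space \<mu>"
    then have z: "norm (of_real r * t) < 1" by (simp add: norm_circle norm_radius r)
    have "norm (poisson_integral f (of_real r * t)) powr p \<le> (LINT s|\<mu>. poisson (of_real r * t) s * norm (f s)) powr p"
      using p by (intro powr_mono2 norm_poisson_integral_le z) auto
    also have "\<dots> \<le> (LINT s|\<mu>. poisson (of_real r * t) s * norm (f s) powr p)"
      using i LpD(2)[OF f] by (intro poisson_jensen p z) auto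
    finally show "norm (poisson_integral f (of_real r * t)) powr p \<le> (LINT s|\<mu>. poisson (of_real r * t) s * norm (f s) powr p)" .
  qed (intro poisson_mean r LpD f)
  also have "\<dots> = (LINT t|\<mu>. norm (f t) powr p)" by (intro poisson_mean r LpD f)
  finally show ?thesis .
qed

section \<open>M. Riesz's inequality\<close>

text \<open>The term cos(x)^p degenerates at x = pi / 2, but for 1 < p <= 2 the angle p x then lies
  in (pi / 2, pi], where -cos(p x) is positive and compensates. This is where the restriction p <= 2
  enters M. Riesz's inequality.\<close>

lemma cos_powr_inequality:
  assumes p: "1 < p" "p \<le> 2"
  obtains A B :: real where "A \<ge> 0" "B \<ge> 0"
    "\<And>x. \<bar>x\<bar> \<le> pi / 2 \<Longrightarrow> 1 \<le> A * cos x powr p - B * cos (p * x)"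
proof -
  \<comment> \<open>The midpoint between pi / (2 p), where cos(p x) changes sign, and pi / 2, where
    cos x vanishes. B is scaled so that the second term alone gives 1 beyond y, and A so that the
    first term absorbs a loss of at most B below y.\<close>
  define y where "y = (pi / (2 * p) + pi / 2) / 2"
  have "pi / (2 * p) < pi / 2" using p by (simp add: field_simps)
  then have y: "pi / (2 * p) < y" "y < pi / 2" by (auto simp: y_def)
  have y0: "0 < y" using y(1) p by (meson divide_pos_pos less_trans mult_pos_pos pi_gt_zero zero_less_numeral zero_less_one)
  have py: "pi / 2 < p * y" using y(1) p by (simp add: field_simps)
  have ppi: "p * (pi / 2) \<le> pi" using p by (simp add: field_simps)
  have "cos (p * y) < cos (pi / 2)"
  proof (rule cos_monotone_0_pi)
    have "p * y < p * (pi / 2)" using y p by (intro mult_strict_left_mono) auto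
    then show "p * y \<le> pi" using ppi by linarith
  qed (use py in auto)
  then have k: "cos (p * y) < 0" by simp
  have g: "cos y > 0" using y y0 by (intro cos_gt_zero_pi) auto
  define B where "B = - 1 / cos (p * y)"
  define A where "A = (1 + B) / cos y powr p"
  have B: "B \<ge> 0" using k by (simp add: B_def divide_nonneg_neg)
  have A: "A \<ge> 0" using B by (simp add: A_def)
  have main: "1 \<le> A * cos x powr p - B * cos (p * x)" if x: "0 \<le> x" "x \<le> pi / 2" for x
  proof (cases "x \<ge> y")
    case True
    have "p * x \<le> p * (pi / 2)" using x p by (intro mult_left_mono) auto
    then have "p * x \<le> pi" using ppi by linarith
    moreover have "0 \<le> p * y" using py pi_gt_zero by linarith
    ultimately have "cos (p * x) \<le> cos (p * y)"
      using True p by (intro cos_monotone_0_pi_le mult_left_mono) auto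
    then have "B * cos (p * x) \<le> B * cos (p * y)" using B by (intro mult_left_mono)
    also have "B * cos (p * y) = - 1" using k by (simp add: B_def)
    finally have "B * cos (p * x) \<le> - 1" .
    moreover have "A * cos x powr p \<ge> 0" using A by simp
    ultimately show ?thesis by linarith
  next
    case False
    then have "cos y \<le> cos x" using x y by (intro cos_monotone_0_pi_le) auto
    then have "cos y powr p \<le> cos x powr p" using g p by (intro powr_mono2) auto
    then have "A * cos y powr p \<le> A * cos x powr p" using A by (intro mult_left_mono)
    moreover have "A * cos y powr p = 1 + B" using g by (simp add: A_def)
    moreover have "B * cos (p * x) \<le> B * 1" using B by (intro mult_left_mono) auto
    ultimately show ?thesis by simp
  qed
  show thesis
  proof (rule that[OF A B])
    fix x :: real assume "\<bar>x\<bar> \<le> pi / 2"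
    then show "1 \<le> A * cos x powr p - B * cos (p * x)"
      using main[of x] main[of "- x"] by (cases "x \<ge> 0") auto
  qed
qed

text \<open>Polar coordinates: dividing by norm z powr p leaves the trigonometric inequality for the
  argument of z, which lies strictly between -pi / 2 and pi / 2.\<close>

lemma Re_powr_inequality:
  assumes p: "p > 0" and A: "\<And>x. \<bar>x\<bar> \<le> pi / 2 \<Longrightarrow> 1 \<le> A * cos x powr p - B * cos (p * x)"
    and z: "Re z > 0"
  shows "norm z powr p \<le> A * Re z powr p - B * Re (z powr of_real p)"
proof -
  have z0: "z \<noteq> 0" using z by auto
  define x where "x = Im (Ln z)"
  have x: "\<bar>x\<bar> < pi / 2" using z Re_Ln_pos_lt[OF z0] by (simp add: x_def)
  have zx: "z = of_real (norm z) * cis x"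
    using exp_Ln[OF z0] Re_Ln[OF z0] z0 by (metis exp_eq_polar exp_ln_iff norm_exp_eq_Re x_def)
  have "Re (of_real n * cis x) = n * cos x" for n by simp
  then have Rez: "Re z = norm z * cos x" using zx by metis
  have "z powr of_real p = exp (of_real p * Ln z)" using z0 by (simp add: powr_def)
  also have "Re \<dots> = exp (p * ln (norm z)) * cos (p * x)"
    using Re_Ln[OF z0] by (simp add: Re_exp x_def)
  finally have 1: "Re (z powr of_real p) = norm z powr p * cos (p * x)"
    using z0 by (simp add: powr_def)
  have 2: "Re z powr p = norm z powr p * cos x powr p"
    using Rez x cos_gt_zero_pi[of x] by (simp add: powr_mult)
  have "norm z powr p * 1 \<le> norm z powr p * (A * cos x powr p - B * cos (p * x))"
    by (intro mult_left_mono A) (use x in auto)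
  then show ?thesis by (simp add: 1 2 algebra_simps)
qed

text \<open>The mean value property, read off from the Taylor series at 0. The auxiliary radius x
  between r and 1 turns convergence into absolute summability at radius r.\<close>

lemma holomorphic_mean:
  assumes h: "h holomorphic_on ball 0 1" and r: "0 \<le> r" "r < 1"
  shows "integrable \<mu> (\<lambda>t. h (of_real r * t))" "(LINT t|\<mu>. h (of_real r * t)) = h 0"
proof -
  define a where "a n = (deriv ^^ n) h 0 / fact n" for n
  have a: "(\<lambda>n. a n * w ^ n) sums h w" if "norm w < 1" for w
    using holomorphic_power_series[OF h, of w] that by (simp add: a_def)
  obtain x where x: "r < x" "x < 1" using dense r by blast
  have "summable (\<lambda>n. a n * of_real x ^ n)"
    using a[of "of_real x"] x r by (auto simp: sums_iff)
  then have "summable (\<lambda>n. norm (a n * of_real r ^ n))"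
    by (rule powser_insidea) (use x r in auto)
  note s = this
  have eq: "(\<Sum>n. (a n * of_real r ^ n) * t ^ n) = h (of_real r * t)" if "norm t = 1" for t
    using a[OF norm_radius[OF r that]] by (simp add: sums_iff power_mult_distrib mult.assoc)
  have i: "integrable \<mu> (\<lambda>t. \<Sum>n. (a n * of_real r ^ n) * t ^ n)" by (rule series_integrable[OF s])
  show "integrable \<mu> (\<lambda>t. h (of_real r * t))"
    using i by (rule Bochner_Integration.integrable_cong[THEN iffD1, rotated -1]) (auto simp: norm_circle eq)
  have "(LINT t|\<mu>. h (of_real r * t)) = fourier_coeff (\<lambda>t. \<Sum>n. (a n * of_real r ^ n) * t ^ n) 0"
    unfolding fourier_coeff_def by (rule Bochner_Integration.integral_cong) (auto simp: norm_circle eq)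
  also have "\<dots> = a 0" using fourier_coeff_series[OF s, of 0] by simp
  also have "\<dots> = h 0" by (simp add: a_def)
  finally show "(LINT t|\<mu>. h (of_real r * t)) = h 0" .
qed

lemma analytic_part_holomorphic:
  assumes "integrable \<mu> f" shows "analytic_part f holomorphic_on ball 0 1"
proof (rule power_series_holomorphic)
  fix w assume "w \<in> ball (0::complex) 1"
  then show "(\<lambda>n. fourier_coeff f (int n) * (w - 0) ^ n) sums analytic_part f w"
    using summable_norm_cancel[OF summable_fourier(1)[OF assms, of w]]
    by (simp add: analytic_part_def summable_sums)
qed

lemma fourier_coeff_cnj: "fourier_coeff (\<lambda>t. cnj (f t)) n = cnj (fourier_coeff f (- n))"
proof -
  have "cnj (fourier_coeff f (- n)) = (LINT t|\<mu>. cnj (f t * t powi n))"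
    unfolding fourier_coeff_def minus_minus by (rule Bochner_Integration.integral_cnj[symmetric])
  also have "\<dots> = (LINT t|\<mu>. cnj (f t) * t powi (- n))"
    by (rule Bochner_Integration.integral_cong)
       (auto simp: norm_circle cnj_circle power_int_minus power_int_inverse)
  finally show ?thesis by (simp add: fourier_coeff_def)
qed

lemma analytic_part_0: "analytic_part f 0 = fourier_coeff f 0"
proof -
  have "(\<Sum>k. fourier_coeff f (int k) * 0 ^ k) = (\<Sum>k. if k = 0 then fourier_coeff f 0 else 0)"
    by (rule suminf_cong) auto
  then show ?thesis using sums_single[of 0 "\<lambda>_. fourier_coeff f 0"]
    by (simp add: analytic_part_def sums_iff)
qed

text \<open>Twice the analytic part minus m is a holomorphic f whose real part is the Poisson
  integral of u, hence positive. So f^p is holomorphic with mean f(0)^p = m^p, and integrating the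
  pointwise inequality for |f|^p leaves only the real part, which the contraction property of
  Poisson integrals controls.\<close>

lemma M_Riesz_nonneg:
  fixes u :: "complex \<Rightarrow> real"
  assumes p: "1 < p" and AB: "A \<ge> 0" "B \<ge> 0"
    "\<And>x. \<bar>x\<bar> \<le> pi / 2 \<Longrightarrow> 1 \<le> A * cos x powr p - B * cos (p * x)"
    and r: "0 \<le> r" "r < 1"
    and u: "\<And>t. u t \<ge> 0" "(\<lambda>t. of_real (u t)) \<in> Lp p"
  shows "(LINT t|\<mu>. norm (analytic_part (\<lambda>t. of_real (u t)) (of_real r * t)) powr p)
    \<le> (A + 1) * (LINT t|\<mu>. u t powr p)"
proof -
  let ?u = "\<lambda>t. of_real (u t) :: complex"
  have iu: "integrable \<mu> ?u" using u(2) p by (intro Lp_integrable) auto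
  then have iu': "integrable \<mu> u" by (simp only: integrable_of_real_iff)
  have up: "integrable \<mu> (\<lambda>t. u t powr p)" using LpD(2)[OF u(2)] u(1) by simp
  define m where "m = (LINT t|\<mu>. u t)"
  have m0: "fourier_coeff ?u 0 = of_real m" by (simp add: fourier_coeff_def m_def)
  have m: "m \<ge> 0" unfolding m_def using u by (intro integral_nonneg_AE) auto
  show ?thesis
  proof (cases "m = 0")
    \<comment> \<open>Here u vanishes almost everywhere and f would be zero, where the complex power
      is not holomorphic.\<close>
    case True
    then have "AE t in \<mu>. u t = 0"
      using iu' u(1) unfolding m_def by (subst (asm) integral_nonneg_eq_0_iff_AE) auto
    then have "fourier_coeff ?u n = fourier_coeff (\<lambda>t. 0) n" for n
      using iu by (intro fourier_coeff_cong_AE) (auto elim!: eventually_mono)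
    then have "analytic_part ?u z = 0" for z by (simp add: analytic_part_def fourier_coeff_def)
    then show ?thesis using AB u by simp
  next
    case False
    then have m: "m > 0" using m by simp
    define P where "P z = (LINT t|\<mu>. poisson z t * u t)" for z
    define f where "f z = 2 * analytic_part ?u z - of_real m" for z
    have Ref: "Re (f z) = P z" if z: "norm z < 1" for z
    proof -
      have s: "summable (\<lambda>k. norm (fourier_coeff ?u (int k) * z ^ k))" by (rule summable_fourier[OF iu z])
      have "cnj (fourier_coeff ?u (int k)) = fourier_coeff ?u (- int k)" for k
        using fourier_coeff_cnj[of ?u "- int k"] by simp
      then have "coanalytic_part ?u (cnj z) = (\<Sum>k. cnj (fourier_coeff ?u (int k) * z ^ k))"
        by (simp add: coanalytic_part_def)
      also have "\<dots> = cnj (analytic_part ?u z)"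
        unfolding analytic_part_def using bounded_linear.suminf[OF bounded_linear_cnj summable_norm_cancel[OF s]] by simp
      finally have "of_real (P z) = analytic_part ?u z + cnj (analytic_part ?u z) - of_real m"
        using poisson_integral_expand[OF iu z] by (simp add: poisson_integral_of_real P_def m0)
      then have "P z = Re (analytic_part ?u z + cnj (analytic_part ?u z) - of_real m)"
        by (metis Re_complex_of_real)
      then show ?thesis by (simp add: f_def)
    qed
    \<comment> \<open>Strict positivity keeps f in the right half plane, away from the branch cut of
      the power.\<close>
    have Ppos: "P z > 0" if z: "norm z < 1" for z
    proof -
      have "poisson z t > 0" if "norm t = 1" for t
      proof -
        have "z / t \<noteq> 1" using z that by (auto simp: norm_divide)
        then show ?thesis using z by (simp add: poisson_def power_less_one_iff abs_square_less_1)
      qed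
      note pos = this
      have i: "integrable \<mu> (\<lambda>t. poisson z t * u t)" by (rule integrable_poisson_mult_real[OF iu' z])
      have "P z \<noteq> 0"
      proof
        assume "P z = 0"
        then have "AE t in \<mu>. poisson z t * u t = 0"
          using i u(1) poisson_nonneg[OF z] unfolding P_def by (subst (asm) integral_nonneg_eq_0_iff_AE) auto
        moreover have "AE t in \<mu>. poisson z t \<noteq> 0" using pos by (intro AE_circleI) force
        ultimately have "AE t in \<mu>. u t = 0" by eventually_elim auto
        then have "m = (LINT t|\<mu>. 0)" unfolding m_def using iu' by (intro integral_cong_AE) auto
        then show False using m by simp
      qed
      moreover have "P z \<ge> 0" unfolding P_def using u poisson_nonneg[OF z] by (intro integral_nonneg_AE) auto
      ultimately show ?thesis by simp
    qed
    define h where "h z = f z powr of_real p" for z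
    have fh: "f holomorphic_on ball 0 1"
      unfolding f_def by (intro holomorphic_intros analytic_part_holomorphic iu)
    have "h holomorphic_on ball 0 1"
      unfolding h_def
    proof (intro holomorphic_intros fh)
      fix z assume "z \<in> ball (0::complex) 1"
      then have "Re (f z) > 0" using Ref[of z] Ppos[of z] by simp
      then show "f z \<notin> \<real>\<^sub>\<le>\<^sub>0" by (auto simp: complex_nonpos_Reals_iff)
    qed
    note hm = holomorphic_mean[OF this r]
    have f0: "f 0 = of_real m" by (simp add: f_def analytic_part_0 m0)
    have h0: "h 0 = of_real (m powr p)" using m unfolding h_def f0 by (simp add: powr_of_real)
    have c: "continuous_on unit_circle (\<lambda>t. f (of_real r * t))"
      unfolding f_def by (intro continuous_intros continuous_analytic_part r iu)
    have fi: "integrable \<mu> (\<lambda>t. norm (f (of_real r * t)) powr p)"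
      using LpD(2)[OF LpI_continuous[OF c]] p by auto
    have Pp: "(LINT t|\<mu>. P (of_real r * t) powr p) \<le> (LINT t|\<mu>. u t powr p)"
      and Pi: "integrable \<mu> (\<lambda>t. P (of_real r * t) powr p)"
    proof -
      have "norm (poisson_integral ?u z) = P z" if "norm z < 1" for z
        using Ppos[OF that] by (simp add: poisson_integral_of_real P_def)
      then have eq: "norm (poisson_integral ?u (of_real r * t)) = P (of_real r * t)" if "norm t = 1" for t
        using norm_radius[OF r that] by simp
      have "(LINT t|\<mu>. P (of_real r * t) powr p) = (LINT t|\<mu>. norm (poisson_integral ?u (of_real r * t)) powr p)"
        by (rule Bochner_Integration.integral_cong) (auto simp: norm_circle eq)
      also have "\<dots> \<le> (LINT t|\<mu>. norm (?u t) powr p)"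
        by (rule poisson_Lp_contraction[OF p r u(2)])
      also have "\<dots> = (LINT t|\<mu>. u t powr p)" using u(1) by simp
      finally show "(LINT t|\<mu>. P (of_real r * t) powr p) \<le> (LINT t|\<mu>. u t powr p)" .
      have "integrable \<mu> (\<lambda>t. norm (poisson_integral ?u (of_real r * t)) powr p)"
        using LpD(2)[OF LpI_continuous[OF continuous_poisson_integral[OF r iu]]] p by auto
      then show "integrable \<mu> (\<lambda>t. P (of_real r * t) powr p)"
        by (rule Bochner_Integration.integrable_cong[THEN iffD1, rotated -1]) (auto simp: norm_circle eq)
    qed
    have "(LINT t|\<mu>. norm (f (of_real r * t)) powr p)
       \<le> (LINT t|\<mu>. A * P (of_real r * t) powr p - B * Re (h (of_real r * t)))"
    proof (rule integral_mono[OF fi])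
      show "integrable \<mu> (\<lambda>t. A * P (of_real r * t) powr p - B * Re (h (of_real r * t)))"
        using Pi hm(1) by auto
      fix t assume "t \<in> space \<mu>"
      then have z: "norm (of_real r * t) < 1" by (simp add: norm_circle norm_radius r)
      show "norm (f (of_real r * t)) powr p \<le> A * P (of_real r * t) powr p - B * Re (h (of_real r * t))"
        using Re_powr_inequality[of p A B "f (of_real r * t)"] AB p Ref[OF z] Ppos[OF z] by (simp add: h_def)
    qed
    also have "\<dots> = A * (LINT t|\<mu>. P (of_real r * t) powr p) - B * Re (h 0)"
      using Pi hm by (simp add: hm(2)[symmetric])
    \<comment> \<open>The mean of the holomorphic term is h 0 = m^p, which is nonnegative, so this
      term may be dropped.\<close>
    also have "\<dots> \<le> A * (LINT t|\<mu>. u t powr p)"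
    proof -
      have "A * (LINT t|\<mu>. P (of_real r * t) powr p) \<le> A * (LINT t|\<mu>. u t powr p)"
        using Pp AB by (intro mult_left_mono)
      moreover have "0 \<le> B * Re (h 0)" using AB by (simp add: h0)
      ultimately show ?thesis by linarith
    qed
    finally have F: "(LINT t|\<mu>. norm (f (of_real r * t)) powr p) \<le> A * (LINT t|\<mu>. u t powr p)" .
    have M: "m powr p \<le> (LINT t|\<mu>. u t powr p)"
      using poisson_jensen[OF p _ iu' u(1) up, of 0] by (simp add: poisson_def m_def)
    have "(LINT t|\<mu>. norm (analytic_part ?u (of_real r * t)) powr p)
       \<le> (LINT t|\<mu>. norm (f (of_real r * t)) powr p + m powr p)"
    proof (rule integral_mono)
      show "integrable \<mu> (\<lambda>t. norm (analytic_part ?u (of_real r * t)) powr p)"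
        using LpD(2)[OF LpI_continuous[OF continuous_analytic_part(1)[OF r iu]]] p by auto
      show "integrable \<mu> (\<lambda>t. norm (f (of_real r * t)) powr p + m powr p)" using fi by auto
      fix t
      have "norm (analytic_part ?u (of_real r * t)) = norm (f (of_real r * t) + of_real m) / 2"
        by (simp add: f_def norm_mult)
      also have "\<dots> \<le> (norm (f (of_real r * t)) + m) / 2"
        using norm_triangle_ineq[of "f (of_real r * t)" "of_real m"] m by simp
      also have "\<dots> \<le> max (norm (f (of_real r * t))) m" by auto
      finally have "norm (analytic_part ?u (of_real r * t)) powr p \<le> max (norm (f (of_real r * t))) m powr p"
        using p by (intro powr_mono2) auto
      also have "\<dots> \<le> norm (f (of_real r * t)) powr p + m powr p" by (auto simp: max_def)
      finally show "norm (analytic_part ?u (of_real r * t)) powr p \<le> norm (f (of_real r * t)) powr p + m powr p" .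
    qed
    also have "\<dots> = (LINT t|\<mu>. norm (f (of_real r * t)) powr p) + m powr p"
      using fi mu.prob_space by simp
    also have "\<dots> \<le> (A + 1) * (LINT t|\<mu>. u t powr p)" using F M by (simp add: algebra_simps)
    finally show ?thesis .
  qed
qed

lemma analytic_part_add:
  assumes f: "integrable \<mu> f" and h: "integrable \<mu> h" and z: "norm z < 1"
  shows "analytic_part (\<lambda>t. f t + h t) z = analytic_part f z + analytic_part h z"
  unfolding analytic_part_def
  using summable_norm_cancel[OF summable_fourier(1)[OF f z]] summable_norm_cancel[OF summable_fourier(1)[OF h z]]
  by (simp add: fourier_coeff_add f h distrib_right suminf_add)

lemma analytic_part_cmult:
  assumes f: "integrable \<mu> f" and z: "norm z < 1"
  shows "analytic_part (\<lambda>t. c * f t) z = c * analytic_part f z"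
  unfolding analytic_part_def
  using summable_norm_cancel[OF summable_fourier(1)[OF f z]]
  by (simp add: fourier_coeff_cmult mult.assoc suminf_mult)

lemma integrable_analytic_part_powr:
  assumes "integrable \<mu> f" "0 \<le> r" "r < 1" "p > 0"
  shows "integrable \<mu> (\<lambda>t. norm (analytic_part f (of_real r * t)) powr p)"
  using LpD(2)[OF LpI_continuous[OF continuous_analytic_part(1)]] assms by auto

text \<open>The positive and negative parts of the real and imaginary parts reduce the claim to
  nonnegative functions. In the constant, 4 powr p comes from bounding a sum of four terms by four
  times the largest, and the other 4 from adding four equal bounds.\<close>

lemma M_Riesz_le_2:
  assumes p: "1 < p" "p \<le> 2"
  shows "\<exists>A\<ge>0. \<forall>r c. 0 \<le> r \<longrightarrow> r < 1 \<longrightarrow> c \<in> Lp p \<longrightarrow>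
    (LINT t|\<mu>. norm (analytic_part c (of_real r * t)) powr p) \<le> A * (LINT t|\<mu>. norm (c t) powr p)"
proof -
  obtain A B where AB: "A \<ge> 0" "B \<ge> 0" "\<And>x. \<bar>x\<bar> \<le> pi / 2 \<Longrightarrow> 1 \<le> A * cos x powr p - B * cos (p * x)"
    using cos_powr_inequality[OF p] by blast
  define C where "C = 4 powr p * (4 * (A + 1))"
  have "(LINT t|\<mu>. norm (analytic_part c (of_real r * t)) powr p) \<le> C * (LINT t|\<mu>. norm (c t) powr p)"
    if r: "0 \<le> r" "r < 1" and c: "c \<in> Lp p" for r c
  proof -
    define u :: "(complex \<Rightarrow> real) \<Rightarrow> complex \<Rightarrow> real" where "u g t = max 0 (g t)" for g t
    let ?R = "\<lambda>t. Re (c t)" and ?I = "\<lambda>t. Im (c t)"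
    have [measurable]: "c \<in> borel_measurable \<mu>" using LpD[OF c] by auto
    define S where "S g t = analytic_part (\<lambda>s. of_real (u g s)) (of_real r * t)" for g t
    have u: "(\<lambda>t. of_real (u g t)) \<in> Lp p" "(LINT t|\<mu>. norm (S g t) powr p) \<le> (A + 1) * (LINT t|\<mu>. norm (c t) powr p)"
      "integrable \<mu> (\<lambda>t. of_real (u g t) :: complex)" "integrable \<mu> (\<lambda>t. norm (S g t) powr p)"
      if [measurable]: "g \<in> borel_measurable \<mu>" and g: "\<And>t. \<bar>g t\<bar> \<le> norm (c t)" for g
    proof -
      have ub: "u g t powr p \<le> norm (c t) powr p" for t
        using g[of t] p by (intro powr_mono2) (auto simp: u_def)
      have um[measurable]: "(\<lambda>t. u g t) \<in> borel_measurable \<mu>" unfolding u_def by measurable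
      show L: "(\<lambda>t. of_real (u g t)) \<in> Lp p"
        by (rule LpI_le[OF _ LpD(2)[OF c]]) (use ub in \<open>auto simp: u_def\<close>)
      show i: "integrable \<mu> (\<lambda>t. of_real (u g t) :: complex)"
        using L p by (intro Lp_integrable[OF L]) auto
      show "integrable \<mu> (\<lambda>t. norm (S g t) powr p)"
        unfolding S_def using p by (intro integrable_analytic_part_powr i r) auto
      have "(LINT t|\<mu>. norm (S g t) powr p) \<le> (A + 1) * (LINT t|\<mu>. u g t powr p)"
        unfolding S_def by (rule M_Riesz_nonneg[OF p(1) AB r _ L]) (auto simp: u_def)
      also have "\<dots> \<le> (A + 1) * (LINT t|\<mu>. norm (c t) powr p)"
      proof (intro mult_left_mono integral_mono)
        show "integrable \<mu> (\<lambda>t. u g t powr p)" using LpD(2)[OF L] by (simp add: u_def)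
      qed (use LpD(2)[OF c] AB ub in auto)
      finally show "(LINT t|\<mu>. norm (S g t) powr p) \<le> (A + 1) * (LINT t|\<mu>. norm (c t) powr p)" .
    qed
    have m: "?R \<in> borel_measurable \<mu>" "(\<lambda>t. - ?R t) \<in> borel_measurable \<mu>" "?I \<in> borel_measurable \<mu>" "(\<lambda>t. - ?I t) \<in> borel_measurable \<mu>"
      by measurable
    have b: "\<bar>?R t\<bar> \<le> norm (c t)" "\<bar>- ?R t\<bar> \<le> norm (c t)" "\<bar>?I t\<bar> \<le> norm (c t)" "\<bar>- ?I t\<bar> \<le> norm (c t)" for t
      by (auto simp: abs_Re_le_cmod abs_Im_le_cmod)
    note u1 = u[OF m(1) b(1)] and u2 = u[OF m(2) b(2)] and u3 = u[OF m(3) b(3)] and u4 = u[OF m(4) b(4)]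
    define c1 c2 c3 c4 :: "complex \<Rightarrow> complex" where "c1 t = of_real (u ?R t)" and "c2 t = of_real (u (\<lambda>t. - ?R t) t)"
      and "c3 t = of_real (u ?I t)" and "c4 t = of_real (u (\<lambda>t. - ?I t) t)" for t
    have i: "integrable \<mu> c1" "integrable \<mu> c2" "integrable \<mu> c3" "integrable \<mu> c4"
      unfolding c1_def[abs_def] c2_def[abs_def] c3_def[abs_def] c4_def[abs_def] by (rule u1 u2 u3 u4)+
    have ceq: "c = (\<lambda>t. (c1 t + (-1) * c2 t) + \<i> * (c3 t + (-1) * c4 t))"
      by (auto simp: fun_eq_iff complex_eq_iff c1_def c2_def c3_def c4_def u_def max_def)
    have "analytic_part c z = (analytic_part c1 z + (-1) * analytic_part c2 z) + \<i> * (analytic_part c3 z + (-1) * analytic_part c4 z)"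
      if "norm z < 1" for z
      unfolding ceq using i that
      by (simp only: analytic_part_add analytic_part_cmult integrable_mult_right Bochner_Integration.integrable_add)
    note dec = this
    have nb: "norm (analytic_part c (of_real r * t)) powr p
       \<le> 4 powr p * (norm (S ?R t) powr p + norm (S (\<lambda>t. - ?R t) t) powr p + norm (S ?I t) powr p + norm (S (\<lambda>t. - ?I t) t) powr p)"
      if t: "norm t = 1" for t
    proof -
      define a1 a2 a3 a4 where "a1 = norm (S ?R t)" and "a2 = norm (S (\<lambda>t. - ?R t) t)" and "a3 = norm (S ?I t)" and "a4 = norm (S (\<lambda>t. - ?I t) t)"
      define M where "M = max (max a1 a2) (max a3 a4)"
      have "norm (analytic_part c (of_real r * t)) = norm ((S ?R t - S (\<lambda>t. - ?R t) t) + \<i> * (S ?I t - S (\<lambda>t. - ?I t) t))"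
        using dec[OF norm_radius[OF r t]] by (simp add: S_def c1_def[abs_def] c2_def[abs_def] c3_def[abs_def] c4_def[abs_def])
      also have "\<dots> \<le> norm (S ?R t - S (\<lambda>t. - ?R t) t) + norm (\<i> * (S ?I t - S (\<lambda>t. - ?I t) t))" by (rule norm_triangle_ineq)
      also have "\<dots> \<le> a1 + a2 + (a3 + a4)"
        unfolding a1_def a2_def a3_def a4_def norm_mult norm_ii mult_1_left by (intro add_mono norm_triangle_ineq4)
      also have "\<dots> \<le> 4 * M" by (auto simp: M_def)
      finally have "norm (analytic_part c (of_real r * t)) powr p \<le> (4 * M) powr p"
        using p by (intro powr_mono2) auto
      also have "\<dots> = 4 powr p * M powr p" using p by (subst powr_mult) (auto simp: M_def a1_def le_max_iff_disj)
      also have "M powr p \<le> a1 powr p + a2 powr p + a3 powr p + a4 powr p"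
        unfolding M_def max_def by auto
      finally show ?thesis by (simp add: a1_def a2_def a3_def a4_def)
    qed
    have ci: "integrable \<mu> c" using Lp_integrable[OF c] p by simp
    have "(LINT t|\<mu>. norm (analytic_part c (of_real r * t)) powr p)
      \<le> (LINT t|\<mu>. 4 powr p * (norm (S ?R t) powr p + norm (S (\<lambda>t. - ?R t) t) powr p + norm (S ?I t) powr p + norm (S (\<lambda>t. - ?I t) t) powr p))"
    proof (rule integral_mono)
      show "integrable \<mu> (\<lambda>t. norm (analytic_part c (of_real r * t)) powr p)"
        using p by (intro integrable_analytic_part_powr ci r) auto
    qed (use u1(4) u2(4) u3(4) u4(4) nb in \<open>auto simp: norm_circle\<close>)
    also have "\<dots> = 4 powr p * ((LINT t|\<mu>. norm (S ?R t) powr p) + (LINT t|\<mu>. norm (S (\<lambda>t. - ?R t) t) powr p)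
         + (LINT t|\<mu>. norm (S ?I t) powr p) + (LINT t|\<mu>. norm (S (\<lambda>t. - ?I t) t) powr p))"
      using u1(4) u2(4) u3(4) u4(4) by simp
    also have "\<dots> \<le> 4 powr p * (4 * ((A + 1) * (LINT t|\<mu>. norm (c t) powr p)))"
      using u1(2) u2(2) u3(2) u4(2) by (intro mult_left_mono) auto
    also have "\<dots> = C * (LINT t|\<mu>. norm (c t) powr p)" by (simp add: C_def)
    finally show ?thesis .
  qed
  moreover have "C \<ge> 0" using AB by (simp add: C_def)
  ultimately show ?thesis by blast
qed

text \<open>The dilated projection multiplies the k-th coefficient by the real number r^k for k >= 0
  and kills the others, so it is self-adjoint: both sides are the same series in the coefficients of
  f and h.\<close>

lemma analytic_part_adjoint:
  assumes f: "integrable \<mu> f" and h: "integrable \<mu> h" and r: "0 \<le> r" "r < 1"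
  shows "(LINT t|\<mu>. analytic_part f (of_real r * t) * cnj (h t)) = (LINT t|\<mu>. f t * cnj (analytic_part h (of_real r * t)))"
proof -
  have A: "(\<lambda>k. fourier_coeff f (int k) * of_real r ^ k * cnj (fourier_coeff h (int k))) sums
     (LINT t|\<mu>. analytic_part f (of_real r * t) * cnj (h t))"
    if f: "integrable \<mu> f" and h: "integrable \<mu> h" for f h
  proof -
    have "integrable \<mu> (\<lambda>t. cnj (h t))" using h by simp
    from fourier_coeff_series_mult[OF this summable_radius(1)[OF r f], of 0]
    show ?thesis by (simp add: fourier_coeff_cnj analytic_part_circle fourier_coeff_def)
  qed
  have "(\<lambda>k. cnj (fourier_coeff h (int k) * of_real r ^ k * cnj (fourier_coeff f (int k)))) sums
     cnj (LINT t|\<mu>. analytic_part h (of_real r * t) * cnj (f t))"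
    using A[OF h f] by (simp only: sums_cnj)
  also have "cnj (LINT t|\<mu>. analytic_part h (of_real r * t) * cnj (f t)) = (LINT t|\<mu>. f t * cnj (analytic_part h (of_real r * t)))"
    by (subst Bochner_Integration.integral_cnj[symmetric]) (simp add: mult.commute)
  also have "(\<lambda>k. cnj (fourier_coeff h (int k) * of_real r ^ k * cnj (fourier_coeff f (int k))))
     = (\<lambda>k. fourier_coeff f (int k) * of_real r ^ k * cnj (fourier_coeff h (int k)))"
    by (auto simp: fun_eq_iff)
  finally show ?thesis using A[OF f h] by (simp add: sums_iff)
qed

text \<open>Duality with the extremal function b = |S|^(p - 2) S, for which S cnj(b) = |S|^p =
  |b|^q. With X the integral of |S|^p, Hoelder's inequality gives X <= |c|_p (A X)^(1/q), and a
  nonzero power X^(1/q) cancels because X is finite for r < 1.\<close>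

lemma M_Riesz_dual:
  assumes p: "1 < p" and q: "q = conj_exponent p" and A: "A \<ge> 0"
    "\<And>r c. 0 \<le> r \<Longrightarrow> r < 1 \<Longrightarrow> c \<in> Lp q \<Longrightarrow>
    (LINT t|\<mu>. norm (analytic_part c (of_real r * t)) powr q) \<le> A * (LINT t|\<mu>. norm (c t) powr q)"
    and r: "0 \<le> r" "r < 1" and c: "c \<in> Lp p"
  shows "(LINT t|\<mu>. norm (analytic_part c (of_real r * t)) powr p) \<le> (A powr (1 / q)) powr p * (LINT t|\<mu>. norm (c t) powr p)"
proof -
  have q1: "q > 1" "(p - 1) * q = p" "1 / p + 1 / q = 1" using conj_exponent[OF p] q by auto
  have ci: "integrable \<mu> c" using Lp_integrable[OF c] p by simp
  define S where "S t = analytic_part c (of_real r * t)" for t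
  have cS: "continuous_on unit_circle S" unfolding S_def by (intro continuous_analytic_part r ci)
  have [measurable]: "S \<in> borel_measurable \<mu>" "c \<in> borel_measurable \<mu>" by (rule meas_continuous[OF cS]) (rule LpD[OF c])
  \<comment> \<open>At a zero of S the value is 0, even when p - 2 is negative.\<close>
  define b where "b t = of_real (norm (S t) powr (p - 2)) * S t" for t
  have nb: "norm (b t) = norm (S t) powr (p - 1)" for t
  proof (cases "S t = 0")
    case False
    have "norm (S t) powr (p - 1) = norm (S t) powr (p - 2) * norm (S t) powr 1"
      by (subst powr_add[symmetric]) simp
    then show ?thesis using False by (simp add: b_def norm_mult)
  qed (simp add: b_def)
  have bS: "S t * cnj (b t) = of_real (norm (S t) powr p)" for t
  proof (cases "S t = 0")
    case False
    have "norm (S t) powr p = norm (S t) powr (p - 2) * norm (S t) powr 2"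
      by (subst powr_add[symmetric]) simp
    then have "of_real (norm (S t) powr p) = of_real (norm (S t) powr (p - 2)) * (S t * cnj (S t))"
      using False complex_norm_square[of "S t"] by (simp flip: powr_numeral)
    then show ?thesis by (simp add: b_def)
  qed (simp add: b_def)
  have bq: "norm (b t) powr q = norm (S t) powr p" for t
    using q1 by (simp add: nb powr_powr)
  have [measurable]: "b \<in> borel_measurable \<mu>" unfolding b_def[abs_def] by measurable
  have b: "b \<in> Lp q" using LpD(2)[OF LpI_continuous[OF cS, of p]] p unfolding Lp_def
    by (auto simp: bq)
  have bi: "integrable \<mu> b" using Lp_integrable[OF b] q1 by simp
  define X where "X = (LINT t|\<mu>. norm (S t) powr p)"
  have X: "X \<ge> 0" by (simp add: X_def)
  define T where "T t = cnj (analytic_part b (of_real r * t))" for t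
  have TL: "T \<in> Lp q" unfolding T_def
    using q1 by (intro LpI_continuous continuous_on_cnj continuous_analytic_part r bi) auto
  have "of_real X = (LINT t|\<mu>. S t * cnj (b t))" by (simp add: bS X_def)
  also have "\<dots> = (LINT t|\<mu>. c t * T t)"
    unfolding S_def T_def by (rule analytic_part_adjoint[OF ci bi r])
  finally have "X = norm (LINT t|\<mu>. c t * T t)" using X by (metis abs_of_nonneg norm_of_real)
  also have "\<dots> \<le> (LINT t|\<mu>. norm (c t * T t))" by (rule integral_norm_bound)
  also have "\<dots> \<le> Lp_norm p c * Lp_norm q T" using holder(2)[OF p c] TL q by simp
  also have "Lp_norm q T \<le> (A * X) powr (1 / q)"
  proof -
    have "(LINT t|\<mu>. norm (T t) powr q) \<le> A * X"
      using A(2)[OF r b] by (simp add: T_def bq X_def)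
    then show ?thesis unfolding Lp_norm_def using q1 by (intro powr_mono2) auto
  qed
  finally have main: "X \<le> Lp_norm p c * (A * X) powr (1 / q)" by (simp add: Lp_norm_nonneg mult_left_mono)
  have "X powr (1 / p) \<le> Lp_norm p c * A powr (1 / q)"
  proof (cases "X = 0")
    case False
    then have "X > 0" using X by simp
    have "X powr (1 / p) * X powr (1 / q) = X" using \<open>X > 0\<close> q1 by (simp flip: powr_add)
    also have "X \<le> Lp_norm p c * A powr (1 / q) * X powr (1 / q)"
      using main A X by (simp add: powr_mult mult.assoc)
    finally show ?thesis using \<open>X > 0\<close> by simp
  qed (simp add: Lp_norm_nonneg)
  then have "(X powr (1 / p)) powr p \<le> (Lp_norm p c * A powr (1 / q)) powr p"
    using p by (intro powr_mono2) auto
  also have "(X powr (1 / p)) powr p = X" using X p by (simp add: powr_powr)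
  also have "(Lp_norm p c * A powr (1 / q)) powr p = (A powr (1 / q)) powr p * (LINT t|\<mu>. norm (c t) powr p)"
    using p Lp_norm_powr[of p c] by (simp add: powr_mult Lp_norm_nonneg)
  finally show ?thesis by (simp add: X_def S_def)
qed

text \<open>For p > 2 the conjugate exponent is below 2, so the first case transfers by
  duality.\<close>

theorem M_Riesz:
  assumes p: "1 < p"
  obtains A where "A \<ge> 0"
    "\<And>r c. 0 \<le> r \<Longrightarrow> r < 1 \<Longrightarrow> c \<in> Lp p \<Longrightarrow>
    (LINT t|\<mu>. norm (analytic_part c (of_real r * t)) powr p) \<le> A * (LINT t|\<mu>. norm (c t) powr p)"
proof (cases "p \<le> 2")
  case True
  then show ?thesis using M_Riesz_le_2[OF p] that by blast
next
  case False
  define q where "q = conj_exponent p"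
  have q: "1 < q" "q \<le> 2" using p False by (auto simp: q_def conj_exponent_def field_simps)
  then obtain A where A: "A \<ge> 0"
    "\<And>r c. 0 \<le> r \<Longrightarrow> r < 1 \<Longrightarrow> c \<in> Lp q \<Longrightarrow>
    (LINT t|\<mu>. norm (analytic_part c (of_real r * t)) powr q) \<le> A * (LINT t|\<mu>. norm (c t) powr q)"
    using M_Riesz_le_2[OF q] by blast
  show ?thesis
    by (rule that[of "(A powr (1 / q)) powr p"]) (use M_Riesz_dual[OF p q_def A] in auto)
qed

section \<open>Cauchy kernels\<close>

text \<open>A crude chord bound: the slope of sin is at least 1/2 up to pi / 3, and beyond that sin
  x >= 1/2 while x / 4 <= pi / 8 < 1/2.\<close>

lemma sin_ge_quarter:
  assumes "0 \<le> x" "x \<le> pi / 2"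
  shows "x / 4 \<le> sin x"
proof (cases "x \<le> pi / 3")
  case True
  show ?thesis
  proof (cases "x = 0")
    case False
    then have "x > 0" using assms by simp
    then obtain y where y: "0 < y" "y < x" "sin x - sin 0 = (x - 0) * cos y"
      using MVT2[of 0 x sin cos] by (auto intro: DERIV_sin)
    have "cos (pi / 3) \<le> cos y" using y True by (intro cos_monotone_0_pi_le) auto
    then have "x * (1 / 2) \<le> x * cos y" using \<open>x > 0\<close> by (intro mult_left_mono) (auto simp: cos_60)
    then show ?thesis using y \<open>x > 0\<close> by simp
  qed simp
next
  case False
  have "sin (pi / 6) \<le> sin x" using False assms by (intro sin_monotone_2pi_le) auto
  then have "1 / 2 \<le> sin x" by (simp add: sin_30)
  then show ?thesis using assms pi_less_4 by linarith
qed

lemma norm_one_minus_cis: "norm (1 - cis x) = 2 * \<bar>sin (x / 2)\<bar>"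
proof -
  have "(norm (1 - cis x))\<^sup>2 = (1 - cos x)\<^sup>2 + (sin x)\<^sup>2" by (simp add: cmod_power2)
  also have "\<dots> = 2 - 2 * cos x" using sin_cos_squared_add[of x] by (simp add: power2_eq_square algebra_simps)
  also have "cos x = 1 - 2 * (sin (x / 2))\<^sup>2" using cos_double_sin[of "x / 2"] by simp
  finally have "(norm (1 - cis x))\<^sup>2 = (2 * \<bar>sin (x / 2)\<bar>)\<^sup>2" by (simp add: power_mult_distrib)
  then show ?thesis by (rule power2_eq_imp_eq) auto
qed

text \<open>The norm is at least 1 - r and, by comparison with the point cis x on the circle itself,
  at least |x| / 8. The average of the two bounds is affine in |x|, so its power -p has an
  elementary antiderivative.\<close>

lemma norm_one_minus_radius_cis:
  assumes r: "0 \<le> r" "r < 1" and x: "\<bar>x\<bar> \<le> pi"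
  shows "((1 - r) + \<bar>x\<bar> / 8) / 2 \<le> norm (1 - of_real r * cis x)"
proof -
  let ?N = "norm (1 - of_real r * cis x)"
  have 1: "1 - r \<le> ?N"
    using norm_triangle_ineq2[of 1 "of_real r * cis x"] r by (simp add: norm_mult)
  have "\<bar>x\<bar> / 2 / 4 \<le> sin (\<bar>x\<bar> / 2)" using x by (intro sin_ge_quarter) auto
  also have "\<dots> \<le> \<bar>sin (x / 2)\<bar>" by (cases "x \<ge> 0") auto
  finally have "\<bar>x\<bar> / 4 \<le> norm (1 - cis x)" by (simp add: norm_one_minus_cis)
  also have "1 - cis x = (1 - of_real r * cis x) - of_real (1 - r) * cis x" by (simp add: algebra_simps)
  also have "norm \<dots> \<le> ?N + norm (of_real (1 - r) * cis x)" by (rule norm_triangle_ineq4)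
  also have "norm (of_real (1 - r) * cis x) = 1 - r" using r by (simp only: norm_mult norm_of_real norm_cis) simp
  finally have "\<bar>x\<bar> / 4 \<le> ?N + (1 - r)" .
  then have "\<bar>x\<bar> / 8 \<le> ?N" using 1 by argo
  then show ?thesis using 1 by argo
qed

text \<open>On the half line the antiderivative has exponent 1 - p < 0 and vanishes at infinity. The
  two half lines contribute 8 / (p - 1) each.\<close>

lemma nn_integral_affine_powr:
  fixes a p :: real
  assumes a: "a > 0" and p: "p > 1"
  shows "(\<integral>\<^sup>+x. ennreal ((a + \<bar>x\<bar> / 8) powr (- p)) \<partial>lborel) \<le> ennreal (16 / (p - 1) * a powr (1 - p))"
proof -
  define F where "F x = - (8 / (p - 1)) * (a + x / 8) powr (1 - p)" for x
  have pos: "(\<integral>\<^sup>+x. ennreal ((a + \<bar>x\<bar> / 8) powr (- p)) * indicator {0..} x \<partial>lborel) = ennreal (8 / (p - 1) * a powr (1 - p))"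
  proof -
    have "(\<integral>\<^sup>+x. ennreal ((a + \<bar>x\<bar> / 8) powr (- p)) * indicator {0..} x \<partial>lborel) = ennreal (0 - F 0)"
    proof (rule nn_integral_FTC_atLeast)
      fix x :: real assume x: "0 \<le> x"
      have "a + x / 8 > 0" using a x by (simp add: add_pos_nonneg)
      then have "DERIV (\<lambda>x. (a + x / 8) powr (1 - p)) x :> (1 - p) * (a + x / 8) powr (1 - p - of_nat 1) * (1 / 8)"
        by (intro DERIV_fun_powr) (auto intro!: derivative_eq_intros)
      then have "DERIV F x :> - (8 / (p - 1)) * ((1 - p) * (a + x / 8) powr (1 - p - of_nat 1) * (1 / 8))"
        unfolding F_def[abs_def] by (rule DERIV_cmult)
      also have "- (8 / (p - 1)) * ((1 - p) * (a + x / 8) powr (1 - p - of_nat 1) * (1 / 8)) = (a + x / 8) powr (- p)"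
        using p by (simp add: field_simps)
      finally show "DERIV F x :> (a + \<bar>x\<bar> / 8) powr (- p)" using x by simp
    next
      have "filterlim (\<lambda>x::real. a + x / 8) at_top at_top"
        unfolding filterlim_at_top
      proof
        fix Z :: real
        show "eventually (\<lambda>x. Z \<le> a + x / 8) at_top"
          by (rule eventually_at_top_linorderI[of "8 * (Z - a)"]) simp
      qed
      then have "((\<lambda>x. (a + x / 8) powr (1 - p)) \<longlongrightarrow> 0) at_top"
        using p by (intro tendsto_neg_powr) auto
      then have "((\<lambda>x. - (8 / (p - 1)) * (a + x / 8) powr (1 - p)) \<longlongrightarrow> - (8 / (p - 1)) * 0) at_top"
        by (intro tendsto_intros)
      then show "(F \<longlongrightarrow> 0) at_top" by (simp add: F_def[abs_def])
    qed auto
    then show ?thesis by (simp add: F_def)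
  qed
  have neg: "(\<integral>\<^sup>+x. ennreal ((a + \<bar>x\<bar> / 8) powr (- p)) * indicator {..0} x \<partial>lborel)
      = (\<integral>\<^sup>+x. ennreal ((a + \<bar>x\<bar> / 8) powr (- p)) * indicator {0..} x \<partial>lborel)"
    by (subst nn_integral_real_affine[where c="-1" and t=0]) (auto intro!: nn_integral_cong simp: indicator_def)
  have "(\<integral>\<^sup>+x. ennreal ((a + \<bar>x\<bar> / 8) powr (- p)) \<partial>lborel)
    \<le> (\<integral>\<^sup>+x. ennreal ((a + \<bar>x\<bar> / 8) powr (- p)) * indicator {0..} x
        + ennreal ((a + \<bar>x\<bar> / 8) powr (- p)) * indicator {..0} x \<partial>lborel)"
    by (intro nn_integral_mono) (auto simp: indicator_def)
  also have "\<dots> = ennreal (8 / (p - 1) * a powr (1 - p)) + ennreal (8 / (p - 1) * a powr (1 - p))"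
    by (subst nn_integral_add) (auto simp: pos neg)
  also have "\<dots> = ennreal (16 / (p - 1) * a powr (1 - p))"
    using p by (subst ennreal_plus[symmetric]) auto
  finally show ?thesis .
qed

lemma continuous_kernel:
  assumes "norm z < 1"
  shows "continuous_on unit_circle (\<lambda>t. 1 / (1 - z * t))"
  by (intro continuous_intros) (use one_minus_ne_0[OF assms] in \<open>auto simp: norm_circle\<close>)

text \<open>The kernel is concentrated on an arc of length about 1 - r around e, where its size is
  about 1 / (1 - r); this accounts for the exponent 1 / p - 1.\<close>

theorem kernel_Lp_estimate:
  assumes p: "p > 1"
  obtains C where "C > 0"
    "\<And>r e. 0 \<le> r \<Longrightarrow> r < 1 \<Longrightarrow> e \<in> {1, - 1} \<Longrightarrow>
      Lp_norm p (\<lambda>t. 1 / (1 - e * of_real r * t)) \<le> C * (1 - r) powr (1 / p - 1)"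
proof -
  \<comment> \<open>The factor 2 powr p comes from the 1/2 in the lower bound for the denominator,
    and 48 is three times the 16 of one translated integral.\<close>
  define D where "D = 2 powr p * (48 / (p - 1))"
  have D: "D > 0" using p by (simp add: D_def)
  have main: "Lp_norm p (\<lambda>t. 1 / (1 - e * of_real r * t)) \<le> D powr (1 / p) * (1 - r) powr (1 / p - 1)"
    if r: "0 \<le> r" "r < 1" and e: "e \<in> {1, - 1}" for r and e :: complex
  proof -
    define a where "a = 1 - r"
    have a: "a > 0" using r by (simp add: a_def)
    let ?k = "\<lambda>t. 1 / (1 - e * of_real r * t)"
    let ?G = "\<lambda>x. (a + \<bar>x\<bar> / 8) powr (- p)"
    have z: "norm (e * of_real r) < 1" using e r by (auto simp: norm_mult)
    have k: "?k \<in> Lp p" using p by (intro LpI_continuous continuous_kernel z) auto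
    \<comment> \<open>Angles run over [0, 2 pi], so the peak at t = 1 sits at both ends and the peak
      at t = -1 sits at pi. Adding three translates treats both values of e at once.\<close>
    have bound: "norm (?k (cis x)) powr p \<le> 2 powr p * (?G x + ?G (x - pi) + ?G (x - 2 * pi))"
      if x: "0 \<le> x" "x \<le> 2 * pi" for x
    proof -
      have *: "norm (?k (cis x)) powr p \<le> 2 powr p * ?G y"
        if y: "e * cis x = cis y" "\<bar>y\<bar> \<le> pi" for y
      proof -
        have eq: "e * of_real r * cis x = of_real r * cis y" by (simp add: y(1)[symmetric])
        have "(a + \<bar>y\<bar> / 8) / 2 \<le> norm (1 - e * of_real r * cis x)"
          using norm_one_minus_radius_cis[OF r y(2)] unfolding a_def eq .
        moreover have "(a + \<bar>y\<bar> / 8) / 2 > 0" using a by (simp add: add_pos_nonneg)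
        ultimately have "norm (?k (cis x)) \<le> 1 / ((a + \<bar>y\<bar> / 8) / 2)"
          unfolding norm_divide norm_one by (intro divide_left_mono mult_pos_pos) auto
        then have "norm (?k (cis x)) powr p \<le> (2 / (a + \<bar>y\<bar> / 8)) powr p" using p by (intro powr_mono2) auto
        also have "\<dots> = 2 powr p * ?G y" using a by (simp add: powr_divide powr_minus_divide)
        finally show ?thesis .
      qed
      have nn: "?G y \<ge> 0" for y by simp
      consider "e = 1" "x \<le> pi" | "e = 1" "x \<ge> pi" | "e = -1" using e by fastforce
      then show ?thesis
      proof cases
        case 1
        then have "norm (?k (cis x)) powr p \<le> 2 powr p * ?G x" using x by (intro *) auto
        also have "\<dots> \<le> 2 powr p * (?G x + ?G (x - pi) + ?G (x - 2 * pi))"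
          using nn[of "x - pi"] nn[of "x - 2 * pi"] by (intro mult_left_mono; (linarith | simp))
        finally show ?thesis .
      next
        case 2
        then have "norm (?k (cis x)) powr p \<le> 2 powr p * ?G (x - 2 * pi)" using x
          by (intro *) (auto simp: cis_divide[symmetric])
        also have "\<dots> \<le> 2 powr p * (?G x + ?G (x - pi) + ?G (x - 2 * pi))"
          using nn[of "x - pi"] nn[of x] by (intro mult_left_mono; (linarith | simp))
        finally show ?thesis .
      next
        case 3
        then have "norm (?k (cis x)) powr p \<le> 2 powr p * ?G (x - pi)" using x
          by (intro *) (auto simp: cis_divide[symmetric] abs_le_iff)
        also have "\<dots> \<le> 2 powr p * (?G x + ?G (x - pi) + ?G (x - 2 * pi))"
          using nn[of "x - 2 * pi"] nn[of x] by (intro mult_left_mono; (linarith | simp))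
        finally show ?thesis .
      qed
    qed
    have shift: "(\<integral>\<^sup>+x. ennreal (?G (x - c)) \<partial>lborel) \<le> ennreal (16 / (p - 1) * a powr (1 - p))" for c
    proof -
      have "(\<integral>\<^sup>+x. ennreal (?G (x - c)) \<partial>lborel) = (\<integral>\<^sup>+x. ennreal (?G x) \<partial>lborel)"
        by (subst nn_integral_real_affine[where c=1 and t=c]) auto
      then show ?thesis using nn_integral_affine_powr[OF a p] by simp
    qed
    have [measurable]: "?k \<in> borel_measurable \<mu>" using LpD[OF k] by auto
    have "ennreal (LINT t|\<mu>. norm (?k t) powr p) = (\<integral>\<^sup>+t. ennreal (norm (?k t) powr p) \<partial>\<mu>)"
      using LpD[OF k] by (subst nn_integral_eq_integral) auto
    also have "\<dots> = (\<integral>\<^sup>+x. ennreal (norm (?k (cis x)) powr p) * indicator {0..2*pi} x \<partial>lborel) / ennreal (2*pi)"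
      by (rule nn_integral_mu) simp
    also have "\<dots> \<le> (\<integral>\<^sup>+x. ennreal (norm (?k (cis x)) powr p) * indicator {0..2*pi} x \<partial>lborel)"
    proof -
      have "inverse (ennreal (2 * pi)) \<le> 1"
        using pi_gt3 by (subst inverse_ennreal) (auto simp: field_simps)
      then have "x * inverse (ennreal (2 * pi)) \<le> x * 1" for x by (rule mult_left_mono) simp
      then show ?thesis unfolding divide_ennreal_def mult_1_right .
    qed
    also have "\<dots> \<le> (\<integral>\<^sup>+x. ennreal (2 powr p) * (ennreal (?G (x - 0)) + ennreal (?G (x - pi)) + ennreal (?G (x - 2 * pi))) \<partial>lborel)"
    proof (rule nn_integral_mono)
      fix x :: real
      show "ennreal (norm (?k (cis x)) powr p) * indicator {0..2*pi} x
        \<le> ennreal (2 powr p) * (ennreal (?G (x - 0)) + ennreal (?G (x - pi)) + ennreal (?G (x - 2 * pi)))"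
        using bound[of x] by (auto simp: indicator_def ennreal_mult[symmetric] ennreal_plus[symmetric] simp del: ennreal_plus intro!: ennreal_leI)
    qed
    also have "\<dots> = ennreal (2 powr p) * ((\<integral>\<^sup>+x. ennreal (?G (x - 0)) \<partial>lborel) + (\<integral>\<^sup>+x. ennreal (?G (x - pi)) \<partial>lborel)
        + (\<integral>\<^sup>+x. ennreal (?G (x - 2 * pi)) \<partial>lborel))"
      by (simp add: nn_integral_cmult nn_integral_add)
    also have "\<dots> \<le> ennreal (2 powr p) * (ennreal (16 / (p - 1) * a powr (1 - p)) + ennreal (16 / (p - 1) * a powr (1 - p)) + ennreal (16 / (p - 1) * a powr (1 - p)))"
      by (intro mult_left_mono add_mono shift) auto
    also have "\<dots> = ennreal (D * a powr (1 - p))"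
      using p by (simp add: D_def ennreal_mult[symmetric] ennreal_plus[symmetric] del: ennreal_plus)
    finally have le: "(LINT t|\<mu>. norm (?k t) powr p) \<le> D * a powr (1 - p)"
      using D by (subst (asm) ennreal_le_iff) auto
    have "Lp_norm p ?k \<le> (D * a powr (1 - p)) powr (1 / p)"
      unfolding Lp_norm_def using le p by (intro powr_mono2) auto
    also have "\<dots> = D powr (1 / p) * a powr ((1 - p) / p)" using D by (simp add: powr_mult powr_powr)
    also have "(1 - p) / p = 1 / p - 1" using p by (simp add: field_simps)
    finally show ?thesis by (simp add: a_def)
  qed
  show ?thesis by (rule that[of "D powr (1 / p)"]) (use D main in auto)
qed

section \<open>Hardy spaces and Toeplitz operators in terms of Fourier coefficients\<close>

lemma HardyD:
  assumes "f \<in> Hardy p"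
  shows "f \<in> Lp p" "\<And>n. n < 0 \<Longrightarrow> fourier_coeff f n = 0"
  using assms by (auto simp: Hardy_def)

lemma Hardy_integrable: "f \<in> Hardy p \<Longrightarrow> p \<ge> 1 \<Longrightarrow> integrable \<mu> f"
  by (rule Lp_integrable[OF HardyD(1)])

lemma Hardy_diff:
  assumes "f \<in> Hardy p" "h \<in> Hardy p" "p > 1"
  shows "(\<lambda>t. f t - h t) \<in> Hardy p"
  using assms unfolding Hardy_def
  by (auto intro!: Lp_diff simp: fourier_coeff_diff Lp_integrable)

lemma Hardy_cmult:
  assumes "f \<in> Hardy p" "p > 1"
  shows "(\<lambda>t. c * f t) \<in> Hardy p"
  using assms unfolding Hardy_def
  by (auto intro!: Lp_cmult simp: fourier_coeff_cmult)

lemma Hardy_eq_AE: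
  assumes f: "f \<in> Hardy p" "h \<in> Hardy p" and p: "p > 1"
    and eq: "\<And>n. n \<ge> 0 \<Longrightarrow> fourier_coeff f n = fourier_coeff h n"
  shows "AE t in \<mu>. f t = h t"
proof -
  have i: "integrable \<mu> f" "integrable \<mu> h" using f p by (auto intro: Hardy_integrable)
  have "fourier_coeff (\<lambda>t. f t - h t) n = 0" for n
    using eq[of n] HardyD(2)[OF f(1), of n] HardyD(2)[OF f(2), of n] i
    by (cases "n \<ge> 0") (auto simp: fourier_coeff_diff)
  then have "AE t in \<mu>. f t - h t = 0" using i by (intro fourier_unique) auto
  then show ?thesis by eventually_elim simp
qed

lemma LinfD:
  assumes "g \<in> Linf"
  obtains M where "g \<in> borel_measurable \<mu>" "AE t in \<mu>. norm (g t) \<le> M" "M > 0"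
proof -
  obtain C where C: "AE t in \<mu>. norm (g t) \<le> C" and m: "g \<in> borel_measurable \<mu>"
    using assms by (auto simp: Linf_def)
  have "AE t in \<mu>. norm (g t) \<le> max C 1" using C by eventually_elim auto
  then show ?thesis using m by (intro that[of "max C 1"]) auto
qed

text \<open>Replaces the chosen function \<open>riesz_proj\<close> by conditions on Fourier
  coefficients: injectivity with a norm bound, and surjectivity. That the projections exist at all
  is extracted from the hypothesis of invertibility.\<close>

theorem invertible_toeplitz:
  assumes p: "p > 1" and g: "g \<in> Linf" and inv: "invertible_operator_Hardy p (toeplitz p g)"
  obtains B C where "bounded_operator_Hardy p B" "C > 0"
    "\<And>f F. f \<in> Hardy p \<Longrightarrow> F \<in> Hardy p \<Longrightarrow>
       (\<And>n. n \<ge> 0 \<Longrightarrow> fourier_coeff (\<lambda>t. g t * f t) n = fourier_coeff F n) \<Longrightarrow>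
       (AE t in \<mu>. B F t = f t) \<and> Lp_norm p f \<le> C * Lp_norm p F"
    "\<And>F. F \<in> Hardy p \<Longrightarrow> \<exists>f\<in>Hardy p. \<forall>n\<ge>0. fourier_coeff (\<lambda>t. g t * f t) n = fourier_coeff F n"
proof -
  let ?A = "toeplitz p g"
  obtain B where A: "bounded_operator_Hardy p ?A" and B: "bounded_operator_Hardy p B"
    and BA: "\<And>f. f \<in> Hardy p \<Longrightarrow> AE t in \<mu>. B (?A f) t = f t"
    and AB: "\<And>f. f \<in> Hardy p \<Longrightarrow> AE t in \<mu>. ?A (B f) t = f t"
    using inv unfolding invertible_operator_Hardy_def by blast
  obtain C' where C': "\<And>f. f \<in> Hardy p \<Longrightarrow> Lp_norm p (B f) \<le> C' * Lp_norm p f"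
    using B unfolding bounded_operator_Hardy_def by blast
  define C where "C = max C' 1"
  have C: "Lp_norm p (B f) \<le> C * Lp_norm p f" if "f \<in> Hardy p" for f
  proof -
    have "C' * Lp_norm p f \<le> C * Lp_norm p f"
      unfolding C_def by (intro mult_right_mono Lp_norm_nonneg) auto
    then show ?thesis using C'[OF that] by simp
  qed
  have AH: "?A f \<in> Hardy p" and BH: "B f \<in> Hardy p" if "f \<in> Hardy p" for f
    using A B that unfolding bounded_operator_Hardy_def by blast+
  have meas: "f \<in> borel_measurable \<mu>" if "f \<in> Hardy p" for f using LpD(1)[OF HardyD(1)[OF that]] .
  obtain M where M: "g \<in> borel_measurable \<mu>" "AE t in \<mu>. norm (g t) \<le> M" using LinfD[OF g] by blast
  note [measurable] = M(1)
  \<comment> \<open>B acts on functions and not on classes; its norm bound is what makes it respect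
    equality almost everywhere.\<close>
  have B0: "AE t in \<mu>. B f t = 0" if f: "f \<in> Hardy p" and 0: "AE t in \<mu>. f t = 0" for f
  proof -
    have "Lp_norm p f = Lp_norm p (\<lambda>t. 0)" using meas[OF f] 0 by (intro Lp_norm_cong_AE) auto
    also have "\<dots> = 0" by (simp add: Lp_norm_def)
    finally have "Lp_norm p (B f) = 0" using C[OF f] Lp_norm_nonneg[of p "B f"] by simp
    then show ?thesis using HardyD(1)[OF BH[OF f]] by (intro Lp_norm_eq_0) auto
  qed
  \<comment> \<open>If the projection of \<open>g f\<close> did not exist, \<open>SOME\<close> would return one and the same function for
    \<open>f\<close> and for \<open>2 f\<close>; linearity makes it vanish, hence \<open>f = 0\<close>, whose projection does exist.\<close>
  have ex: "\<exists>h\<in>Hardy p. \<forall>n\<ge>0. fourier_coeff h n = fourier_coeff (\<lambda>t. g t * f t) n" if f: "f \<in> Hardy p" for f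
  proof (rule ccontr)
    assume no: "\<not> ?thesis"
    have no2: "\<not> (\<exists>h\<in>Hardy p. \<forall>n\<ge>0. fourier_coeff h n = fourier_coeff (\<lambda>t. g t * (2 * f t)) n)"
    proof
      assume "\<exists>h\<in>Hardy p. \<forall>n\<ge>0. fourier_coeff h n = fourier_coeff (\<lambda>t. g t * (2 * f t)) n"
      then obtain h where h: "h \<in> Hardy p" "\<forall>n\<ge>0. fourier_coeff h n = fourier_coeff (\<lambda>t. g t * (2 * f t)) n" by blast
      have "fourier_coeff (\<lambda>t. g t * (2 * f t)) n = 2 * fourier_coeff (\<lambda>t. g t * f t) n" for n
        using fourier_coeff_cmult[of 2 "\<lambda>t. g t * f t" n] by (simp add: mult.left_commute)
      then have "\<forall>n\<ge>0. fourier_coeff (\<lambda>t. (1/2) * h t) n = fourier_coeff (\<lambda>t. g t * f t) n"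
        using h(2) unfolding fourier_coeff_cmult by simp
      then show False using no Hardy_cmult[OF h(1) p, of "1/2"] by blast
    qed
    have "?A f = (SOME h. False)" "?A (\<lambda>t. 2 * f t) = (SOME h. False)"
      unfolding toeplitz_def riesz_proj_def using no no2 by (metis (mono_tags, lifting))+
    moreover have "AE t in \<mu>. ?A (\<lambda>s. 2 * f s) t = 2 * ?A f t"
      using A f unfolding bounded_operator_Hardy_def by blast
    ultimately have "AE t in \<mu>. ?A f t = 0" by (auto elim!: eventually_mono)
    then have "AE t in \<mu>. f t = 0" using B0[OF AH[OF f]] BA[OF f] by (auto elim: eventually_elim2)
    then have "fourier_coeff (\<lambda>t. g t * f t) n = fourier_coeff (\<lambda>t. 0) n" for n
      using meas[OF f] by (intro fourier_coeff_cong_AE) (auto elim!: eventually_mono)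
    moreover have "(\<lambda>t. 0) \<in> Hardy p" using Hardy_cmult[OF f p, of 0] by simp
    ultimately show False using no by auto
  qed
  have Aspec: "fourier_coeff (?A f) n = fourier_coeff (\<lambda>t. g t * f t) n" if f: "f \<in> Hardy p" and n: "n \<ge> 0" for f n
  proof -
    have "\<exists>h. h \<in> Hardy p \<and> (\<forall>n\<ge>0. fourier_coeff h n = fourier_coeff (\<lambda>t. g t * f t) n)"
      using ex[OF f] by auto
    then have "?A f \<in> Hardy p \<and> (\<forall>n\<ge>0. fourier_coeff (?A f) n = fourier_coeff (\<lambda>t. g t * f t) n)"
      unfolding toeplitz_def riesz_proj_def by (rule someI_ex)
    then show ?thesis using n by blast
  qed
  show thesis
  proof (rule that[OF B, of C])
    show "C > 0" by (simp add: C_def)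
    fix F assume F: "F \<in> Hardy p"
    have "fourier_coeff (\<lambda>t. g t * B F t) n = fourier_coeff F n" if "n \<ge> 0" for n
      using Aspec[OF BH[OF F] that] fourier_coeff_cong_AE[OF meas[OF AH[OF BH[OF F]]] meas[OF F] AB[OF F]] by simp
    then show "\<exists>f\<in>Hardy p. \<forall>n\<ge>0. fourier_coeff (\<lambda>t. g t * f t) n = fourier_coeff F n"
      using BH[OF F] by blast
    fix f assume f: "f \<in> Hardy p" and eq: "\<And>n. n \<ge> 0 \<Longrightarrow> fourier_coeff (\<lambda>t. g t * f t) n = fourier_coeff F n"
    \<comment> \<open>F and A f agree only almost everywhere. Writing F = A f + D with a null
      function D, additivity of B transfers B (A f) = f to B F.\<close>
    define D where "D t = F t - ?A f t" for t
    have D: "D \<in> Hardy p" unfolding D_def by (rule Hardy_diff[OF F AH[OF f] p])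
    have "AE t in \<mu>. ?A f t = F t"
      by (rule Hardy_eq_AE[OF AH[OF f] F p]) (use Aspec[OF f] eq in auto)
    then have "AE t in \<mu>. D t = 0" by eventually_elim (simp add: D_def)
    then have D0: "AE t in \<mu>. B D t = 0" by (rule B0[OF D])
    have F_eq: "(\<lambda>s. ?A f s + D s) = F" by (simp add: D_def)
    have "AE t in \<mu>. B (\<lambda>s. ?A f s + D s) t = B (?A f) t + B D t"
      using B AH[OF f] D unfolding bounded_operator_Hardy_def by blast
    then have BF: "AE t in \<mu>. B F t = f t"
      using D0 BA[OF f] unfolding F_eq by eventually_elim simp
    have "Lp_norm p f = Lp_norm p (B F)"
      by (rule Lp_norm_cong_AE[OF meas[OF f] meas[OF BH[OF F]]]) (use BF in eventually_elim, simp)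
    then show "(AE t in \<mu>. B F t = f t) \<and> Lp_norm p f \<le> C * Lp_norm p F" using BF C[OF F] by simp
  qed
qed

section \<open>Hardy spaces and radial limits\<close>

text \<open>Boundedness in L^p with p > 1 replaces a dominating function. Where |u| <= 1, the fixed
  h dominates. Where |u| > 1, Young's inequality with a small weight k applies: the term k^p |u|^p
  is uniformly small in the mean, and the term in |h| / k is dominated and tends to 0 because almost
  every t eventually leaves that set.\<close>

lemma Lp_bounded_AE_tendsto_zero:
  fixes u :: "nat \<Rightarrow> complex \<Rightarrow> complex"
  assumes p: "p > 1" and u: "\<And>n. u n \<in> Lp p" "\<And>n. (LINT t|\<mu>. norm (u n t) powr p) \<le> A"
    and lim: "AE t in \<mu>. (\<lambda>n. u n t) \<longlonglongrightarrow> 0"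
    and h: "h \<in> Lp (conj_exponent p)"
  shows "(\<lambda>n. LINT t|\<mu>. norm (u n t * h t)) \<longlonglongrightarrow> 0"
proof (rule tendstoI)
  fix e :: real assume e: "e > 0"
  define q where "q = conj_exponent p"
  have q: "q > 1" "1 / p + 1 / q = 1" using conj_exponent[OF p] by (auto simp: q_def)
  note h = h[folded q_def]
  have A: "A \<ge> 0" by (rule order_trans[OF _ u(2)[of 0]]) simp
  have [measurable]: "u n \<in> borel_measurable \<mu>" "h \<in> borel_measurable \<mu>" for n using LpD u h by auto
  have hi: "integrable \<mu> h" using Lp_integrable[OF h] q by simp
  note uh = holder(1)[OF p u(1) h[unfolded q_def]]
  \<comment> \<open>Chosen so that k powr p * A is at most e / 3; the summand 1 covers A =
    0.\<close>
  define k where "k = (e / (3 * (A + 1))) powr (1 / p)"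
  have k: "k > 0" using e A by (simp add: k_def)
  have kp: "k powr p = e / (3 * (A + 1))" using e A p by (simp add: k_def powr_powr)
  define a where "a n t = min (norm (u n t)) 1 * norm (h t)" for n t
  define b where "b n t = (if norm (u n t) > 1 then (norm (h t) / k) powr q else 0)" for n t
  have hq: "integrable \<mu> (\<lambda>t. (norm (h t) / k) powr q)"
    using LpD(2)[OF h] k by (simp add: powr_divide)
  have [measurable]: "a n \<in> borel_measurable \<mu>" "b n \<in> borel_measurable \<mu>" for n
    unfolding a_def[abs_def] b_def[abs_def] by measurable
  have ai: "integrable \<mu> (a n)" for n
    by (rule Bochner_Integration.integrable_bound[OF hi])
       (auto simp: a_def abs_mult mult_left_le_one_le)
  have bi: "integrable \<mu> (b n)" for n
    by (rule Bochner_Integration.integrable_bound[OF hq]) (auto simp: b_def)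
  have "(\<lambda>n. LINT t|\<mu>. a n t) \<longlonglongrightarrow> (LINT t|\<mu>. 0)"
  proof (rule integral_dominated_convergence[where w="\<lambda>t. norm (h t)"])
    show "AE t in \<mu>. (\<lambda>n. a n t) \<longlonglongrightarrow> 0"
      using lim
    proof eventually_elim
      case (elim t)
      then have "(\<lambda>n. a n t) \<longlonglongrightarrow> min (norm (0::complex)) 1 * norm (h t)"
        unfolding a_def by (intro tendsto_intros)
      then show ?case by simp
    qed
  qed (use hi in \<open>auto simp: a_def abs_mult mult_left_le_one_le\<close>)
  then have ea: "eventually (\<lambda>n. (LINT t|\<mu>. a n t) < e / 3) sequentially"
    by (rule order_tendstoD(2)) (use e in simp)
  have "(\<lambda>n. LINT t|\<mu>. b n t) \<longlonglongrightarrow> (LINT t|\<mu>. 0)"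
  proof (rule integral_dominated_convergence[where w="\<lambda>t. (norm (h t) / k) powr q"])
    show "AE t in \<mu>. (\<lambda>n. b n t) \<longlonglongrightarrow> 0"
      using lim
    proof eventually_elim
      case (elim t)
      then have "(\<lambda>n. norm (u n t)) \<longlonglongrightarrow> 0" by (rule tendsto_norm_zero)
      then have "eventually (\<lambda>n. norm (u n t) < 1) sequentially" by (rule order_tendstoD(2)) simp
      then have "eventually (\<lambda>n. b n t = 0) sequentially" by eventually_elim (simp add: b_def)
      then show ?case by (rule tendsto_eventually)
    qed
  qed (use hq in \<open>auto simp: b_def\<close>)
  then have eb: "eventually (\<lambda>n. (LINT t|\<mu>. b n t) < e / 3) sequentially"
    by (rule order_tendstoD(2)) (use e in simp)
  have young: "norm (u n t * h t) \<le> a n t + k powr p * norm (u n t) powr p + b n t" for n t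
  proof (cases "norm (u n t) > 1")
    case True
    have "norm (u n t * h t) = (k * norm (u n t)) * (norm (h t) / k)" using k by (simp add: norm_mult)
    also have "\<dots> \<le> (k * norm (u n t)) powr p / p + (norm (h t) / k) powr q / q"
      by (rule Youngs_inequality) (use p q k in auto)
    also have "(k * norm (u n t)) powr p / p \<le> (k * norm (u n t)) powr p"
      using p divide_left_mono[of 1 p "(k * norm (u n t)) powr p"] by simp
    also have "(k * norm (u n t)) powr p = k powr p * norm (u n t) powr p" using k by (simp add: powr_mult)
    also have "(norm (h t) / k) powr q / q \<le> (norm (h t) / k) powr q"
      using q divide_left_mono[of 1 q "(norm (h t) / k) powr q"] by simp
    also have "(norm (h t) / k) powr q = b n t" using True by (simp add: b_def)
    finally have "norm (u n t * h t) \<le> k powr p * norm (u n t) powr p + b n t" by simp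
    moreover have "a n t \<ge> 0" by (simp add: a_def)
    ultimately show ?thesis by linarith
  next
    case False
    then have "norm (u n t * h t) = a n t" by (simp add: a_def norm_mult)
    then show ?thesis by (simp add: b_def)
  qed
  show "\<forall>\<^sub>F n in sequentially. dist (LINT t|\<mu>. norm (u n t * h t)) 0 < e"
    using ea eb
  proof eventually_elim
    case (elim n)
    have "(LINT t|\<mu>. norm (u n t * h t)) \<le> (LINT t|\<mu>. a n t + k powr p * norm (u n t) powr p + b n t)"
      using ai bi LpD(2)[OF u(1)] uh young by (intro integral_mono) auto
    also have "\<dots> = (LINT t|\<mu>. a n t) + k powr p * (LINT t|\<mu>. norm (u n t) powr p) + (LINT t|\<mu>. b n t)"
      using ai bi LpD(2)[OF u(1)] by simp
    also have "k powr p * (LINT t|\<mu>. norm (u n t) powr p) \<le> k powr p * A"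
      using u(2) by (intro mult_left_mono) auto
    also have "k powr p * A \<le> e / 3" unfolding kp using A e by (simp add: field_simps)
    finally have "(LINT t|\<mu>. norm (u n t * h t)) < e" using elim by linarith
    then show ?case by (simp add: dist_norm)
  qed
qed

text \<open>Convergence in L^1 yields convergence almost everywhere along a subsequence of radii,
  which is enough for Fatou's lemma and for the limits of coefficients.\<close>

lemma radial_limits:
  assumes f: "integrable \<mu> f"
  obtains r :: "nat \<Rightarrow> real" where "\<And>n. 0 \<le> r n" "\<And>n. r n < 1" "r \<longlonglongrightarrow> 1"
    "AE t in \<mu>. (\<lambda>n. poisson_integral f (of_real (r n) * t)) \<longlonglongrightarrow> f t"
proof -
  obtain r :: "nat \<Rightarrow> real" where r: "\<And>n. 0 \<le> r n" "\<And>n. r n < 1" "r \<longlonglongrightarrow> 1"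
    using radii_tendsto_one by blast
  have "\<exists>l. strict_mono l \<and> (AE t in \<mu>. (\<lambda>n. poisson_integral f (of_real (r (l n)) * t) - f t) \<longlonglongrightarrow> 0)"
    by (rule tendsto_L1_AE_subseq[where u="\<lambda>n t. poisson_integral f (of_real (r n) * t) - f t"])
       (use poisson_L1_convergence[OF f r] integrable_poisson_integral[OF r(1,2) f] f in auto)
  then obtain l :: "nat \<Rightarrow> nat" where l: "strict_mono l"
    and lim: "AE t in \<mu>. (\<lambda>n. poisson_integral f (of_real (r (l n)) * t) - f t) \<longlonglongrightarrow> 0" by blast
  show ?thesis
  proof (rule that[of "r \<circ> l"])
    show "(r \<circ> l) \<longlonglongrightarrow> 1" using r(3) l by (rule LIMSEQ_subseq_LIMSEQ)
    show "AE t in \<mu>. (\<lambda>n. poisson_integral f (of_real ((r \<circ> l) n) * t)) \<longlonglongrightarrow> f t"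
      using lim by eventually_elim (simp add: LIM_zero_iff)
  qed (use r in auto)
qed

text \<open>H^p times H^q lies in H^1. For a dilation of f the coefficients of the product are an
  explicit convolution, which vanishes at negative indices; the dilations are bounded in L^p and
  converge almost everywhere, so the coefficients pass to the limit.\<close>

theorem Hardy_mult_coeff:
  assumes p: "p > 1" and f: "f \<in> Hardy p" and h: "h \<in> Hardy (conj_exponent p)" and n: "n < 0"
  shows "fourier_coeff (\<lambda>t. f t * h t) n = 0"
proof -
  have q: "conj_exponent p > 1" using conj_exponent[OF p] by simp
  have fL: "f \<in> Lp p" and hL: "h \<in> Lp (conj_exponent p)" using f h by (auto dest: HardyD)
  have fi: "integrable \<mu> f" and hi: "integrable \<mu> h"
    using Lp_integrable[OF fL] Lp_integrable[OF hL] p q by auto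
  obtain r :: "nat \<Rightarrow> real" where r: "\<And>n. 0 \<le> r n" "\<And>n. r n < 1" 
    "AE t in \<mu>. (\<lambda>n. poisson_integral f (of_real (r n) * t)) \<longlonglongrightarrow> f t"
    using radial_limits[OF fi] by metis
  define F where "F k t = poisson_integral f (of_real (r k) * t)" for k t
  have FL: "F k \<in> Lp p" for k
    unfolding F_def using p by (intro LpI_continuous continuous_poisson_integral r fi) auto
  have Fh: "fourier_coeff (\<lambda>t. F k t * h t) n = 0" for k
  proof -
    have "F k t = (\<Sum>j. (fourier_coeff f (int j) * of_real (r k) ^ j) * t ^ j)" if "norm t = 1" for t
      unfolding F_def using poisson_integral_hardy[OF fi _ norm_radius[OF r(1,2) that]] HardyD(2)[OF f]
      by (simp add: analytic_part_circle)
    then have "fourier_coeff (\<lambda>t. F k t * h t) n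
       = fourier_coeff (\<lambda>t. (\<Sum>j. (fourier_coeff f (int j) * of_real (r k) ^ j) * t ^ j) * h t) n"
      unfolding fourier_coeff_def by (intro Bochner_Integration.integral_cong) (auto simp: norm_circle)
    also have "\<dots> = (\<Sum>j. (fourier_coeff f (int j) * of_real (r k) ^ j) * fourier_coeff h (n - int j))"
      using fourier_coeff_series_mult[OF hi summable_radius(1)[OF r(1,2) fi]] by (simp add: sums_iff)
    also have "\<dots> = 0" using n HardyD(2)[OF h] by simp
    finally show ?thesis .
  qed
  define u where "u k t = f t - F k t" for k t
  have uL: "u k \<in> Lp p" for k unfolding u_def using p by (intro Lp_diff fL FL) auto
  let ?I = "LINT t|\<mu>. norm (f t) powr p"
  have "(LINT t|\<mu>. norm (u k t) powr p) \<le> 2 powr p * (?I + ?I)" for k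
  proof -
    have "(LINT t|\<mu>. norm (u k t) powr p) \<le> 2 powr p * (?I + (LINT t|\<mu>. norm (F k t) powr p))"
      unfolding u_def using p by (intro Lp_diff_integral_bound fL FL) auto
    also have "\<dots> \<le> 2 powr p * (?I + ?I)"
      using poisson_Lp_contraction[OF p r(1,2) fL] by (intro mult_left_mono add_left_mono) (auto simp: F_def)
    finally show ?thesis .
  qed
  note ub = this
  have "AE t in \<mu>. (\<lambda>k. u k t) \<longlonglongrightarrow> 0"
    using r(3)
  proof eventually_elim
    case (elim t)
    then have "(\<lambda>k. f t - F k t) \<longlonglongrightarrow> f t - f t" unfolding F_def by (intro tendsto_intros)
    then show ?case by (simp add: u_def)
  qed
  from Lp_bounded_AE_tendsto_zero[OF p uL ub this hL]
  have lim: "(\<lambda>k. LINT t|\<mu>. norm (u k t * h t)) \<longlonglongrightarrow> 0" .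
  have le: "norm (fourier_coeff (\<lambda>t. f t * h t) n) \<le> (LINT t|\<mu>. norm (u k t * h t))" for k
  proof -
    have "fourier_coeff (\<lambda>t. u k t * h t) n = fourier_coeff (\<lambda>t. f t * h t - F k t * h t) n"
      by (simp add: u_def left_diff_distrib)
    also have "\<dots> = fourier_coeff (\<lambda>t. f t * h t) n"
      using fourier_coeff_diff[OF holder(1)[OF p fL hL] holder(1)[OF p FL hL]] Fh by simp
    finally show ?thesis using norm_fourier_coeff_le[OF holder(1)[OF p uL hL]] by metis
  qed
  have "norm (fourier_coeff (\<lambda>t. f t * h t) n) \<le> 0"
    by (rule LIMSEQ_le_const[OF lim]) (use le in auto)
  then show ?thesis by simp
qed

text \<open>Here \<phi> is the solution of T(g) \<phi> = 1, C bounds the inverse operator, and s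
  will turn out to be the signature. The bound is phrased through coefficients of g f, so that F = 0
  yields injectivity and explicit pairs f, F yield norm estimates.\<close>

locale matching_toeplitz =
  fixes p :: real and g \<phi> :: "complex \<Rightarrow> complex" and s :: complex and C :: real
  assumes p: "p > 1" and g: "g \<in> Linf" and C: "C > 0"
    and inverse_bound: "\<And>f F. f \<in> Hardy p \<Longrightarrow> F \<in> Hardy p \<Longrightarrow>
       (\<And>n. n \<ge> 0 \<Longrightarrow> fourier_coeff (\<lambda>t. g t * f t) n = fourier_coeff F n) \<Longrightarrow>
       Lp_norm p f \<le> C * Lp_norm p F"
    and phi: "\<phi> \<in> Hardy p" and s: "s * s = 1" and phi_0: "fourier_coeff \<phi> 0 = s"
    and g_phi: "AE t in \<mu>. g t * \<phi> t = s * \<phi> (1 / t)"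

text \<open>Let \<psi>(t) = (g \<phi>)(1/t). Since T(g) \<phi> = 1, it lies in H^p with zeroth
  coefficient 1, and matching gives g \<psi> = \<phi>(1/t), whose projection is the constant s. So
  T(g) \<psi> = T(g)(s \<phi>), injectivity gives \<psi> = s \<phi>, and comparing zeroth
  coefficients gives s^2 = 1.\<close>

theorem matching_toeplitzI:
  assumes p: "p > 1" and g: "g \<in> Linf" and m: "matching g" and C: "C > 0"
    and bd: "\<And>f F. f \<in> Hardy p \<Longrightarrow> F \<in> Hardy p \<Longrightarrow>
       (\<And>n. n \<ge> 0 \<Longrightarrow> fourier_coeff (\<lambda>t. g t * f t) n = fourier_coeff F n) \<Longrightarrow>
       Lp_norm p f \<le> C * Lp_norm p F"
    and surj: "\<And>F. F \<in> Hardy p \<Longrightarrow> \<exists>f\<in>Hardy p. \<forall>n\<ge>0. fourier_coeff (\<lambda>t. g t * f t) n = fourier_coeff F n"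
  obtains \<phi> s where "matching_toeplitz p g \<phi> s C"
proof -
  obtain M where M: "g \<in> borel_measurable \<mu>" "AE t in \<mu>. norm (g t) \<le> M" using LinfD[OF g] by blast
  have one: "(\<lambda>t. 1) \<in> Hardy p" using p by (auto simp: Hardy_def fourier_coeff_one intro!: LpI_continuous)
  obtain \<phi> where phi: "\<phi> \<in> Hardy p"
    and c: "\<And>n. n \<ge> 0 \<Longrightarrow> fourier_coeff (\<lambda>t. g t * \<phi> t) n = (if n = 0 then 1 else 0)"
    using surj[OF one] by (auto simp: fourier_coeff_one)
  note [measurable] = M(1) LpD(1)[OF HardyD(1)[OF phi]]
  define s where "s = fourier_coeff \<phi> 0"
  define \<psi> where "\<psi> = reflect (\<lambda>t. g t * \<phi> t)"
  have gL: "(\<lambda>t. g t * \<phi> t) \<in> Lp p"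
    by (rule Lp_bounded_mult[OF HardyD(1)[OF phi] M]) (use p in auto)
  have cpsi: "fourier_coeff \<psi> n = fourier_coeff (\<lambda>t. g t * \<phi> t) (- n)" for n
    unfolding \<psi>_def by (rule fourier_coeff_reflect) simp
  have psi: "\<psi> \<in> Hardy p"
    using Lp_reflect[OF gL] c by (auto simp: Hardy_def cpsi \<psi>_def[symmetric])
  note [measurable] = LpD(1)[OF HardyD(1)[OF psi]]
  have "AE t in \<mu>. g t * \<psi> t = reflect \<phi> t"
    using m unfolding matching_def by eventually_elim (simp add: \<psi>_def reflect_def mult.assoc[symmetric])
  then have gpsi: "fourier_coeff (\<lambda>t. g t * \<psi> t) n = fourier_coeff \<phi> (- n)" for n
    by (subst fourier_coeff_cong_AE[where h="reflect \<phi>"]) (auto simp: fourier_coeff_reflect)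
  define D where "D t = \<psi> t - s * \<phi> t" for t
  have D: "D \<in> Hardy p" unfolding D_def by (intro Hardy_diff Hardy_cmult psi phi p)
  have gi: "integrable \<mu> (\<lambda>t. g t * \<phi> t)" "integrable \<mu> (\<lambda>t. g t * \<psi> t)"
    using p by (auto intro!: integrable_bounded_mult[OF _ M] Hardy_integrable[OF phi] Hardy_integrable[OF psi])
  have gD: "fourier_coeff (\<lambda>t. g t * D t) n
      = fourier_coeff (\<lambda>t. g t * \<psi> t) n - s * fourier_coeff (\<lambda>t. g t * \<phi> t) n" for n
  proof -
    have "fourier_coeff (\<lambda>t. g t * D t) n = fourier_coeff (\<lambda>t. g t * \<psi> t - s * (g t * \<phi> t)) n"
      by (simp add: D_def algebra_simps)
    then show ?thesis using gi by (simp add: fourier_coeff_diff fourier_coeff_cmult)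
  qed
  have "fourier_coeff (\<lambda>t. 0) n = 0" for n by (simp add: fourier_coeff_def)
  then have "fourier_coeff (\<lambda>t. g t * D t) n = fourier_coeff (\<lambda>t. 0) n" if "n \<ge> 0" for n
    using that HardyD(2)[OF phi, of "- n"] by (cases "n = 0") (auto simp: gD c gpsi s_def)
  moreover have "(\<lambda>t. 0) \<in> Hardy p" using Hardy_cmult[OF one p, of 0] by simp
  ultimately have "Lp_norm p D \<le> C * Lp_norm p (\<lambda>t. 0)" by (intro bd D)
  then have "Lp_norm p D = 0" using Lp_norm_nonneg[of p D] by (simp add: Lp_norm_def)
  then have D0: "AE t in \<mu>. D t = 0" by (rule Lp_norm_eq_0[OF HardyD(1)[OF D]])
  then have eq: "AE t in \<mu>. \<psi> t = s * \<phi> t" by eventually_elim (simp add: D_def)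
  have "fourier_coeff \<psi> 0 = fourier_coeff (\<lambda>t. s * \<phi> t) 0"
    by (rule fourier_coeff_cong_AE[OF _ _ eq]) auto
  then have "s * s = 1" using cpsi[of 0] c[of 0] by (simp add: fourier_coeff_cmult s_def)
  moreover have "AE t in \<mu>. g t * \<phi> t = s * \<phi> (1 / t)"
    using AE_reflect[OF eq] by (simp add: \<psi>_def reflect_def)
  ultimately have "matching_toeplitz p g \<phi> s C"
    by unfold_locales (use p g C bd phi s_def in auto)
  then show ?thesis by (rule that)
qed

section \<open>Toeplitz operators with matching symbol\<close>

context matching_toeplitz
begin

lemma conj_gt_1: "conj_exponent p > 1" using conj_exponent[OF p] by simp

lemma phi_Lp: "\<phi> \<in> Lp p" using phi by (rule HardyD)

lemma phi_integrable: "integrable \<mu> \<phi>" using Hardy_integrable[OF phi] p by simp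

lemma phi_meas [measurable]: "\<phi> \<in> borel_measurable \<mu>" using LpD[OF phi_Lp] by simp

lemma g_meas [measurable]: "g \<in> borel_measurable \<mu>" using g by (auto simp: Linf_def)

lemma s_nonzero: "s \<noteq> 0" using s by auto

lemma norm_s: "norm s = 1"
proof -
  have "norm s * norm s = 1" using s by (metis norm_mult norm_one)
  then show ?thesis by (metis abs_norm_cancel power2_eq_square real_sqrt_abs real_sqrt_one)
qed

lemma fourier_coeff_g_phi_mult:
  assumes [measurable]: "h \<in> borel_measurable \<mu>"
  shows "fourier_coeff (\<lambda>t. g t * (\<phi> t * h t)) n = s * fourier_coeff (\<lambda>t. h t * reflect \<phi> t) n"
proof -
  have "AE t in \<mu>. g t * (\<phi> t * h t) = s * (h t * reflect \<phi> t)"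
    using g_phi
  proof eventually_elim
    case (elim t)
    have "g t * (\<phi> t * h t) = (g t * \<phi> t) * h t" by (simp only: mult.assoc)
    then show ?case by (simp add: elim reflect_def)
  qed
  then have "fourier_coeff (\<lambda>t. g t * (\<phi> t * h t)) n = fourier_coeff (\<lambda>t. s * (h t * reflect \<phi> t)) n"
    by (intro fourier_coeff_cong_AE) auto
  then show ?thesis by (simp only: fourier_coeff_cmult)
qed

section \<open>The inverse Toeplitz operator on Cauchy kernels and the value of s\<close>

lemma kernel_bounded:
  fixes z :: complex
  assumes z: "norm z < 1"
  obtains K where "\<And>t::complex. norm t = 1 \<Longrightarrow> norm (1 / (1 - z * t)) \<le> K"
proof -
  have "1 - norm z \<le> norm (1 - z * t)" if "norm t = 1" for t :: complex
    using norm_triangle_ineq2[of 1 "z * t"] that by (simp add: norm_mult)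
  then have "norm (1 / (1 - z * t)) \<le> 1 / (1 - norm z)" if "norm t = 1" for t :: complex
    unfolding norm_divide norm_one using z that one_minus_ne_0[OF z that]
    by (intro divide_left_mono mult_pos_pos) auto
  then show ?thesis by (rule that)
qed

lemma kernel_meas [measurable]: "norm z < 1 \<Longrightarrow> (\<lambda>t. 1 / (1 - z * t)) \<in> borel_measurable \<mu>"
  by (intro meas_continuous continuous_kernel)

text \<open>For n >= 0 the n-th coefficient of g \<phi> / (1 - w t) is s times the sum over k >= n
  of w^k times the coefficient of \<phi> at k - n, that is s w^n \<phi>(w): under the projection the
  antianalytic factor \<phi>(1/t) acts on the Cauchy kernel as a number. The bound for the inverse
  is applied to this explicit pair.\<close>

lemma kernel_norm_le:
  assumes w: "norm w < 1"
  shows "(\<lambda>t. \<phi> t * (1 / (1 - w * t))) \<in> Lp p"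
    "Lp_norm p (\<lambda>t. \<phi> t * (1 / (1 - w * t))) \<le> C * norm (analytic_part \<phi> w) * Lp_norm p (\<lambda>t. 1 / (1 - w * t))"
proof -
  let ?k = "\<lambda>t. 1 / (1 - w * t)"
  obtain K where K: "\<And>t. norm t = 1 \<Longrightarrow> norm (?k t) \<le> K" using kernel_bounded[OF w] by blast
  have km[measurable]: "?k \<in> borel_measurable \<mu>" by (rule kernel_meas[OF w])
  have "(\<lambda>t. ?k t * \<phi> t) \<in> Lp p"
    by (rule Lp_bounded_mult[OF phi_Lp km AE_circleI[OF K]]) (use p in auto)
  then show L: "(\<lambda>t. \<phi> t * ?k t) \<in> Lp p" by (simp only: mult.commute)
  have "fourier_coeff (\<lambda>t. \<phi> t * ?k t) n = 0" if "n < 0" for n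
    using fourier_coeff_kernel_mult[OF phi_integrable w, of n] HardyD(2)[OF phi] that by (simp add: sums_iff)
  then have f: "(\<lambda>t. \<phi> t * ?k t) \<in> Hardy p" using L by (simp add: Hardy_def)
  have kc: "fourier_coeff ?k n = (if n \<ge> 0 then w ^ nat n else 0)" for n
  proof -
    have "fourier_coeff ?k n = fourier_coeff (\<lambda>t. \<Sum>k. w ^ k * t ^ k) n"
      unfolding fourier_coeff_def
      by (rule Bochner_Integration.integral_cong) (auto simp: norm_circle geometric_circle w)
    then show ?thesis using fourier_coeff_series[OF summable_norm_power[OF w], of n] by simp
  qed
  define F where "F t = (s * analytic_part \<phi> w) * ?k t" for t
  have "?k \<in> Hardy p" using p by (auto simp: Hardy_def kc intro!: LpI_continuous continuous_kernel w)
  then have F: "F \<in> Hardy p" unfolding F_def by (rule Hardy_cmult[OF _ p])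
  have "fourier_coeff (\<lambda>t. g t * (\<phi> t * ?k t)) n = fourier_coeff F n" if n: "n \<ge> 0" for n
  proof -
    obtain m where m: "n = int m" using n by (metis nonneg_int_cases)
    define S where "S = fourier_coeff (\<lambda>t. ?k t * reflect \<phi> t) n"
    have S: "(\<lambda>k. w ^ k * fourier_coeff \<phi> (int k - n)) sums S"
      using fourier_coeff_kernel_mult[OF integrable_reflect'[OF phi_integrable] w, of n]
      by (simp add: fourier_coeff_reflect S_def)
    have "(\<lambda>k. fourier_coeff \<phi> (int k) * w ^ k) sums analytic_part \<phi> w"
      unfolding analytic_part_def by (intro summable_sums summable_norm_cancel[OF summable_fourier(1)[OF phi_integrable w]])
    then have "(\<lambda>k. w ^ m * (fourier_coeff \<phi> (int k) * w ^ k)) sums (w ^ m * analytic_part \<phi> w)" by (rule sums_mult)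
    then have "(\<lambda>k. w ^ (k + m) * fourier_coeff \<phi> (int (k + m) - n)) sums (w ^ m * analytic_part \<phi> w)"
      by (simp add: m power_add mult_ac)
    then have "(\<lambda>k. w ^ k * fourier_coeff \<phi> (int k - n)) sums (w ^ m * analytic_part \<phi> w + (\<Sum>i<m. w ^ i * fourier_coeff \<phi> (int i - n)))"
      by (subst (asm) sums_iff_shift)
    moreover have "(\<Sum>i<m. w ^ i * fourier_coeff \<phi> (int i - n)) = 0"
      using HardyD(2)[OF phi] by (intro sum.neutral) (auto simp: m)
    ultimately have "S = w ^ m * analytic_part \<phi> w" using S by (metis add.right_neutral sums_unique2)
    then have "fourier_coeff (\<lambda>t. g t * (\<phi> t * ?k t)) n = s * (w ^ m * analytic_part \<phi> w)"
      unfolding fourier_coeff_g_phi_mult[OF km] S_def by simp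
    then show ?thesis using m unfolding F_def fourier_coeff_cmult kc by simp
  qed
  then have "Lp_norm p (\<lambda>t. \<phi> t * ?k t) \<le> C * Lp_norm p F" by (rule inverse_bound[OF f F])
  also have "Lp_norm p F = norm (analytic_part \<phi> w) * Lp_norm p ?k"
    unfolding F_def using p by (subst Lp_norm_cmult) (auto simp: norm_mult norm_s)
  finally show "Lp_norm p (\<lambda>t. \<phi> t * ?k t) \<le> C * norm (analytic_part \<phi> w) * Lp_norm p ?k"
    by (simp only: mult.assoc)
qed

text \<open>The factor |\<phi>(w)| occurs on both sides of the estimate and cancels, leaving a bound
  for |s - g(e)| free of \<phi>. Near e, continuity of g supplies a factor \<eta>; far from e, the
  Poisson kernel itself is of order 1 - r.\<close>

theorem value_at_fixed_point:
  assumes e: "e \<in> {1, - 1}" and cont: "continuous (at e within unit_circle) g"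
  shows "s = g e"
proof -
  define q where "q = conj_exponent p"
  have q: "q > 1" "1 / p + 1 / q = 1" using conj_exponent[OF p] by (auto simp: q_def)
  obtain Cp where Cp: "Cp > 0" "\<And>r e. 0 \<le> r \<Longrightarrow> r < 1 \<Longrightarrow> e \<in> {1, - 1} \<Longrightarrow>
      Lp_norm p (\<lambda>t. 1 / (1 - e * of_real r * t)) \<le> Cp * (1 - r) powr (1 / p - 1)"
    using kernel_Lp_estimate[OF p] by blast
  obtain Cq where Cq: "Cq > 0" "\<And>r e. 0 \<le> r \<Longrightarrow> r < 1 \<Longrightarrow> e \<in> {1, - 1} \<Longrightarrow>
      Lp_norm q (\<lambda>t. 1 / (1 - e * of_real r * t)) \<le> Cq * (1 - r) powr (1 / q - 1)"
    using kernel_Lp_estimate[OF q(1)] by blast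
  obtain M where M: "AE t in \<mu>. norm (g t) \<le> M" "M > 0" using LinfD[OF g] by blast
  define \<gamma> where "\<gamma> = g e"
  \<comment> \<open>The 2 comes from 1 - r^2 <= 2 (1 - r), C from the inverse of T(g), and Cp, Cq
    from the two kernel norms.\<close>
  define K1 where "K1 = 2 * C * Cp * Cq"
  \<comment> \<open>The condition 1 - r \<le> \<delta> / 2 gives |1 - w t| >= \<delta> / 2 outside
    the \<delta>-neighbourhood of e. The 16 collects 2 from 1 - r^2, 4 from the squared kernel, and
    2 from the bound for the mean of |\<phi>|.\<close>
  have main: "norm (s - \<gamma>) \<le> \<eta> * K1 + (M + norm \<gamma>) * (16 / \<delta>\<^sup>2 * C * Cp) * (1 - r) powr (1 / p)"
    if r: "0 \<le> r" "r < 1" "1 - r \<le> \<delta> / 2" and \<delta>: "\<delta> > 0" and \<eta>: "\<eta> > 0"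
      and near: "\<And>t. norm t = 1 \<Longrightarrow> norm (t - e) < \<delta> \<Longrightarrow> norm (g t - \<gamma>) \<le> \<eta>" for r \<delta> \<eta> :: real
  proof -
    define w where "w = e * of_real r"
    have w: "norm w < 1" "norm w = r" using e r by (auto simp: w_def norm_mult)
    have cw: "cnj w = w" using e by (auto simp: w_def)
    define \<Phi> where "\<Phi> = analytic_part \<phi> w"
    let ?k = "\<lambda>t. 1 / (1 - w * t)"
    have pk: "poisson w t = (1 - r\<^sup>2) * (norm (?k t))\<^sup>2" if "norm t = 1" for t
    proof -
      have "cnj (1 - w / t) = 1 - w * t" using that by (simp add: cw cnj_circle divide_inverse)
      then have "norm (1 - w / t) = norm (1 - w * t)" by (metis complex_mod_cnj)
      then show ?thesis by (simp add: poisson_def w norm_divide power_divide)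
    qed
    have pr: "poisson w (1 / t) = poisson w t" if "norm t = 1" for t
    proof -
      have "norm (1 - w / t) = norm (1 - w * t)"
        using that by (metis complex_cnj_diff complex_cnj_divide complex_cnj_one complex_mod_cnj cw cnj_circle divide_inverse inverse_inverse_eq)
      then show ?thesis by (simp add: poisson_def)
    qed
    have P\<phi>: "(LINT t|\<mu>. of_real (poisson w t) * \<phi> t) = \<Phi>"
      using poisson_integral_hardy[OF phi_integrable _ w(1)] HardyD(2)[OF phi] by (simp add: poisson_integral_def \<Phi>_def)
    have i1: "integrable \<mu> (\<lambda>t. of_real (poisson w t) * \<phi> t)" by (rule integrable_poisson_mult[OF phi_integrable w(1)])
    note [measurable] = meas_poisson[OF w(1)]
    have g1: "integrable \<mu> (\<lambda>t. g t * (of_real (poisson w t) * \<phi> t))"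
      by (rule integrable_bounded_mult[OF i1 g_meas M(1)])
    have "(LINT t|\<mu>. g t * (of_real (poisson w t) * \<phi> t)) = (LINT t|\<mu>. s * (of_real (poisson w (1 / t)) * \<phi> (1 / t)))"
    proof (rule integral_cong_AE)
      have "AE t in \<mu>. norm t = 1" by (rule AE_circleI) simp
      then show "AE t in \<mu>. g t * (of_real (poisson w t) * \<phi> t) = s * (of_real (poisson w (1 / t)) * \<phi> (1 / t))"
        using g_phi
      proof eventually_elim
        case (elim t)
        have "g t * (of_real (poisson w t) * \<phi> t) = of_real (poisson w t) * (g t * \<phi> t)" by (simp only: mult.left_commute)
        then show ?case by (simp add: elim pr)
      qed
    qed auto
    also have "\<dots> = s * (LINT t|\<mu>. of_real (poisson w (1 / t)) * \<phi> (1 / t))" by simp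
    also have "(LINT t|\<mu>. of_real (poisson w (1 / t)) * \<phi> (1 / t)) = \<Phi>"
      using integral_reflect[of "\<lambda>t. of_real (poisson w t) * \<phi> t"] P\<phi> by simp
    finally have "(LINT t|\<mu>. g t * (of_real (poisson w t) * \<phi> t)) = s * \<Phi>" .
    then have id: "(s - \<gamma>) * \<Phi> = (LINT t|\<mu>. g t * (of_real (poisson w t) * \<phi> t) - \<gamma> * (of_real (poisson w t) * \<phi> t))"
      using g1 i1 P\<phi> by (simp add: left_diff_distrib)
    have kq: "?k \<in> Lp q" using q by (intro LpI_continuous continuous_kernel w) auto
    note hk = kernel_norm_le[OF w(1)]
    have fk: "Lp_norm p (\<lambda>t. \<phi> t * ?k t) \<le> C * norm \<Phi> * (Cp * (1 - r) powr (1 / p - 1))"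
      unfolding \<Phi>_def using hk(2) Cp(2)[OF r(1,2) e] C
      by (elim order_trans) (auto simp: w_def intro!: mult_left_mono)
    have r2: "1 - r\<^sup>2 \<le> 2 * (1 - r)"
    proof -
      have "1 - r\<^sup>2 = (1 - r) * (1 + r)" by (simp add: power2_eq_square algebra_simps)
      also have "\<dots> \<le> (1 - r) * 2" using r by (intro mult_left_mono) auto
      finally show ?thesis by simp
    qed
    have near_int: "(LINT t|\<mu>. norm (\<phi> t) * poisson w t) \<le> norm \<Phi> * K1"
    proof -
      have "(LINT t|\<mu>. norm (\<phi> t) * poisson w t) = (LINT t|\<mu>. (1 - r\<^sup>2) * norm (\<phi> t * ?k t * ?k t))"
        by (rule Bochner_Integration.integral_cong) (auto simp: norm_circle pk norm_mult norm_divide power2_eq_square)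
      also have "\<dots> = (1 - r\<^sup>2) * (LINT t|\<mu>. norm (\<phi> t * ?k t * ?k t))" by simp
      also have "\<dots> \<le> (1 - r\<^sup>2) * (Lp_norm p (\<lambda>t. \<phi> t * ?k t) * Lp_norm q ?k)"
        using holder(2)[OF p hk(1) kq[unfolded q_def]] r unfolding q_def
        by (intro mult_left_mono) (auto simp: power_le_one)
      also have "\<dots> \<le> (2 * (1 - r)) * ((C * norm \<Phi> * (Cp * (1 - r) powr (1 / p - 1))) * (Cq * (1 - r) powr (1 / q - 1)))"
      proof (intro mult_mono)
        show "1 - r\<^sup>2 \<le> 2 * (1 - r)" by (rule r2)
        show "Lp_norm q ?k \<le> Cq * (1 - r) powr (1 / q - 1)" using Cq(2)[OF r(1,2) e] by (simp add: w_def)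
      qed (use fk r C Cp Cq in \<open>auto simp: Lp_norm_nonneg\<close>)
      also have "\<dots> = norm \<Phi> * K1 * ((1 - r) powr 1 * (1 - r) powr (1 / p - 1) * (1 - r) powr (1 / q - 1))"
        using r by (simp add: K1_def)
      also have "(1 - r) powr 1 * (1 - r) powr (1 / p - 1) * (1 - r) powr (1 / q - 1) = (1 - r) powr (1 + (1 / p - 1) + (1 / q - 1))"
        by (simp only: powr_add)
      also have "1 + (1 / p - 1) + (1 / q - 1) = 0" using q by simp
      finally show ?thesis using r by simp
    qed
    \<comment> \<open>On the circle |1 - w t| <= 2, so |\<phi>| is at most twice |\<phi> / (1 - w
      t)|. The resulting bound is again proportional to |\<phi>(w)|, as the cancellation
      requires.\<close>
    have total: "(LINT t|\<mu>. norm (\<phi> t)) \<le> 2 * (C * norm \<Phi> * (Cp * (1 - r) powr (1 / p - 1)))"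
    proof -
      have "(LINT t|\<mu>. norm (\<phi> t)) \<le> Lp_norm p \<phi>" by (rule integral_norm_le_Lp_norm[OF p phi_Lp])
      also have "\<dots> \<le> Lp_norm p (\<lambda>t. 2 * (\<phi> t * ?k t))"
      proof (rule Lp_norm_mono[OF phi_meas Lp_cmult[OF hk(1)]])
        show "AE t in \<mu>. norm (\<phi> t) \<le> norm (2 * (\<phi> t * ?k t))"
        proof (rule AE_circleI)
          fix t :: complex assume t: "norm t = 1"
          have "norm (1 - w * t) \<le> 2" using norm_triangle_ineq4[of 1 "w * t"] t w by (simp add: norm_mult)
          then have "norm (\<phi> t) * norm (1 - w * t) \<le> norm (\<phi> t) * 2" by (intro mult_left_mono) auto
          moreover have "norm (1 - w * t) > 0" using one_minus_ne_0[OF w(1) t] by simp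
          ultimately show "norm (\<phi> t) \<le> norm (2 * (\<phi> t * ?k t))"
            by (simp add: norm_mult norm_divide field_simps)
        qed
      qed (use p in auto)
      also have "\<dots> = 2 * Lp_norm p (\<lambda>t. \<phi> t * ?k t)" using p by (subst Lp_norm_cmult) auto
      finally show ?thesis using fk by linarith
    qed
    \<comment> \<open>The zeroth coefficient of \<phi> has modulus 1, so the bound just shown cannot
      hold with \<Phi> = 0; this justifies the division at the end.\<close>
    have "1 \<le> (LINT t|\<mu>. norm (\<phi> t))"
      using norm_fourier_coeff_le[OF phi_integrable, of 0] by (simp add: phi_0 norm_s)
    then have "\<Phi> \<noteq> 0" using total by auto
    then have \<Phi>: "norm \<Phi> > 0" by simp
    define L where "L = (M + norm \<gamma>) * (2 * (1 - r) * (4 / \<delta>\<^sup>2))"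
    have L0: "L \<ge> 0" using M r by (simp add: L_def)
    have pw: "AE t in \<mu>. norm (g t * (of_real (poisson w t) * \<phi> t) - \<gamma> * (of_real (poisson w t) * \<phi> t))
        \<le> \<eta> * (norm (\<phi> t) * poisson w t) + L * norm (\<phi> t)"
    proof -
      have "AE t in \<mu>. norm t = 1" by (rule AE_circleI) simp
      then show ?thesis using M(1)
      proof eventually_elim
        case (elim t)
        have p0: "poisson w t \<ge> 0" by (rule poisson_nonneg[OF w(1)])
        have eq: "norm (g t * (of_real (poisson w t) * \<phi> t) - \<gamma> * (of_real (poisson w t) * \<phi> t))
           = norm (g t - \<gamma>) * (norm (\<phi> t) * poisson w t)"
          using p0 by (simp add: left_diff_distrib[symmetric] norm_mult)
        show ?case
        proof (cases "norm (t - e) < \<delta>")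
          case True
          have "norm (g t - \<gamma>) * (norm (\<phi> t) * poisson w t) \<le> \<eta> * (norm (\<phi> t) * poisson w t)"
            using near[OF elim(1) True] p0 by (intro mult_right_mono) auto
          then show ?thesis unfolding eq using L0 by (simp add: add_increasing2)
        next
          case False
          have e2: "e * e = 1" using e by auto
          \<comment> \<open>Since e^2 = 1, the distance from t to e is |1 - e t|, which differs from
            |1 - w t| by at most 1 - r.\<close>
          have "t - e = e * (e * t - 1)" using e2 by (simp add: algebra_simps flip: mult.assoc)
          then have "norm (t - e) = norm (1 - e * t)" using e by (auto simp: norm_mult norm_minus_commute)
          moreover have "norm (1 - e * t) \<le> norm (1 - w * t) + norm (of_real (1 - r) * (e * t))"
          proof -
            have eqn: "1 - e * t = (1 - w * t) - of_real (1 - r) * (e * t)" by (simp add: w_def algebra_simps)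
            show ?thesis unfolding eqn by (rule norm_triangle_ineq4)
          qed
          moreover have "norm (of_real (1 - r) * (e * t)) = 1 - r"
            unfolding norm_mult norm_of_real using e elim(1) r by auto
          ultimately have "\<delta> / 2 \<le> norm (1 - w * t)" using False r(3) by linarith
          then have "norm (?k t) \<le> 1 / (\<delta> / 2)"
            unfolding norm_divide norm_one using \<delta> by (intro divide_left_mono mult_pos_pos) auto
          then have "(norm (?k t))\<^sup>2 \<le> (1 / (\<delta> / 2))\<^sup>2" by (intro power_mono) auto
          also have "(1 / (\<delta> / 2))\<^sup>2 = 4 / \<delta>\<^sup>2" by (simp add: power_divide)
          finally have k2: "(norm (?k t))\<^sup>2 \<le> 4 / \<delta>\<^sup>2" .
          have pb: "poisson w t \<le> 2 * (1 - r) * (4 / \<delta>\<^sup>2)"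
            unfolding pk[OF elim(1)] using r2 k2 r by (intro mult_mono) auto
          have "norm (g t - \<gamma>) \<le> M + norm \<gamma>" using norm_triangle_ineq4[of "g t" \<gamma>] elim(2) by linarith
          then have "norm (g t - \<gamma>) * (norm (\<phi> t) * poisson w t) \<le> (M + norm \<gamma>) * (norm (\<phi> t) * (2 * (1 - r) * (4 / \<delta>\<^sup>2)))"
            using pb p0 M by (intro mult_mono mult_left_mono) auto
          also have "\<dots> = L * norm (\<phi> t)" by (simp add: L_def)
          finally show ?thesis unfolding eq using \<eta> p0 by (simp add: add_increasing)
        qed
      qed
    qed
    have ip: "integrable \<mu> (\<lambda>t. norm (\<phi> t) * poisson w t)"
      using integrable_poisson_mult_real[OF integrable_norm[OF phi_integrable] w(1)] by (simp only: mult.commute)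
    have "norm (s - \<gamma>) * norm \<Phi> = norm ((s - \<gamma>) * \<Phi>)" by (simp add: norm_mult)
    also have "\<dots> \<le> (LINT t|\<mu>. norm (g t * (of_real (poisson w t) * \<phi> t) - \<gamma> * (of_real (poisson w t) * \<phi> t)))"
      unfolding id by (rule integral_norm_bound)
    also have "\<dots> \<le> (LINT t|\<mu>. \<eta> * (norm (\<phi> t) * poisson w t) + L * norm (\<phi> t))"
    proof (rule integral_mono_AE[OF _ _ pw])
      show "integrable \<mu> (\<lambda>t. norm (g t * (of_real (poisson w t) * \<phi> t) - \<gamma> * (of_real (poisson w t) * \<phi> t)))"
        by (intro integrable_norm Bochner_Integration.integrable_diff integrable_mult_right g1 i1)
      show "integrable \<mu> (\<lambda>t. \<eta> * (norm (\<phi> t) * poisson w t) + L * norm (\<phi> t))"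
        by (intro Bochner_Integration.integrable_add integrable_mult_right ip integrable_norm phi_integrable)
    qed
    also have "\<dots> = \<eta> * (LINT t|\<mu>. norm (\<phi> t) * poisson w t) + L * (LINT t|\<mu>. norm (\<phi> t))"
      using ip phi_integrable by simp
    also have "\<dots> \<le> \<eta> * (norm \<Phi> * K1) + L * (2 * (C * norm \<Phi> * (Cp * (1 - r) powr (1 / p - 1))))"
      using near_int total \<eta> L0 by (intro add_mono mult_left_mono) auto
    also have "\<dots> = (\<eta> * K1 + (M + norm \<gamma>) * (16 / \<delta>\<^sup>2 * C * Cp) * ((1 - r) powr 1 * (1 - r) powr (1 / p - 1))) * norm \<Phi>"
      using r by (simp add: L_def algebra_simps)
    \<comment> \<open>The full power of 1 - r contained in L leaves the positive exponent 1 / p, so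
      this term vanishes as r tends to 1 with \<delta> fixed.\<close>
    also have "(1 - r) powr 1 * (1 - r) powr (1 / p - 1) = (1 - r) powr (1 / p)"
      by (subst powr_add[symmetric]) simp
    finally show ?thesis using \<Phi> by (simp only: mult_le_cancel_right_pos)
  qed
  \<comment> \<open>The order of limits matters: \<delta> depends on \<eta>, so r tends to 1 first
    and \<eta> is made small afterwards.\<close>
  have "norm (s - \<gamma>) \<le> \<eta> * K1" if \<eta>: "\<eta> > 0" for \<eta>
  proof -
    obtain \<delta> where \<delta>: "\<delta> > 0" "\<And>t. t \<in> unit_circle \<Longrightarrow> dist t e < \<delta> \<Longrightarrow> dist (g t) (g e) < \<eta>"
      using cont \<eta> unfolding continuous_within_eps_delta by blast
    then have near: "norm (g t - \<gamma>) \<le> \<eta>" if "norm t = 1" "norm (t - e) < \<delta>" for t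
      using that by (force simp: norm_circle dist_norm \<gamma>_def)
    obtain r :: "nat \<Rightarrow> real" where r: "\<And>n. 0 \<le> r n" "\<And>n. r n < 1" "r \<longlonglongrightarrow> 1"
      using radii_tendsto_one by blast
    have r1: "(\<lambda>n. 1 - r n) \<longlonglongrightarrow> 0" using tendsto_diff[OF tendsto_const r(3), of 1] by simp
    have "(\<lambda>n. (1 - r n) powr (1 / p)) \<longlonglongrightarrow> 0 powr (1 / p)"
      by (rule tendsto_powr'[OF r1 tendsto_const]) (use p r in \<open>auto intro!: always_eventually simp: less_imp_le\<close>)
    then have "(\<lambda>n. \<eta> * K1 + (M + norm \<gamma>) * (16 / \<delta>\<^sup>2 * C * Cp) * (1 - r n) powr (1 / p)) \<longlonglongrightarrow>
       \<eta> * K1 + (M + norm \<gamma>) * (16 / \<delta>\<^sup>2 * C * Cp) * 0 powr (1 / p)"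
      by (intro tendsto_add tendsto_mult tendsto_const)
    moreover have "eventually (\<lambda>n. norm (s - \<gamma>) \<le> \<eta> * K1 + (M + norm \<gamma>) * (16 / \<delta>\<^sup>2 * C * Cp) * (1 - r n) powr (1 / p)) sequentially"
    proof -
      have "eventually (\<lambda>n. 1 - r n < \<delta> / 2) sequentially"
        by (rule order_tendstoD(2)[OF r1]) (use \<delta> in simp)
      then show ?thesis
        by eventually_elim (rule main[OF r(1,2) _ \<delta>(1) \<eta> near], auto)
    qed
    ultimately have "norm (s - \<gamma>) \<le> \<eta> * K1 + (M + norm \<gamma>) * (16 / \<delta>\<^sup>2 * C * Cp) * 0 powr (1 / p)"
      by (rule tendsto_lowerbound) simp
    then show ?thesis by simp
  qed
  note small = this
  have K1: "K1 > 0" using C Cp Cq by (simp add: K1_def)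
  have "norm (s - \<gamma>) \<le> 0 + x" if "x > 0" for x
    using small[of "x / K1"] that K1 by simp
  then have "norm (s - \<gamma>) \<le> 0" by (rule field_le_epsilon)
  then show ?thesis by (simp add: \<gamma>_def)
qed

end

section \<open>The reciprocal of \<phi>, from formal series to boundary function\<close>

lemma fourier_coeff_finite_sum_mult:
  assumes f: "integrable \<mu> f"
  shows "integrable \<mu> (\<lambda>t. (\<Sum>j\<le>N. d j * t ^ j) * f t)"
    "fourier_coeff (\<lambda>t. (\<Sum>j\<le>N. d j * t ^ j) * f t) n = (\<Sum>j\<le>N. d j * fourier_coeff f (n - int j))"
proof -
  have eq: "(\<lambda>t. (\<Sum>j\<le>N. d j * t ^ j) * f t) = (\<lambda>t. \<Sum>j\<le>N. d j * (t powi int j * f t))"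
    by (simp add: sum_distrib_right mult.assoc)
  have i: "integrable \<mu> (\<lambda>t. d j * (t powi int j * f t))" for j
    by (intro integrable_mult_right integrable_powi_mult f)
  show "integrable \<mu> (\<lambda>t. (\<Sum>j\<le>N. d j * t ^ j) * f t)"
    unfolding eq by (intro Bochner_Integration.integrable_sum i)
  show "fourier_coeff (\<lambda>t. (\<Sum>j\<le>N. d j * t ^ j) * f t) n = (\<Sum>j\<le>N. d j * fourier_coeff f (n - int j))"
    unfolding eq by (subst fourier_coeff_sum[OF i]) (simp only: fourier_coeff_cmult fourier_coeff_shift)
qed

lemma fourier_coeff_finite_sum:
  "fourier_coeff (\<lambda>t. \<Sum>j\<le>N. d j * t ^ j) n = (if 0 \<le> n \<and> n \<le> int N then d (nat n) else 0)"
proof -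
  have "fourier_coeff (\<lambda>t. (\<Sum>j\<le>N. d j * t ^ j) * 1) n = (\<Sum>j\<le>N. d j * fourier_coeff (\<lambda>t. 1) (n - int j))"
    by (rule fourier_coeff_finite_sum_mult) simp
  also have "\<dots> = (\<Sum>j\<le>N. if j = nat n then if n \<ge> 0 then d j else 0 else 0)"
    by (rule sum.cong) (auto simp: fourier_coeff_one)
  also have "\<dots> = (if 0 \<le> n \<and> n \<le> int N then d (nat n) else 0)" by (simp add: nat_le_iff)
  finally show ?thesis by simp
qed

lemma finite_sum_Hardy:
  assumes "p > 0" shows "(\<lambda>t. \<Sum>j\<le>N. d j * t ^ j) \<in> Hardy p"
  using assms by (auto simp: Hardy_def fourier_coeff_finite_sum intro!: LpI_continuous continuous_intros)

lemma bounded_finite_sum: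
  obtains K where "\<And>t::complex. norm t = 1 \<Longrightarrow> norm (\<Sum>j\<le>N. d j * t ^ j) \<le> K"
proof
  fix t :: complex assume "norm t = 1"
  then show "norm (\<Sum>j\<le>N. d j * t ^ j) \<le> (\<Sum>j\<le>N. norm (d j))"
    using norm_sum[of "\<lambda>j. d j * t ^ j" "{..N}"] by (simp add: norm_mult norm_power)
qed

lemma Lp_finite_sum_mult:
  assumes f: "f \<in> Lp p" and p: "p > 0"
  shows "(\<lambda>t. (\<Sum>j\<le>N. d j * t ^ j) * f t) \<in> Lp p"
proof -
  obtain K where "\<And>t::complex. norm t = 1 \<Longrightarrow> norm (\<Sum>j\<le>N. d j * t ^ j) \<le> K"
    using bounded_finite_sum by blast
  then show ?thesis
    by (intro Lp_bounded_mult[OF f _ AE_circleI p] meas_continuous continuous_intros) auto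
qed

context matching_toeplitz
begin

text \<open>These are the K_k. The formal inverse exists because the constant term s is nonzero,
  whereas zeros of \<phi> in the disc are not yet excluded.\<close>

definition recip_coeff :: "nat \<Rightarrow> complex" where
  "recip_coeff = fps_nth (inverse (Abs_fps (\<lambda>n. fourier_coeff \<phi> (int n))))"

lemma recip_coeff_conv:
  "(\<Sum>i\<le>k. recip_coeff i * fourier_coeff \<phi> (int (k - i))) = (if k = 0 then 1 else 0)"
proof -
  let ?F = "Abs_fps (\<lambda>n. fourier_coeff \<phi> (int n))"
  have "inverse ?F * ?F = 1" by (rule inverse_mult_eq_1) (simp add: phi_0 s_nonzero)
  then have "fps_nth (inverse ?F * ?F) k = (if k = 0 then 1 else 0)" by simp
  then show ?thesis by (simp add: fps_mult_nth recip_coeff_def atMost_atLeast0)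
qed

lemma recip_coeff_0: "recip_coeff 0 = s"
proof -
  have "recip_coeff 0 * s = 1" using recip_coeff_conv[of 0] by (simp add: phi_0)
  then show ?thesis using s by (metis mult.assoc mult.commute mult.left_neutral)
qed

text \<open>Formally the coefficients of the projection of r(t) / \<phi>(1/t).\<close>

definition inverse_symbol_coeff :: "complex poly \<Rightarrow> nat \<Rightarrow> complex" where
  "inverse_symbol_coeff r j = (\<Sum>k=j..degree r. coeff r k * recip_coeff (k - j))"

text \<open>Multiplication by \<phi>(1/t) undoes multiplication by its reciprocal even with a
  projection in between, because antianalytic factors never raise a frequency. After exchanging the
  sums this is the convolution identity for \<open>recip_coeff\<close>.\<close>

lemma inverse_symbol_conv:
  "(\<Sum>j\<le>degree r. inverse_symbol_coeff r j * fourier_coeff \<phi> (int j - int m)) = coeff r m"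
proof -
  let ?N = "degree r"
  have inner: "(\<Sum>j\<le>k. recip_coeff (k - j) * fourier_coeff \<phi> (int j - int m)) = (if k = m then 1 else 0)" for k
  proof (cases "m \<le> k")
    case True
    have "(\<Sum>j\<le>k. recip_coeff (k - j) * fourier_coeff \<phi> (int j - int m))
       = (\<Sum>j\<in>{m..k}. recip_coeff (k - j) * fourier_coeff \<phi> (int j - int m))"
      using HardyD(2)[OF phi] by (intro sum.mono_neutral_right) auto
    also have "\<dots> = (\<Sum>i\<le>k - m. recip_coeff i * fourier_coeff \<phi> (int (k - m - i)))"
      using True by (intro sum.reindex_bij_witness[of _ "\<lambda>i. k - i" "\<lambda>j. k - j"]) (auto simp: of_nat_diff)
    also have "\<dots> = (if k = m then 1 else 0)" using True by (simp only: recip_coeff_conv) auto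
    finally show ?thesis .
  next
    case False
    then show ?thesis using HardyD(2)[OF phi] by (auto intro!: sum.neutral)
  qed
  have "(\<Sum>j\<le>?N. inverse_symbol_coeff r j * fourier_coeff \<phi> (int j - int m))
     = (\<Sum>j\<le>?N. \<Sum>k=j..?N. coeff r k * recip_coeff (k - j) * fourier_coeff \<phi> (int j - int m))"
    by (simp add: inverse_symbol_coeff_def sum_distrib_right)
  also have "\<dots> = (\<Sum>k\<le>?N. \<Sum>j\<le>k. coeff r k * recip_coeff (k - j) * fourier_coeff \<phi> (int j - int m))"
    unfolding sum.Sigma[OF finite_atMost ballI[OF finite_atLeastAtMost]] sum.Sigma[OF finite_atMost ballI[OF finite_atMost]]
    by (rule sum.reindex_bij_witness[of _ "\<lambda>(k, j). (j, k)" "\<lambda>(j, k). (k, j)"]) auto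
  also have "\<dots> = (\<Sum>k\<le>?N. coeff r k * (if k = m then 1 else 0))"
    by (intro sum.cong refl) (simp only: mult.assoc sum_distrib_left[symmetric] inner)
  also have "\<dots> = coeff r m" by (simp add: if_distrib coeff_eq_0 cong: if_cong)
  finally show ?thesis .
qed

text \<open>The solution of T(g) f = r read off from the expected factorization: \<phi> times the
  projection of r / (s \<phi>(1/t)), where 1 / s = s.\<close>

definition preimage :: "complex poly \<Rightarrow> complex \<Rightarrow> complex" where
  "preimage r t = s * (\<Sum>j\<le>degree r. inverse_symbol_coeff r j * t ^ j) * \<phi> t"

lemma preimage_Hardy: "preimage r \<in> Hardy p"
proof -
  let ?D = "\<lambda>t. \<Sum>j\<le>degree r. inverse_symbol_coeff r j * t ^ j"
  have "(\<lambda>t. ?D t * \<phi> t) \<in> Hardy p"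
    using Lp_finite_sum_mult[OF phi_Lp] p HardyD(2)[OF phi]
    by (auto simp: Hardy_def fourier_coeff_finite_sum_mult phi_integrable)
  from Hardy_cmult[OF this p, of s] show ?thesis by (simp add: preimage_def[abs_def] mult.assoc)
qed

lemma fourier_coeff_poly: "fourier_coeff (poly r) n = (if n \<ge> 0 then coeff r (nat n) else 0)"
  using fourier_coeff_finite_sum[of "coeff r" "degree r" n]
  by (auto simp: poly_altdef[abs_def] coeff_eq_0)

lemma poly_Hardy: "p' > 0 \<Longrightarrow> poly r \<in> Hardy p'"
  using finite_sum_Hardy[of p' "coeff r" "degree r"] by (simp add: poly_altdef[abs_def])

text \<open>Two factors s meet and give 1: one from the preimage, one from g \<phi> = s \<phi>(1/t).
  What remains is the convolution identity.\<close>

lemma toeplitz_preimage: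
  assumes "n \<ge> 0"
  shows "fourier_coeff (\<lambda>t. g t * preimage r t) n = fourier_coeff (poly r) n"
proof -
  let ?D = "\<lambda>t. \<Sum>j\<le>degree r. inverse_symbol_coeff r j * t ^ j"
  have [measurable]: "?D \<in> borel_measurable \<mu>" by (intro meas_continuous continuous_intros)
  have "fourier_coeff (\<lambda>t. g t * preimage r t) n = fourier_coeff (\<lambda>t. s * (g t * (\<phi> t * ?D t))) n"
    by (simp add: preimage_def mult_ac)
  also have "\<dots> = s * s * fourier_coeff (\<lambda>t. ?D t * reflect \<phi> t) n"
    by (simp only: fourier_coeff_cmult fourier_coeff_g_phi_mult[OF \<open>?D \<in> _\<close>] mult.assoc)
  also have "\<dots> = (\<Sum>j\<le>degree r. inverse_symbol_coeff r j * fourier_coeff \<phi> (int j - n))"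
    by (simp add: s fourier_coeff_finite_sum_mult integrable_reflect' phi_integrable fourier_coeff_reflect)
  also have "\<dots> = coeff r (nat n)" using inverse_symbol_conv[of r "nat n"] assms by simp
  finally show ?thesis using assms by (simp add: fourier_coeff_poly)
qed

text \<open>Because \<phi> has zeroth coefficient s and s^2 = 1, the sum is the zeroth coefficient
  of the solution of T(g) f = r, and the bound for the inverse controls it.\<close>

lemma recip_functional_bound:
  "norm (\<Sum>k\<le>degree r. coeff r k * recip_coeff k) \<le> C * Lp_norm p (poly r)"
proof -
  have L: "preimage r \<in> Lp p" using preimage_Hardy by (rule HardyD)
  have "fourier_coeff (preimage r) 0 = s * (\<Sum>j\<le>degree r. inverse_symbol_coeff r j * fourier_coeff \<phi> (0 - int j))"
    by (simp only: preimage_def[abs_def] mult.assoc fourier_coeff_cmult fourier_coeff_finite_sum_mult phi_integrable)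
  also have "(\<Sum>j\<le>degree r. inverse_symbol_coeff r j * fourier_coeff \<phi> (0 - int j))
      = (\<Sum>j\<le>degree r. if j = 0 then inverse_symbol_coeff r 0 * s else 0)"
    using HardyD(2)[OF phi] by (intro sum.cong) (auto simp: phi_0)
  also have "\<dots> = inverse_symbol_coeff r 0 * s" by simp
  finally have "fourier_coeff (preimage r) 0 = s * s * inverse_symbol_coeff r 0" by (simp add: mult_ac)
  then have "(\<Sum>k\<le>degree r. coeff r k * recip_coeff k) = fourier_coeff (preimage r) 0"
    by (simp add: s inverse_symbol_coeff_def atMost_atLeast0)
  also have "norm \<dots> \<le> (LINT t|\<mu>. norm (preimage r t))"
    by (rule norm_fourier_coeff_le[OF Lp_integrable[OF L]]) (use p in simp)
  also have "\<dots> \<le> Lp_norm p (preimage r)" by (rule integral_norm_le_Lp_norm[OF p L])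
  also have "\<dots> \<le> C * Lp_norm p (poly r)"
    by (rule inverse_bound[OF preimage_Hardy poly_Hardy toeplitz_preimage]) (use p in auto)
  finally show ?thesis .
qed

lemma recip_functional_bound_sum:
  "norm (\<Sum>k\<le>N. b k * recip_coeff k) \<le> C * Lp_norm p (\<lambda>t. \<Sum>k\<le>N. b k * t ^ k)"
proof -
  define r where "r = (\<Sum>k\<le>N. monom (b k) k)"
  have cr: "coeff r k = (if k \<le> N then b k else 0)" for k
    by (simp add: r_def coeff_sum)
  have "degree r \<le> N" by (rule degree_le) (simp add: cr)
  then have "(\<Sum>k\<le>degree r. coeff r k * recip_coeff k) = (\<Sum>k\<le>N. coeff r k * recip_coeff k)"
    by (intro sum.mono_neutral_left) (auto simp: coeff_eq_0)
  also have "\<dots> = (\<Sum>k\<le>N. b k * recip_coeff k)" by (simp add: cr)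
  finally have "(\<Sum>k\<le>degree r. coeff r k * recip_coeff k) = (\<Sum>k\<le>N. b k * recip_coeff k)" .
  moreover have "poly r = (\<lambda>t. \<Sum>k\<le>N. b k * t ^ k)" by (simp add: fun_eq_iff r_def poly_sum poly_monom)
  ultimately show ?thesis using recip_functional_bound[of r] by simp
qed

text \<open>The functional is tested on t^k, which has norm 1. Bounded coefficients make the
  reciprocal series converge in the whole disc.\<close>

lemma recip_coeff_bound: "norm (recip_coeff k) \<le> C"
proof -
  let ?b = "\<lambda>j. if j = k then 1 else 0 :: complex"
  have b: "(\<Sum>j\<le>k. ?b j * x j) = x k" for x
  proof -
    have "(\<Sum>j\<le>k. ?b j * x j) = (\<Sum>j\<le>k. if j = k then x k else 0)" by (rule sum.cong) auto
    then show ?thesis by simp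
  qed
  have "Lp_norm p (\<lambda>t. t ^ k) = Lp_norm p (\<lambda>t. 1)"
    unfolding Lp_norm_def
    by (intro arg_cong[where f="\<lambda>x. x powr (1 / p)"] Bochner_Integration.integral_cong)
       (auto simp: norm_circle norm_power)
  then show ?thesis using recip_functional_bound_sum[of ?b k] unfolding b by (simp add: Lp_norm_1)
qed

definition recip :: "complex \<Rightarrow> complex" where "recip z = (\<Sum>k. recip_coeff k * z ^ k)"

lemma summable_recip: "norm z < 1 \<Longrightarrow> summable (\<lambda>k. norm (recip_coeff k * z ^ k))"
  by (rule summable_coeff_power[OF recip_coeff_bound])

text \<open>The Cauchy product turns the formal identity into one between functions; in particular
  \<phi> has no zeros in the disc.\<close>

lemma recip_mult_phi:
  assumes z: "norm z < 1"
  shows "recip z * analytic_part \<phi> z = 1"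
proof -
  have "(\<lambda>k. \<Sum>i\<le>k. (recip_coeff i * z ^ i) * (fourier_coeff \<phi> (int (k - i)) * z ^ (k - i))) sums
     ((\<Sum>k. recip_coeff k * z ^ k) * (\<Sum>k. fourier_coeff \<phi> (int k) * z ^ k))"
    by (rule Cauchy_product_sums[OF summable_recip[OF z] summable_fourier(1)[OF phi_integrable z]])
  moreover have "(\<Sum>i\<le>k. (recip_coeff i * z ^ i) * (fourier_coeff \<phi> (int (k - i)) * z ^ (k - i))) = (if k = 0 then 1 else 0)" for k
  proof -
    have "(\<Sum>i\<le>k. (recip_coeff i * z ^ i) * (fourier_coeff \<phi> (int (k - i)) * z ^ (k - i)))
       = (\<Sum>i\<le>k. z ^ k * (recip_coeff i * fourier_coeff \<phi> (int (k - i))))"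
    proof (rule sum.cong)
      fix i assume "i \<in> {..k}"
      then have "z ^ i * z ^ (k - i) = z ^ k" by (simp flip: power_add)
      moreover have "(recip_coeff i * z ^ i) * (fourier_coeff \<phi> (int (k - i)) * z ^ (k - i))
         = z ^ i * z ^ (k - i) * (recip_coeff i * fourier_coeff \<phi> (int (k - i)))"
        by (simp only: mult_ac)
      ultimately show "(recip_coeff i * z ^ i) * (fourier_coeff \<phi> (int (k - i)) * z ^ (k - i))
         = z ^ k * (recip_coeff i * fourier_coeff \<phi> (int (k - i)))" by simp
    qed simp
    then show ?thesis by (simp only: sum_distrib_left[symmetric] recip_coeff_conv) simp
  qed
  moreover have "(\<lambda>k. if k = 0 then 1 else 0 :: complex) sums 1" using sums_single[of 0 "\<lambda>_. 1::complex"] by simp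
  ultimately show ?thesis unfolding recip_def analytic_part_def by (simp add: sums_iff)
qed

lemma recip_circle: "recip (of_real r * t) = (\<Sum>k. (recip_coeff k * of_real r ^ k) * t ^ k)"
  by (simp add: recip_def power_mult_distrib mult.assoc)

lemma summable_recip_radius:
  assumes "0 \<le> r" "r < 1"
  shows "summable (\<lambda>k. norm (recip_coeff k * of_real r ^ k))"
  using summable_recip[of "of_real r"] assms by simp

lemma continuous_recip:
  assumes "0 \<le> r" "r < 1"
  shows "continuous_on unit_circle (\<lambda>t. recip (of_real r * t))"
  unfolding recip_circle by (intro series_continuous summable_recip_radius assms)

lemma fourier_coeff_recip:
  assumes "0 \<le> r" "r < 1"
  shows "fourier_coeff (\<lambda>t. recip (of_real r * t)) n = (if n \<ge> 0 then recip_coeff (nat n) * of_real r ^ nat n else 0)"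
  unfolding recip_circle by (rule fourier_coeff_series[OF summable_recip_radius[OF assms]])

text \<open>The functional is evaluated on Taylor polynomials of the dilated projection of c, and
  both sides pass to the limit. The left side becomes a pairing of the reciprocal with an arbitrary
  integrable c, which prepares the duality argument.\<close>

lemma recip_functional_limit:
  assumes r: "0 \<le> r" "r < 1" and c: "integrable \<mu> c"
  shows "norm (LINT t|\<mu>. recip (of_real r * t) * c (1 / t)) powr p
    \<le> C powr p * (LINT t|\<mu>. norm (analytic_part c (of_real r * t)) powr p)"
proof -
  let ?b = "\<lambda>k. fourier_coeff c (int k) * of_real r ^ k"
  define X where "X = (LINT t|\<mu>. recip (of_real r * t) * c (1 / t))"
  have sb: "summable (\<lambda>k. norm (?b k))" by (rule summable_radius(1)[OF r c])
  have cm[measurable]: "c \<in> borel_measurable \<mu>" using c by auto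
  have "(\<lambda>k. recip_coeff k * of_real r ^ k * fourier_coeff (reflect c) (0 - int k)) sums
     fourier_coeff (\<lambda>t. recip (of_real r * t) * reflect c t) 0"
    unfolding recip_circle by (rule fourier_coeff_series_mult[OF integrable_reflect'[OF c] summable_recip_radius[OF r]])
  then have "(\<lambda>k. ?b k * recip_coeff k) sums X"
    by (simp add: X_def fourier_coeff_reflect reflect_def fourier_coeff_def[of _ 0] mult_ac)
  then have "(\<lambda>N. \<Sum>k\<le>N. ?b k * recip_coeff k) \<longlonglongrightarrow> X" by (simp add: sums_def_le)
  then have l1: "(\<lambda>N. norm (\<Sum>k\<le>N. ?b k * recip_coeff k) powr p) \<longlonglongrightarrow> norm X powr p"
    by (intro tendsto_powr'[OF tendsto_norm tendsto_const]) (use p in auto)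
  have l2: "(\<lambda>N. LINT t|\<mu>. norm (\<Sum>k\<le>N. ?b k * t ^ k) powr p) \<longlonglongrightarrow> (LINT t|\<mu>. norm (analytic_part c (of_real r * t)) powr p)"
  proof (rule integral_dominated_convergence[where w="\<lambda>_. (\<Sum>k. norm (?b k)) powr p"])
    have [measurable]: "(\<lambda>t. \<Sum>k\<le>N. ?b k * t ^ k) \<in> borel_measurable \<mu>" for N
      by (intro meas_continuous continuous_intros)
    show "(\<lambda>t. norm (\<Sum>k\<le>N. ?b k * t ^ k) powr p) \<in> borel_measurable \<mu>" for N by measurable
    show "(\<lambda>t. norm (analytic_part c (of_real r * t)) powr p) \<in> borel_measurable \<mu>"
      using integrable_analytic_part_powr[OF c r, of p] p by auto
    show "AE t in \<mu>. (\<lambda>N. norm (\<Sum>k\<le>N. ?b k * t ^ k) powr p) \<longlonglongrightarrow> norm (analytic_part c (of_real r * t)) powr p"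
    proof (rule AE_circleI)
      fix t :: complex assume "norm t = 1"
      then have "summable (\<lambda>k. norm (?b k * t ^ k))" using sb by (simp add: norm_mult norm_power)
      then have "(\<lambda>k. ?b k * t ^ k) sums (analytic_part c (of_real r * t))"
        unfolding analytic_part_circle by (rule summable_sums[OF summable_norm_cancel])
      then have "(\<lambda>N. \<Sum>k\<le>N. ?b k * t ^ k) \<longlonglongrightarrow> analytic_part c (of_real r * t)" by (simp add: sums_def_le)
      then show "(\<lambda>N. norm (\<Sum>k\<le>N. ?b k * t ^ k) powr p) \<longlonglongrightarrow> norm (analytic_part c (of_real r * t)) powr p"
        by (intro tendsto_powr'[OF tendsto_norm tendsto_const]) (use p in auto)
    qed
    show "AE t in \<mu>. norm (norm (\<Sum>k\<le>N. ?b k * t ^ k) powr p) \<le> (\<Sum>k. norm (?b k)) powr p" for N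
    proof (rule AE_circleI)
      fix t :: complex assume t: "norm t = 1"
      have "norm (\<Sum>k\<le>N. ?b k * t ^ k) \<le> (\<Sum>k\<le>N. norm (?b k))"
        using t norm_sum[of "\<lambda>k. ?b k * t ^ k" "{..N}"] by (simp add: norm_mult norm_power)
      also have "\<dots> \<le> (\<Sum>k. norm (?b k))" by (rule sum_le_suminf[OF sb]) auto
      finally show "norm (norm (\<Sum>k\<le>N. ?b k * t ^ k) powr p) \<le> (\<Sum>k. norm (?b k)) powr p"
        using p by (simp add: powr_mono2)
    qed
  qed simp
  have "norm (\<Sum>k\<le>N. ?b k * recip_coeff k) powr p \<le> C powr p * (LINT t|\<mu>. norm (\<Sum>k\<le>N. ?b k * t ^ k) powr p)" for N
  proof -
    have "norm (\<Sum>k\<le>N. ?b k * recip_coeff k) powr p \<le> (C * Lp_norm p (\<lambda>t. \<Sum>k\<le>N. ?b k * t ^ k)) powr p"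
      using p by (intro powr_mono2 recip_functional_bound_sum) auto
    also have "\<dots> = C powr p * (LINT t|\<mu>. norm (\<Sum>k\<le>N. ?b k * t ^ k) powr p)"
      using p C by (simp add: powr_mult Lp_norm_nonneg Lp_norm_powr)
    finally show ?thesis .
  qed
  then have "norm X powr p \<le> C powr p * (LINT t|\<mu>. norm (analytic_part c (of_real r * t)) powr p)"
    by (intro LIMSEQ_le[OF l1 tendsto_mult[OF tendsto_const l2]]) auto
  then show ?thesis by (simp only: X_def)
qed

text \<open>Duality, uniformly in r: c is the reflection of the extremal function |k|^q / k, with k
  the dilated reciprocal. M. Riesz's inequality bounds the projection of c by c, and since (q - 1) p
  = q the estimate becomes X^p <= C^p A X for X the integral of |k|^q.\<close>

lemma recip_Lq_bound:
  obtains A where "\<And>r. 0 \<le> r \<Longrightarrow> r < 1 \<Longrightarrow>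
    (LINT t|\<mu>. norm (recip (of_real r * t)) powr conj_exponent p) \<le> A"
proof -
  define q where "q = conj_exponent p"
  have q: "q > 1" "(q - 1) * p = q" using conj_exponent[OF p] by (auto simp: q_def)
  obtain A where A: "A \<ge> 0" "\<And>r c. 0 \<le> r \<Longrightarrow> r < 1 \<Longrightarrow> c \<in> Lp p \<Longrightarrow>
    (LINT t|\<mu>. norm (analytic_part c (of_real r * t)) powr p) \<le> A * (LINT t|\<mu>. norm (c t) powr p)"
    using M_Riesz[OF p] by blast
  have "(LINT t|\<mu>. norm (recip (of_real r * t)) powr q) \<le> (C powr p * A) powr (1 / (p - 1))"
    if r: "0 \<le> r" "r < 1" for r
  proof -
    define k where "k t = recip (of_real r * t)" for t
    have ck: "continuous_on unit_circle k" unfolding k_def by (rule continuous_recip[OF r])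
    have [measurable]: "k \<in> borel_measurable \<mu>" by (rule meas_continuous[OF ck])
    have k0: "k t \<noteq> 0" if "norm t = 1" for t
      using recip_mult_phi[OF norm_radius[OF r that]] by (auto simp: k_def)
    define d where "d t = of_real (norm (k t) powr q) / k t" for t
    define c where "c t = d (1 / t)" for t
    have cd: "continuous_on unit_circle d"
      unfolding d_def using ck k0 q by (intro continuous_intros) (auto simp: norm_circle)
    have dL: "d \<in> Lp p" using p by (intro LpI_continuous cd) auto
    have cL: "c \<in> Lp p" using Lp_reflect[OF dL] by (simp add: reflect_def[abs_def] c_def[abs_def])
    have ci: "integrable \<mu> c" using Lp_integrable[OF cL] p by simp
    define X where "X = (LINT t|\<mu>. norm (k t) powr q)"
    have X: "X \<ge> 0" by (simp add: X_def)
    have "(LINT t|\<mu>. recip (of_real r * t) * c (1 / t)) = (LINT t|\<mu>. of_real (norm (k t) powr q))"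
      by (rule Bochner_Integration.integral_cong) (auto simp: norm_circle c_def d_def k0 k_def[symmetric])
    also have "\<dots> = of_real X" by (simp add: X_def)
    finally have "norm (LINT t|\<mu>. recip (of_real r * t) * c (1 / t)) = X" using X by simp
    then have "X powr p \<le> C powr p * (LINT t|\<mu>. norm (analytic_part c (of_real r * t)) powr p)"
      using recip_functional_limit[OF r ci] by simp
    also have "\<dots> \<le> C powr p * (A * (LINT t|\<mu>. norm (c t) powr p))"
      by (intro mult_left_mono A r cL) auto
    also have "(LINT t|\<mu>. norm (c t) powr p) = (LINT t|\<mu>. norm (d t) powr p)"
      unfolding c_def using LpD(1)[OF dL] by (intro integral_reflect) auto
    also have "\<dots> = X"
      unfolding X_def
    proof (rule Bochner_Integration.integral_cong)
      fix t assume "t \<in> space \<mu>"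
      then have "norm (k t) > 0" using k0 by (simp add: norm_circle)
      then have "norm (d t) = norm (k t) powr (q - 1)"
        by (simp add: d_def norm_divide powr_diff)
      then show "norm (d t) powr p = norm (k t) powr q" using q by (simp add: powr_powr)
    qed simp
    finally have le: "X powr p \<le> C powr p * A * X" by (simp add: mult.assoc)
    have "X \<le> (C powr p * A) powr (1 / (p - 1))"
    proof (cases "X = 0")
      case False
      then have X0: "X > 0" using X by simp
      have "X powr (p - 1) * X = X powr p" using X0 powr_add[of X "p - 1" 1] by simp
      then have "X powr (p - 1) * X \<le> C powr p * A * X" using le by (simp only:)
      then have "X powr (p - 1) \<le> C powr p * A" using X0 by (rule mult_right_le_imp_le)
      then have "(X powr (p - 1)) powr (1 / (p - 1)) \<le> (C powr p * A) powr (1 / (p - 1))"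
        using p by (intro powr_mono2) auto
      then show ?thesis using X0 p by (simp add: powr_powr)
    qed simp
    then show ?thesis by (simp add: X_def k_def)
  qed
  then show ?thesis using that unfolding q_def by blast
qed

end

text \<open>Exhibiting one function with the right coefficients determines the projection, so a
  concrete projection is justified by an explicit candidate.\<close>

lemma riesz_proj_unique:
  assumes p: "p > 1" and h: "h \<in> Hardy p" and eq: "\<And>n. n \<ge> 0 \<Longrightarrow> fourier_coeff h n = fourier_coeff f n"
  shows "AE t in \<mu>. riesz_proj p f t = h t"
proof -
  have "riesz_proj p f \<in> Hardy p \<and> (\<forall>n\<ge>0. fourier_coeff (riesz_proj p f) n = fourier_coeff f n)"
    unfolding riesz_proj_def by (rule someI[of _ h]) (use h eq in auto)
  then show ?thesis by (intro Hardy_eq_AE[OF _ h p]) (auto simp: eq)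
qed

context matching_toeplitz
begin

text \<open>The three claims share one passage to the boundary. Fatou's lemma bounds the mean of the
  lower limit of |1/\<phi>(r t)|^q. Where \<phi> has boundary value zero this limit is infinite, so
  that happens only on a null set; elsewhere it equals |1/\<phi>|^q. The coefficients follow because
  the dilations are bounded in L^q and converge almost everywhere.\<close>

lemma reciprocal:
  shows phi_nonzero: "AE t in \<mu>. \<phi> t \<noteq> 0"
    and inverse_phi_Hardy: "(\<lambda>t. inverse (\<phi> t)) \<in> Hardy (conj_exponent p)"
    and fourier_coeff_inverse_phi:
      "fourier_coeff (\<lambda>t. inverse (\<phi> t)) n = (if n \<ge> 0 then recip_coeff (nat n) else 0)"
proof -
  define q where "q = conj_exponent p"
  have q: "q > 1" "conj_exponent q = p" using conj_exponent[OF p] by (auto simp: q_def)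
  obtain A where A: "\<And>r. 0 \<le> r \<Longrightarrow> r < 1 \<Longrightarrow> (LINT t|\<mu>. norm (recip (of_real r * t)) powr q) \<le> A"
    using recip_Lq_bound unfolding q_def by blast
  obtain r :: "nat \<Rightarrow> real" where r: "\<And>n. 0 \<le> r n" "\<And>n. r n < 1" "r \<longlonglongrightarrow> 1"
    and lim: "AE t in \<mu>. (\<lambda>n. poisson_integral \<phi> (of_real (r n) * t)) \<longlonglongrightarrow> \<phi> t"
    using radial_limits[OF phi_integrable] by blast
  define K where "K n t = recip (of_real (r n) * t)" for n t
  define F where "F n t = analytic_part \<phi> (of_real (r n) * t)" for n t
  have KF: "K n t * F n t = 1" if "norm t = 1" for n t
    unfolding K_def F_def by (rule recip_mult_phi[OF norm_radius[OF r(1,2) that]])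
  have KL: "K n \<in> Lp q" for n
    unfolding K_def using q by (intro LpI_continuous continuous_recip r) auto
  have Km[measurable]: "K n \<in> borel_measurable \<mu>" for n using LpD(1)[OF KL] .
  have circle: "AE t in \<mu>. norm t = 1" by (rule AE_circleI) simp
  have lim': "AE t in \<mu>. (\<lambda>n. F n t) \<longlonglongrightarrow> \<phi> t"
    using lim circle
  proof eventually_elim
    case (elim t)
    have "poisson_integral \<phi> (of_real (r n) * t) = F n t" for n
      unfolding F_def using HardyD(2)[OF phi]
      by (intro poisson_integral_hardy phi_integrable norm_radius[OF r(1,2) elim(2)]) auto
    then show ?case using elim(1) by simp
  qed
  \<comment> \<open>An extended nonnegative lower limit makes sense before \<phi> t \<noteq> 0 is
    known.\<close>
  define h where "h t = liminf (\<lambda>n. ennreal (norm (K n t) powr q))" for t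
  have hm[measurable]: "h \<in> borel_measurable \<mu>" unfolding h_def[abs_def] by measurable
  have "(\<integral>\<^sup>+t. h t \<partial>\<mu>) \<le> liminf (\<lambda>n. \<integral>\<^sup>+t. ennreal (norm (K n t) powr q) \<partial>\<mu>)"
    unfolding h_def by (rule nn_integral_liminf) measurable
  also have "\<dots> \<le> limsup (\<lambda>n. \<integral>\<^sup>+t. ennreal (norm (K n t) powr q) \<partial>\<mu>)"
    by (rule Liminf_le_Limsup) simp
  also have "\<dots> \<le> ennreal A"
  proof (rule Limsup_bounded, rule always_eventually, rule allI)
    fix n
    have "(\<integral>\<^sup>+t. ennreal (norm (K n t) powr q) \<partial>\<mu>) = ennreal (LINT t|\<mu>. norm (K n t) powr q)"
      using LpD(2)[OF KL] by (rule nn_integral_eq_integral) simp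
    also have "\<dots> \<le> ennreal A" unfolding K_def by (intro ennreal_leI A r)
    finally show "(\<integral>\<^sup>+t. ennreal (norm (K n t) powr q) \<partial>\<mu>) \<le> ennreal A" .
  qed
  finally have hA: "(\<integral>\<^sup>+t. h t \<partial>\<mu>) \<le> ennreal A" .
  have "(\<integral>\<^sup>+t. h t \<partial>\<mu>) \<noteq> \<infinity>" using hA by (auto simp: top_unique)
  then have hfin: "AE t in \<mu>. h t \<noteq> \<infinity>" by (rule nn_integral_noteq_infinite[OF hm])
  have key: "AE t in \<mu>. \<phi> t \<noteq> 0 \<and> (\<lambda>n. K n t) \<longlonglongrightarrow> inverse (\<phi> t)
      \<and> ennreal (norm (inverse (\<phi> t)) powr q) = h t"
    using hfin lim' circle
  proof eventually_elim
    case (elim t)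
    have F0: "F n t \<noteq> 0" and KFi: "K n t = inverse (F n t)" for n
    proof -
      show "F n t \<noteq> 0" using KF[OF elim(3), of n] by auto
      have "F n t * K n t = 1" using KF[OF elim(3), of n] by (simp only: mult.commute)
      then show "K n t = inverse (F n t)" by (rule inverse_unique[symmetric])
    qed
    have "\<phi> t \<noteq> 0"
    proof
      assume "\<phi> t = 0"
      then have "(\<lambda>n. norm (F n t)) \<longlonglongrightarrow> 0" using elim(2) by (simp add: tendsto_norm_zero)
      then have top: "filterlim (\<lambda>n. inverse (norm (F n t))) at_top sequentially"
        by (rule filterlim_inverse_at_top) (use F0 in auto)
      then have "eventually (\<lambda>n. 1 \<le> inverse (norm (F n t))) sequentially"
        by (auto simp: filterlim_at_top)
      then have "eventually (\<lambda>n. inverse (norm (F n t)) \<le> norm (K n t) powr q) sequentially"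
      proof eventually_elim
        case (elim n)
        then have "inverse (norm (F n t)) powr 1 \<le> inverse (norm (F n t)) powr q"
          using q by (intro powr_mono) auto
        then show ?case by (simp add: KFi norm_inverse)
      qed
      with top have "filterlim (\<lambda>n. norm (K n t) powr q) at_top sequentially" by (rule filterlim_at_top_mono)
      then have "(\<lambda>n. ennreal (norm (K n t) powr q)) \<longlonglongrightarrow> \<infinity>"
        by (simp add: ennreal_tendsto_top_eq_at_top)
      then have "h t = \<infinity>" unfolding h_def by (rule lim_imp_Liminf[OF sequentially_bot])
      then show False using elim(1) by simp
    qed
    moreover have Klim: "(\<lambda>n. K n t) \<longlonglongrightarrow> inverse (\<phi> t)"
      unfolding KFi using elim(2) \<open>\<phi> t \<noteq> 0\<close> by (rule tendsto_inverse)
    moreover have "(\<lambda>n. norm (K n t) powr q) \<longlonglongrightarrow> norm (inverse (\<phi> t)) powr q"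
      by (intro tendsto_powr'[OF tendsto_norm[OF Klim] tendsto_const]) (use q in auto)
    then have "(\<lambda>n. ennreal (norm (K n t) powr q)) \<longlonglongrightarrow> ennreal (norm (inverse (\<phi> t)) powr q)"
      by (rule tendsto_ennrealI)
    then have "h t = ennreal (norm (inverse (\<phi> t)) powr q)"
      unfolding h_def by (rule lim_imp_Liminf[OF sequentially_bot])
    ultimately show ?case by simp
  qed
  then show "AE t in \<mu>. \<phi> t \<noteq> 0" by eventually_elim simp
  let ?\<chi> = "\<lambda>t. inverse (\<phi> t)"
  have "(\<integral>\<^sup>+t. ennreal (norm (?\<chi> t) powr q) \<partial>\<mu>) = (\<integral>\<^sup>+t. h t \<partial>\<mu>)"
    by (rule nn_integral_cong_AE) (use key in eventually_elim, simp)
  also have "\<dots> < \<infinity>" using hA by (rule le_less_trans) simp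
  finally have \<chi>L: "?\<chi> \<in> Lp q"
    unfolding Lp_def by (auto intro!: integrableI_nonneg)
  have \<chi>i: "integrable \<mu> ?\<chi>" using Lp_integrable[OF \<chi>L] q by simp
  define u where "u n t = K n t - ?\<chi> t" for n t
  have uL: "u n \<in> Lp q" for n unfolding u_def using q by (intro Lp_diff KL \<chi>L) auto
  have ub: "(LINT t|\<mu>. norm (u n t) powr q) \<le> 2 powr q * (A + (LINT t|\<mu>. norm (?\<chi> t) powr q))" for n
  proof -
    have "(LINT t|\<mu>. norm (u n t) powr q)
        \<le> 2 powr q * ((LINT t|\<mu>. norm (K n t) powr q) + (LINT t|\<mu>. norm (?\<chi> t) powr q))"
      unfolding u_def using q by (intro Lp_diff_integral_bound KL \<chi>L) auto
    also have "\<dots> \<le> 2 powr q * (A + (LINT t|\<mu>. norm (?\<chi> t) powr q))"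
      using A[OF r(1,2)] by (intro mult_left_mono add_right_mono) (auto simp: K_def)
    finally show ?thesis .
  qed
  have ulim: "AE t in \<mu>. (\<lambda>n. u n t) \<longlonglongrightarrow> 0"
    using key
  proof eventually_elim
    case (elim t)
    then have "(\<lambda>n. K n t - ?\<chi> t) \<longlonglongrightarrow> ?\<chi> t - ?\<chi> t" by (intro tendsto_diff tendsto_const) auto
    then show ?case by (simp add: u_def)
  qed
  \<comment> \<open>Pairing with the constant 1 turns boundedness in L^q into convergence in L^1,
    hence of every coefficient.\<close>
  have "(\<lambda>t. 1) \<in> Lp (conj_exponent q)" unfolding q(2) using p by (intro LpI_continuous) auto
  from Lp_bounded_AE_tendsto_zero[OF q(1) uL ub ulim this]
  have lim0: "(\<lambda>n. LINT t|\<mu>. norm (u n t)) \<longlonglongrightarrow> 0" by simp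
  have coeff: "fourier_coeff ?\<chi> n = (if n \<ge> 0 then recip_coeff (nat n) else 0)" for n
  proof -
    have "(\<lambda>k. fourier_coeff (u k) n) \<longlonglongrightarrow> 0"
      by (rule Lim_null_comparison[OF _ lim0])
         (intro always_eventually allI norm_fourier_coeff_le Lp_integrable[OF uL], use q in simp)
    moreover have "fourier_coeff (u k) n = fourier_coeff (K k) n - fourier_coeff ?\<chi> n" for k
      unfolding u_def using q by (intro fourier_coeff_diff Lp_integrable[OF KL] \<chi>i) auto
    ultimately have "(\<lambda>k. fourier_coeff (K k) n - fourier_coeff ?\<chi> n) \<longlonglongrightarrow> 0" by simp
    then have 1: "(\<lambda>k. fourier_coeff (K k) n) \<longlonglongrightarrow> fourier_coeff ?\<chi> n" by (simp add: LIM_zero_iff)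
    have "(\<lambda>k. recip_coeff (nat n) * of_real (r k) ^ nat n) \<longlonglongrightarrow> recip_coeff (nat n) * of_real 1 ^ nat n"
      by (intro tendsto_intros r(3))
    then have "(\<lambda>k. if n \<ge> 0 then recip_coeff (nat n) * of_real (r k) ^ nat n else 0)
        \<longlonglongrightarrow> (if n \<ge> 0 then recip_coeff (nat n) * of_real 1 ^ nat n else 0)"
      by simp
    then have "(\<lambda>k. fourier_coeff (K k) n) \<longlonglongrightarrow> (if n \<ge> 0 then recip_coeff (nat n) * of_real 1 ^ nat n else 0)"
      by (simp only: K_def[abs_def] fourier_coeff_recip[OF r(1,2)])
    from LIMSEQ_unique[OF 1 this] show ?thesis by simp
  qed
  show "fourier_coeff ?\<chi> n = (if n \<ge> 0 then recip_coeff (nat n) else 0)" by (rule coeff)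
  show "?\<chi> \<in> Hardy (conj_exponent p)"
    using \<chi>L by (simp add: Hardy_def coeff q_def)
qed

section \<open>Existence of the factorization and uniqueness of its signature\<close>

lemma inverse_phi_Lp: "(\<lambda>t. inverse (\<phi> t)) \<in> Lp (conj_exponent p)"
  using inverse_phi_Hardy by (rule HardyD)

lemma inverse_phi_meas [measurable]: "(\<lambda>t. inverse (\<phi> t)) \<in> borel_measurable \<mu>"
  using LpD(1)[OF inverse_phi_Lp] .

lemma inverse_phi_integrable: "integrable \<mu> (\<lambda>t. inverse (\<phi> t))"
  using Lp_integrable[OF inverse_phi_Lp] conj_gt_1 by simp

text \<open>The \<open>recip_coeff\<close> are by now the coefficients of a genuine function, so the
  formal computation behind \<open>inverse_symbol_coeff\<close> describes an actual projection. The
  candidate is a polynomial, so its membership in H^q is immediate.\<close>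

lemma riesz_proj_inverse_factor:
  "AE t in \<mu>. riesz_proj (conj_exponent p) (\<lambda>t. inverse (s * \<phi> (1 / t)) * poly r t) t
     = s * (\<Sum>j\<le>degree r. inverse_symbol_coeff r j * t ^ j)"
proof (rule riesz_proj_unique[OF conj_gt_1])
  let ?\<chi> = "\<lambda>t. inverse (\<phi> t)" and ?D = "\<lambda>t. \<Sum>j\<le>degree r. inverse_symbol_coeff r j * t ^ j"
  have q: "conj_exponent p > 0" using conj_gt_1 by simp
  show "(\<lambda>t. s * ?D t) \<in> Hardy (conj_exponent p)"
    by (intro Hardy_cmult finite_sum_Hardy q conj_gt_1)
  fix n :: int assume n: "n \<ge> 0"
  then obtain m where m: "n = int m" by (metis nonneg_int_cases)
  have inv_s: "inverse s = s" using s by (rule inverse_unique)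
  have "(\<lambda>t. inverse (s * \<phi> (1 / t)) * poly r t) = (\<lambda>t. s * ((\<Sum>k\<le>degree r. coeff r k * t ^ k) * reflect ?\<chi> t))"
    by (simp add: fun_eq_iff inv_s poly_altdef reflect_def mult_ac)
  then have "fourier_coeff (\<lambda>t. inverse (s * \<phi> (1 / t)) * poly r t) n
     = s * (\<Sum>k\<le>degree r. coeff r k * fourier_coeff ?\<chi> (int k - n))"
    by (simp add: fourier_coeff_cmult fourier_coeff_finite_sum_mult integrable_reflect' inverse_phi_integrable
        fourier_coeff_reflect)
  also have "(\<Sum>k\<le>degree r. coeff r k * fourier_coeff ?\<chi> (int k - n)) = (\<Sum>k\<in>{m..degree r}. coeff r k * fourier_coeff ?\<chi> (int k - n))"
    by (rule sum.mono_neutral_right) (auto simp: m fourier_coeff_inverse_phi)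
  also have "\<dots> = inverse_symbol_coeff r m"
    unfolding inverse_symbol_coeff_def by (rule sum.cong) (auto simp: m fourier_coeff_inverse_phi nat_diff_distrib)
  finally have 1: "fourier_coeff (\<lambda>t. inverse (s * \<phi> (1 / t)) * poly r t) n = s * inverse_symbol_coeff r m" .
  have "inverse_symbol_coeff r m = 0" if "m > degree r" using that by (simp add: inverse_symbol_coeff_def)
  then show "fourier_coeff (\<lambda>t. s * ?D t) n = fourier_coeff (\<lambda>t. inverse (s * \<phi> (1 / t)) * poly r t) n"
    unfolding 1 fourier_coeff_cmult fourier_coeff_finite_sum by (auto simp: m not_le)
qed

text \<open>The bounded extension demanded of a factorization is the inverse of T(g) itself: on a
  polynomial r it gives \<open>preimage r\<close>, which is \<phi> times the projection of r divided
  by the minus factor.\<close>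

theorem factorization_exists:
  assumes B: "bounded_operator_Hardy p B"
    "\<And>f F. f \<in> Hardy p \<Longrightarrow> F \<in> Hardy p \<Longrightarrow>
       (\<And>n. n \<ge> 0 \<Longrightarrow> fourier_coeff (\<lambda>t. g t * f t) n = fourier_coeff F n) \<Longrightarrow> AE t in \<mu>. B F t = f t"
  shows "wiener_hopf_factorization p g (\<lambda>t. s * \<phi> (1 / t)) 0 (\<lambda>t. inverse (\<phi> t))"
proof -
  let ?gm = "\<lambda>t. s * \<phi> (1 / t)" and ?\<chi> = "\<lambda>t. inverse (\<phi> t)"
  have q: "conj_exponent p > 0" using conj_gt_1 by simp
  have inv_s: "inverse s = s" using s by (rule inverse_unique)
  have gm: "?gm = (\<lambda>t. s * reflect \<phi> t)" by (simp add: reflect_def)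
  have igm: "(\<lambda>t. inverse (?gm t)) = (\<lambda>t. s * reflect ?\<chi> t)" by (simp add: reflect_def inv_s fun_eq_iff)
  have 1: "AE t in \<mu>. g t = ?gm t * t powi 0 * ?\<chi> t"
    using g_phi phi_nonzero by eventually_elim (simp add: field_simps)
  have 2: "AE t in \<mu>. ?\<chi> t \<noteq> 0" using phi_nonzero by eventually_elim simp
  have 3: "AE t in \<mu>. ?gm t \<noteq> 0" using AE_reflect[OF phi_nonzero] by eventually_elim (simp add: s_nonzero)
  have 4: "?gm \<in> conj_Hardy p"
    unfolding gm conj_Hardy_def using p HardyD(2)[OF phi]
    by (auto intro!: Lp_cmult Lp_reflect phi_Lp simp: fourier_coeff_cmult fourier_coeff_reflect)
  have 5: "(\<lambda>t. inverse (?gm t)) \<in> conj_Hardy (conj_exponent p)"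
    unfolding igm conj_Hardy_def using q
    by (auto intro!: Lp_cmult Lp_reflect inverse_phi_Lp simp: fourier_coeff_cmult fourier_coeff_reflect fourier_coeff_inverse_phi)
  have 6: "fourier_coeff ?gm 0 = 1"
    unfolding gm by (simp add: fourier_coeff_cmult fourier_coeff_reflect phi_0 s)
  have 7: "AE t in \<mu>. B (poly r) t = inverse (?\<chi> t) * riesz_proj (conj_exponent p) (\<lambda>t. inverse (?gm t) * poly r t) t" for r
  proof -
    have "AE t in \<mu>. B (poly r) t = preimage r t"
      by (rule B(2)[OF preimage_Hardy poly_Hardy toeplitz_preimage]) (use p in auto)
    then show ?thesis using riesz_proj_inverse_factor[of r]
      by eventually_elim (simp add: preimage_def mult_ac)
  qed
  show ?thesis
    unfolding wiener_hopf_factorization_def Let_def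
    using 1 2 3 4 5 6 7 inverse_phi_Hardy phi B(1) by (auto simp del: inverse_mult_distrib)
qed

text \<open>The index decides the argument. For \<nu> < 0 the function 1/gp lies in the kernel of
  T(g); for \<nu> = 0 it solves T(g) f = 1 and hence equals \<phi>; for \<nu> > 0 a comparison with
  \<phi> leaves a function without any frequencies.\<close>

theorem factorization_unique:
  assumes wh: "wiener_hopf_factorization p g gm \<nu> gp"
  shows "fourier_coeff gp 0 = s"
proof -
  let ?q = "conj_exponent p"
  have g_eq: "AE t in \<mu>. g t = gm t * t powi \<nu> * gp t" and gp0: "AE t in \<mu>. gp t \<noteq> 0" and gm0: "AE t in \<mu>. gm t \<noteq> 0"
    and gp: "gp \<in> Hardy ?q" and X: "(\<lambda>t. inverse (gp t)) \<in> Hardy p"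
    and gm: "gm \<in> conj_Hardy p" and igm: "(\<lambda>t. inverse (gm t)) \<in> conj_Hardy ?q" and gm1: "fourier_coeff gm 0 = 1"
    using wh unfolding wiener_hopf_factorization_def Let_def by blast+
  have igmL: "(\<lambda>t. inverse (gm t)) \<in> Lp ?q" and gmL: "gm \<in> Lp p" using igm gm by (auto simp: conj_Hardy_def)
  note gpL = HardyD(1)[OF gp] and XL = HardyD(1)[OF X]
  note [measurable] = LpD(1)[OF gpL] LpD(1)[OF XL] LpD(1)[OF gmL] LpD(1)[OF igmL]
  let ?X = "\<lambda>t. inverse (gp t)"
  have "AE t in \<mu>. g t * ?X t = t powi \<nu> * gm t"
    using g_eq gp0 by eventually_elim simp
  then have gX: "fourier_coeff (\<lambda>t. g t * ?X t) n = fourier_coeff gm (n - \<nu>)" for n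
    by (subst fourier_coeff_shift[symmetric], intro fourier_coeff_cong_AE) auto
  have gm_pos: "fourier_coeff gm n = 0" if "n > 0" for n using gm that by (simp add: conj_Hardy_def)
  have zero: "(\<lambda>t. 0) \<in> Hardy p" using Hardy_cmult[OF phi p, of 0] by simp
  have fc0: "fourier_coeff (\<lambda>t. 0) n = 0" for n by (simp add: fourier_coeff_def)
  have vanish: "AE t in \<mu>. f t = 0"
    if f: "f \<in> Hardy p" "\<And>n. n \<ge> 0 \<Longrightarrow> fourier_coeff (\<lambda>t. g t * f t) n = 0" for f
  proof -
    have "Lp_norm p f \<le> C * Lp_norm p (\<lambda>t. 0)"
      by (rule inverse_bound[OF f(1) zero]) (simp add: f(2) fc0)
    then have "Lp_norm p f = 0" using Lp_norm_nonneg[of p f] by (simp add: Lp_norm_def)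
    then show ?thesis by (rule Lp_norm_eq_0[OF HardyD(1)[OF f(1)]])
  qed
  consider "\<nu> < 0" | "\<nu> = 0" | "\<nu> > 0" by linarith
  then show ?thesis
  proof cases
    case 1
    \<comment> \<open>The product of g and 1/gp is t^\<nu> gm, whose frequencies are all at most
      \<nu> < 0, so its projection is zero.\<close>
    then have "AE t in \<mu>. ?X t = 0" by (intro vanish X) (simp add: gX gm_pos)
    then have "AE t in \<mu>. False" using gp0 by eventually_elim simp
    then show ?thesis by simp
  next
    case 2
    obtain M where M: "AE t in \<mu>. norm (g t) \<le> M" using LinfD[OF g] by blast
    have i: "integrable \<mu> (\<lambda>t. g t * ?X t)" "integrable \<mu> (\<lambda>t. g t * \<phi> t)"
      using p by (auto intro!: integrable_bounded_mult[OF _ g_meas M] Hardy_integrable[OF X] phi_integrable)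
    have gphi: "fourier_coeff (\<lambda>t. g t * \<phi> t) n = s * fourier_coeff \<phi> (- n)" for n
      using fourier_coeff_g_phi_mult[of "\<lambda>_. 1" n] by (simp add: fourier_coeff_reflect)
    have "AE t in \<mu>. ?X t - \<phi> t = 0"
    proof (rule vanish)
      show "(\<lambda>t. ?X t - \<phi> t) \<in> Hardy p" by (rule Hardy_diff[OF X phi p])
      fix n :: int assume "n \<ge> 0"
      have "fourier_coeff (\<lambda>t. g t * (?X t - \<phi> t)) n = fourier_coeff (\<lambda>t. g t * ?X t) n - fourier_coeff (\<lambda>t. g t * \<phi> t) n"
        unfolding right_diff_distrib by (rule fourier_coeff_diff[OF i])
      also have "\<dots> = 0"
        using \<open>n \<ge> 0\<close> HardyD(2)[OF phi, of "- n"] gm_pos[of n]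
        by (cases "n = 0") (auto simp: gX gphi 2 gm1 phi_0 s)
      finally show "fourier_coeff (\<lambda>t. g t * (?X t - \<phi> t)) n = 0" .
    qed
    then have "AE t in \<mu>. gp t = inverse (\<phi> t)"
      by eventually_elim (metis eq_iff_diff_eq_0 inverse_inverse_eq)
    then have "fourier_coeff gp 0 = fourier_coeff (\<lambda>t. inverse (\<phi> t)) 0"
      by (intro fourier_coeff_cong_AE) auto
    then show ?thesis by (simp add: fourier_coeff_inverse_phi recip_coeff_0)
  next
    case 3
    \<comment> \<open>Here T(g) applied to 1/gp is not zero, so injectivity gives no contradiction.
      Instead t^\<nu> \<phi> gp = s \<phi>(1/t) / gm: the left side has only frequencies at least
      \<nu> > 0, the right side only frequencies at most 0.\<close>
    let ?u = "\<lambda>t. \<phi> t * gp t" and ?w = "\<lambda>t. \<phi> t * reflect (\<lambda>t. inverse (gm t)) t"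
    have w: "reflect (\<lambda>t. inverse (gm t)) \<in> Hardy ?q"
      using igm Lp_reflect[OF igmL] by (auto simp: Hardy_def conj_Hardy_def fourier_coeff_reflect)
    note [measurable] = LpD(1)[OF HardyD(1)[OF w]]
    have "AE t in \<mu>. t powi \<nu> * ?u t = s * reflect ?w t"
      using g_phi g_eq gm0
    proof eventually_elim
      case (elim t)
      have "s * reflect ?w t = (s * \<phi> (1 / t)) * inverse (gm t)" by (simp add: reflect_def mult.assoc)
      also have "s * \<phi> (1 / t) = gm t * t powi \<nu> * gp t * \<phi> t" using elim by simp
      finally show ?case using elim(3) by (simp add: mult_ac)
    qed
    then have "fourier_coeff (\<lambda>t. t powi \<nu> * ?u t) n = fourier_coeff (\<lambda>t. s * reflect ?w t) n" for n
      by (intro fourier_coeff_cong_AE) auto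
    then have rel: "fourier_coeff ?u (n - \<nu>) = s * fourier_coeff ?w (- n)" for n
      unfolding fourier_coeff_shift fourier_coeff_cmult by (subst (asm) fourier_coeff_reflect) auto
    have "fourier_coeff ?u n = 0" for n
    proof (cases "n < 0")
      case True
      then show ?thesis by (rule Hardy_mult_coeff[OF p phi gp])
    next
      case False
      then have "- (n + \<nu>) < 0" using 3 by simp
      from Hardy_mult_coeff[OF p phi w this] show ?thesis using rel[of "n + \<nu>"] by simp
    qed
    then have "AE t in \<mu>. ?u t = 0" by (intro fourier_unique holder(1)[OF p phi_Lp gpL])
    then have "AE t in \<mu>. False" using phi_nonzero gp0 by eventually_elim simp
    then show ?thesis by simp
  qed
qed

end

theorem proposition5p5:
  fixes p :: real and g :: "complex \<Rightarrow> complex"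
  assumes "1 < p"
    and "g \<in> Linf"
    and "matching g"
    and "invertible_operator_Hardy p (toeplitz p g)"
    and "continuous (at 1 within unit_circle) g \<or> continuous (at (-1) within unit_circle) g"
  shows "(continuous (at 1 within unit_circle) g \<longrightarrow> factorization_signature p g = g 1) \<and>
         (continuous (at (-1) within unit_circle) g \<longrightarrow> factorization_signature p g = g (-1))"
proof -
  obtain B C where B: "bounded_operator_Hardy p B" and C: "C > 0"
    and inv: "\<And>f F. f \<in> Hardy p \<Longrightarrow> F \<in> Hardy p \<Longrightarrow>
       (\<And>n. n \<ge> 0 \<Longrightarrow> fourier_coeff (\<lambda>t. g t * f t) n = fourier_coeff F n) \<Longrightarrow>
       (AE t in \<mu>. B F t = f t) \<and> Lp_norm p f \<le> C * Lp_norm p F"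
    and surj: "\<And>F. F \<in> Hardy p \<Longrightarrow> \<exists>f\<in>Hardy p. \<forall>n\<ge>0. fourier_coeff (\<lambda>t. g t * f t) n = fourier_coeff F n"
    using invertible_toeplitz[OF assms(1,2,4)] by blast
  obtain \<phi> s where "matching_toeplitz p g \<phi> s C"
    using matching_toeplitzI[OF assms(1-3) C conjunct2[OF inv] surj] by blast
  then interpret matching_toeplitz p g \<phi> s C .
  \<comment> \<open>The definite description needs one factorization with the value s and the same
    value for every other factorization.\<close>
  have "factorization_signature p g = s"
    unfolding factorization_signature_def
  proof (rule the_equality)
    have "wiener_hopf_factorization p g (\<lambda>t. s * \<phi> (1 / t)) 0 (\<lambda>t. inverse (\<phi> t))"
      by (rule factorization_exists[OF B conjunct1[OF inv]])
    then show "\<exists>gm \<nu> gp. wiener_hopf_factorization p g gm \<nu> gp \<and> s = fourier_coeff gp 0"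
      using factorization_unique by metis
    show "s' = s" if "\<exists>gm \<nu> gp. wiener_hopf_factorization p g gm \<nu> gp \<and> s' = fourier_coeff gp 0" for s'
      using that factorization_unique by blast
  qed
  then show ?thesis using value_at_fixed_point by auto
qed

end
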